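(* Let $M_{\mathbb{Z}}=\operatorname{PSL}_2(\mathbb{Z})\backslash\mathbb{H}^2_{\mathbb{R}}$ be the modular orbifold. The number $\mathcal{N}_A(s)$ of ambiguous primitive closed geodesics of length at most $s$ in $M_{\mathbb{Z}}$ satisfies, as $s\to+\infty$, \[ \mathcal{N}_A(s)=\frac{3}{4\,\pi^2}\;s^2\,e^{\frac s2}+O\big(s\,e^{\frac s2}\big). \] The number $\mathcal{N}_{AR}(s)$ of primitive closed geodesics of length at most $s$ in $M_{\mathbb{Z}}$ that are both ambiguous and reciprocal satisfies, as $s\to+\infty$, \[ \mathcal{N}_{AR}(s)=\frac{3}{8\,\pi}\;s\,e^{\frac s4}+O\big(e^{\frac s4}\big). \]
   Context: $\mathbb{H}^2_{\mathbb{R}}$ is the upper halfplane, $\Gamma_{\mathbb{Z}}=\operatorname{PSL}_2(\mathbb{Z})$ acting by homographies. Let $\widetilde\Delta$ be the geodesic line with endpoints $0,\infty$ and $\widetilde\Delta_1$ the geodesic line with endpoints $0,2$; $\Delta,\Delta_1$ are their images in $M_{\mathbb{Z}}$. Closed geodesics are oriented but not pointed, and understood in the orbifold sense: primitive closed geodesics of $M_{\mathbb{Z}}$ correspond bijectively to conjugacy classes in $\Gamma_{\mathbb{Z}}$ of primitive hyperbolic elements $\gamma$ (those that are not proper powers in $\Gamma_{\mathbb{Z}}$), the closed geodesic being the image of the oriented segment $[a,\gamma a]$ for any $a$ on the translation axis of $\gamma$, and its length being the translation length of $\gamma$. A closed geodesic is ambiguous if it meets $\Delta$ or $\Delta_1$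 perpendicularly (i.e. the axis of $\gamma$ meets perpendicularly some $\Gamma_{\mathbb{Z}}$-translate of $\widetilde\Delta$ or $\widetilde\Delta_1$), and reciprocal if it contains the point $\Gamma_{\mathbb{Z}}\, i$ (i.e. the axis of $\gamma$ contains a point of the orbit $\Gamma_{\mathbb{Z}}\cdot i$). *)

theory Defs
  imports
    "HOL-Analysis.Analysis"
    "HOL-Algebra.Group_Action"
    "HOL-Library.Landau_Symbols"
begin

section \<open>The upper half-plane\<close>

definition uhp :: "complex set" where
  "uhp = {z. 0 < Im z}"

text \<open>The distance of the metric \<open>|dz|\<^sup>2 / (Im z)\<^sup>2\<close>, of curvature \<open>-1\<close>.\<close>

definition hyp_dist :: "complex \<Rightarrow> complex \<Rightarrow> real" where
  "hyp_dist z w = arcosh (1 + (cmod (z - w))\<^sup>2 / (2 * Im z * Im w))"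

definition hyp_geodesic :: "(real \<Rightarrow> complex) \<Rightarrow> bool" where
  "hyp_geodesic c \<longleftrightarrow> range c \<subseteq> uhp \<and> (\<forall>s t. hyp_dist (c s) (c t) = \<bar>s - t\<bar>)"

text \<open>The hyperbolic metric is conformal to the Euclidean one, so the angle between two geodesic
  lines is the Euclidean angle between their velocity vectors; these do not vanish, since the
  parametrisations have unit hyperbolic speed.\<close>

definition meet_perpendicularly :: "complex set \<Rightarrow> complex set \<Rightarrow> bool" where
  "meet_perpendicularly L L' \<longleftrightarrow>
     (\<exists>c c' v v'. hyp_geodesic c \<and> range c = L \<and> hyp_geodesic c' \<and> range c' = L' \<and> c 0 = c' 0 \<and>
        (c has_vector_derivative v) (at 0) \<and> (c' has_vector_derivative v') (at 0) \<and>
        inner v v' = 0)"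

text \<open>The geodesic lines with endpoints \<open>0, \<infinity>\<close> and \<open>0, 2\<close>.\<close>

definition line_0_inf :: "complex set" where
  "line_0_inf = {z \<in> uhp. Re z = 0}"

definition line_0_2 :: "complex set" where
  "line_0_2 = {z \<in> uhp. cmod (z - 1) = 1}"

section \<open>The modular group\<close>

definition SL2Z :: "(int ^ 2 ^ 2) monoid" where
  "SL2Z = \<lparr>carrier = {A. det A = 1}, mult = (**), one = mat 1\<rparr>"

definition PSL2Z :: "(int ^ 2 ^ 2) set monoid" where
  "PSL2Z = SL2Z Mod {mat 1, - mat 1}"

definition mat_act :: "int ^ 2 ^ 2 \<Rightarrow> complex \<Rightarrow> complex" where
  "mat_act A = moebius (of_int (A $ 1 $ 1)) (of_int (A $ 1 $ 2))
                       (of_int (A $ 2 $ 1)) (of_int (A $ 2 $ 2))"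

text \<open>An element of \<open>PSL2Z\<close> is a coset \<open>{A, -A}\<close>, and both representatives act in the same way.\<close>

definition psl_act :: "(int ^ 2 ^ 2) set \<Rightarrow> complex \<Rightarrow> complex" where
  "psl_act \<gamma> z = the_elem ((\<lambda>A. mat_act A z) ` \<gamma>)"

definition hyperbolic :: "(int ^ 2 ^ 2) set \<Rightarrow> bool" where
  "hyperbolic \<gamma> \<longleftrightarrow> (\<forall>A \<in> \<gamma>. 2 < \<bar>trace A\<bar>)"

definition primitive :: "(int ^ 2 ^ 2) set \<Rightarrow> bool" where
  "primitive \<gamma> \<longleftrightarrow> \<not> (\<exists>\<delta> \<in> carrier PSL2Z. \<exists>n::nat. 2 \<le> n \<and> \<gamma> = \<delta> [^]\<^bsub>PSL2Z\<^esub> n)"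

definition translation_length :: "(int ^ 2 ^ 2) set \<Rightarrow> real" where
  "translation_length \<gamma> = (INF z \<in> uhp. hyp_dist z (psl_act \<gamma> z))"

text \<open>The set of points that \<open>\<gamma>\<close> moves by exactly its translation length; for hyperbolic
  \<open>\<gamma>\<close> it is the geodesic line along which \<open>\<gamma>\<close> translates.\<close>

definition axis :: "(int ^ 2 ^ 2) set \<Rightarrow> complex set" where
  "axis \<gamma> = {z \<in> uhp. hyp_dist z (psl_act \<gamma> z) = translation_length \<gamma>}"

section \<open>Closed geodesics of the modular orbifold\<close>

definition conj_class :: "(int ^ 2 ^ 2) set \<Rightarrow> (int ^ 2 ^ 2) set set" where
  "conj_class = orbit PSL2Z (\<lambda>\<delta> \<gamma>. \<delta> \<otimes>\<^bsub>PSL2Z\<^esub> \<gamma> \<otimes>\<^bsub>PSL2Z\<^esub> inv\<^bsub>PSL2Z\<^esub> \<delta>)"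

text \<open>An oriented, unpointed primitive closed geodesic is encoded by the conjugacy class of the
  primitive hyperbolic elements along whose axes it lifts. The length and the two properties below
  are conjugacy invariant, so they do not depend on the chosen element of the class.\<close>

definition primitive_closed_geodesics :: "(int ^ 2 ^ 2) set set set" where
  "primitive_closed_geodesics =
     conj_class ` {\<gamma> \<in> carrier PSL2Z. hyperbolic \<gamma> \<and> primitive \<gamma>}"

definition geodesic_length :: "(int ^ 2 ^ 2) set set \<Rightarrow> real" where
  "geodesic_length C = the_elem (translation_length ` C)"

definition ambiguous :: "(int ^ 2 ^ 2) set set \<Rightarrow> bool" where
  "ambiguous C \<longleftrightarrow>
     (\<exists>\<gamma> \<in> C. \<exists>\<delta> \<in> carrier PSL2Z. \<exists>L \<in> {line_0_inf, line_0_2}.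
        meet_perpendicularly (axis \<gamma>) (psl_act \<delta> ` L))"

definition reciprocal :: "(int ^ 2 ^ 2) set set \<Rightarrow> bool" where
  "reciprocal C \<longleftrightarrow> (\<exists>\<gamma> \<in> C. axis \<gamma> \<inter> orbit PSL2Z psl_act \<i> \<noteq> {})"

definition N_A :: "real \<Rightarrow> nat" where
  "N_A s = card {C \<in> primitive_closed_geodesics. geodesic_length C \<le> s \<and> ambiguous C}"

definition N_AR :: "real \<Rightarrow> nat" where
  "N_AR s = card {C \<in> primitive_closed_geodesics.
                    geodesic_length C \<le> s \<and> ambiguous C \<and> reciprocal C}"

section \<open>Basic facts\<close>

lemma group_SL2Z: "group SL2Z"
proof (rule groupI)
  fix A assume A: "A \<in> carrier SL2Z"
  define B :: "int^2^2" where
    "B = vector [vector [A$2$2, - A$1$2], vector [- A$2$1, A$1$1]]"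
  have "B \<in> carrier SL2Z" "B \<otimes>\<^bsub>SL2Z\<^esub> A = \<one>\<^bsub>SL2Z\<^esub>"
    using A by (auto simp: SL2Z_def B_def det_2 matrix_matrix_mult_def sum_2 vec_eq_iff
                           forall_2 mat_def algebra_simps)
  then show "\<exists>B\<in>carrier SL2Z. B \<otimes>\<^bsub>SL2Z\<^esub> A = \<one>\<^bsub>SL2Z\<^esub>" by blast
qed (auto simp: SL2Z_def det_mul matrix_mul_assoc)

lemma normal_pm1: "{mat 1, - mat 1} \<lhd> SL2Z"
proof -
  interpret group SL2Z by (rule group_SL2Z)
  have m: "(- mat 1) ** A = - A" "A ** (- mat 1) = - A" for A :: "int^2^2"
    by (auto simp: matrix_matrix_mult_def sum_2 vec_eq_iff forall_2 mat_def)
  have d: "- mat 1 \<in> carrier SL2Z"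
    by (simp add: SL2Z_def det_2 mat_def)
  have i: "inv\<^bsub>SL2Z\<^esub> (- mat 1) = - mat 1"
    by (rule inv_equality) (use d in \<open>auto simp: SL2Z_def m\<close>)
  have i1: "inv\<^bsub>SL2Z\<^esub> (mat 1) = mat 1"
    using inv_one by (simp add: SL2Z_def)
  have "subgroup {mat 1, - mat 1} SL2Z"
    by unfold_locales (use d i i1 in \<open>auto simp: SL2Z_def m\<close>)
  then show ?thesis
    by (rule normalI) (auto simp: r_coset_def l_coset_def SL2Z_def m)
qed

lemma group_PSL2Z: "group PSL2Z"
  unfolding PSL2Z_def by (rule normal.factorgroup_is_group[OF normal_pm1])

lemma carrier_PSL2Z: "carrier PSL2Z = {{A, - A} | A. det A = 1}"
proof -
  have "(- mat 1) ** A = - A" for A :: "int^2^2"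
    by (auto simp: matrix_matrix_mult_def sum_2 vec_eq_iff forall_2 mat_def)
  then show ?thesis
    by (auto simp: PSL2Z_def carrier_FactGroup r_coset_def SL2Z_def)
qed

lemma psl_act_rep: "psl_act {A, - A} = mat_act A"
proof
  fix z
  have "mat_act (- A) z = mat_act A z"
  proof -
    let ?p = "of_int (A$1$1) * z + of_int (A$1$2)" and ?q = "of_int (A$2$1) * z + of_int (A$2$2)"
    have "mat_act (- A) z = (- ?p) / (- ?q)"
      by (simp add: mat_act_def moebius_def)
    also have "\<dots> = ?p / ?q"
      by (rule minus_divide_divide)
    finally show ?thesis
      by (simp add: mat_act_def moebius_def)
  qed
  then show "psl_act {A, - A} z = mat_act A z"
    by (simp add: psl_act_def)
qed

lemma arcosh_cosh_abs: "arcosh (cosh x) = \<bar>x\<bar>" for x :: real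
  using arcosh_cosh_real[of "\<bar>x\<bar>"] by simp

lemma hyp_geodesic_0_inf:
  defines "c \<equiv> \<lambda>t::real. Complex 0 (exp t)"
  shows "hyp_geodesic c" "range c = line_0_inf"
proof -
  have "1 + (exp s - exp t)\<^sup>2 / (2 * exp s * exp t) = cosh \<bar>s - t\<bar>" for s t :: real
    by (simp add: cosh_def exp_minus exp_diff field_simps power2_eq_square abs_if)
  then show "hyp_geodesic c"
    by (auto simp: hyp_geodesic_def c_def uhp_def hyp_dist_def cmod_def arcosh_cosh_abs)
  have "z \<in> range c" if "0 < Im z" "Re z = 0" for z
    using that by (intro range_eqI[of _ _ "ln (Im z)"]) (simp add: c_def complex_eq_iff)
  then show "range c = line_0_inf"
    by (auto simp: line_0_inf_def uhp_def c_def)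
qed

lemma hyp_geodesic_0_2:
  defines "c \<equiv> \<lambda>t::real. Complex (1 + tanh t) (1 / cosh t)"
  shows "hyp_geodesic c" "range c = line_0_2"
proof -
  have sq: "(tanh t)\<^sup>2 + (1 / cosh t)\<^sup>2 = 1" for t :: real
  proof -
    have "(tanh t)\<^sup>2 + (1 / cosh t)\<^sup>2 = ((sinh t)\<^sup>2 + 1) / (cosh t)\<^sup>2"
      unfolding tanh_def power_divide add_divide_distrib by simp
    also have "\<dots> = 1"
      unfolding cosh_square_eq[symmetric] by (rule divide_self) simp
    finally show ?thesis .
  qed
  have dist: "1 + ((tanh s - tanh t)\<^sup>2 + (1 / cosh s - 1 / cosh t)\<^sup>2) / (2 * (1 / cosh s) * (1 / cosh t))
          = cosh \<bar>s - t\<bar>" for s t :: real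
  proof -
    have pos: "cosh s > 0" "cosh t > 0" by simp_all
    have "(tanh s - tanh t)\<^sup>2 + (1 / cosh s - 1 / cosh t)\<^sup>2
            = 2 - 2 * tanh s * tanh t - 2 * (1 / cosh s) * (1 / cosh t)"
      using sq[of s] sq[of t] by (simp add: power2_diff)
    also have "1 + \<dots> / (2 * (1 / cosh s) * (1 / cosh t)) = cosh s * cosh t - sinh s * sinh t"
      using pos by (simp add: tanh_def field_simps)
    also have "\<dots> = cosh \<bar>s - t\<bar>"
      by (simp add: cosh_diff abs_if)
    finally show ?thesis .
  qed
  have "hyp_dist (c s) (c t) = arcosh (cosh \<bar>s - t\<bar>)" for s t
    unfolding dist[symmetric] hyp_dist_def by (simp add: c_def cmod_power2)
  then show "hyp_geodesic c"
    by (auto simp: hyp_geodesic_def c_def uhp_def arcosh_cosh_abs)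
  have "z \<in> range c" if z: "0 < Im z" "cmod (z - 1) = 1" for z
  proof -
    have e: "(Re z - 1)\<^sup>2 + (Im z)\<^sup>2 = 1"
      using z(2) by (simp add: cmod_def)
    moreover have "0 < (Im z)\<^sup>2"
      using z(1) by simp
    ultimately have "(Re z - 1)\<^sup>2 < 1"
      by linarith
    then have lt: "\<bar>Re z - 1\<bar> < 1"
      by (simp add: abs_square_less_1)
    define r where "r = Re z / (2 - Re z)"
    define t where "t = ln (sqrt r)"
    have "0 < r"
      using lt by (simp add: r_def)
    then have "tanh t = (r - 1) / (r + 1)"
      by (simp add: t_def tanh_ln_real)
    also have "\<dots> = Re z - 1"
      using lt by (simp add: r_def field_simps)
    finally have th: "tanh t = Re z - 1" .
    have "(1 / cosh t)\<^sup>2 = (Im z)\<^sup>2"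
      using sq[of t] e th by simp
    then have "1 / cosh t = Im z"
      using z(1) by (simp add: power2_eq_iff_nonneg less_imp_le)
    then have "z = c t"
      using th by (simp add: c_def complex_eq_iff)
    then show ?thesis by blast
  qed
  moreover have "c t \<in> line_0_2" for t
    using sq[of t] by (simp add: line_0_2_def uhp_def c_def cmod_def)
  ultimately show "range c = line_0_2"
    by (auto simp: line_0_2_def uhp_def)
qed

end

(*
  An ambiguous primitive closed geodesic is inverted by a reflection R of PGL_2(Z) whose mirror is
  perpendicular to it.  Every reflection is conjugate in SL_2(Z) to exactly one of the reflections
  J n : z |-> n - conj(z), n = 0, 1, and the reflections inverting a primitive hyperbolic A form the
  set {R A^k, -R A^k}, which has four orbits under conjugation by the centralizer {A^k, -A^k} (signs
  of R count).  So each ambiguous class is represented by exactly four matrices A' inverted by some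
  J n.  Such an A' = (a b; c d) has a = d + n c and c | d^2 - 1, so the classes are counted by
  solutions of quadratic congruences.  An ambiguous class is also reciprocal iff A is the square of
  a matrix of determinant -1 inverted by the same J n, which leads to c | d^2 + 1 and to halved
  length.  Swapping the two ends of the mirror of J n allows one to bound c by the trace, after which
  counting d in residue classes modulo c gives, for traces up to W, the main term
  2 W (R(W/2) + R(W)), where R(x) is the sum of rho(c)/c over c <= x and rho(c) the number of
  solutions of d^2 = 1 (resp. -1) modulo c.

  The classification of reflections (resp. of elements of order 2) turns rho(c) into the number of
  primitive representations of c by q (2 p - n q) (resp. p^2 + q^2).  The sum of 1/form over all
  representations is elementary, and coprimality costs a factor 6/pi^2.
*)

theory Submission
  imports Defs
begin

section \<open>Algebra of SL_2(Z): involutions, centralizers, square roots\<close>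

section \<open>Integral \<open>2 \<times> 2\<close> matrices\<close>

text \<open>Conjugation by \<open>A ^ k\<close> multiplies an inverting reflection by an even power
  of \<open>A\<close>; sign and parity of the exponent survive, hence four orbits. Primitivity
  enters because it makes \<open>A\<close> and -1 generate the centralizer.

  The difficulty is an error term one logarithm below the main term. Counting d modulo c is accurate
  only while c is at most of the order of the trace W, but c divides a number of size W^2 and can be
  that large. Swapping the ends of the mirror exchanges c with a cofactor of about W^2 / c. The
  remaining error is a multiple of the sum of rho(c) for c <= W, which is O(W log W) for d^2 = 1 and
  O(W) for d^2 = -1.

  Non-primitive matrices have to be negligible as well. Ambiguous ones are powers of matrices whose
  trace is about sqrt W at most. In the reciprocal case A = \<epsilon>^2 has trace about W^2, and
  roots of exponent 2 in SL_2(Z), with traces up to about W, would outnumber the main term. They do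
  not exist: such a root D makes \<epsilon> D^{-1} an involution of determinant -1 commuting with A.
  Exponents are therefore odd, at least 3, and traces at most about W^(2/3).\<close>

datatype mat2 = Mat2 (m11: int) (m12: int) (m21: int) (m22: int)

text \<open>On \<open>int ^ 2 ^ 2\<close> the symbol \<open>*\<close> is the componentwise product.
  The copy \<open>mat2\<close> makes the matrix product the ring multiplication, so that
  \<open>^\<close> and the ring lemmas speak of matrix powers.\<close>

instantiation mat2 :: ring_1
begin

definition "0 = Mat2 0 0 0 0"
definition "1 = Mat2 1 0 0 1"
definition "M + N = Mat2 (m11 M + m11 N) (m12 M + m12 N) (m21 M + m21 N) (m22 M + m22 N)"
definition "M - N = Mat2 (m11 M - m11 N) (m12 M - m12 N) (m21 M - m21 N) (m22 M - m22 N)"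
definition "- M = Mat2 (- m11 M) (- m12 M) (- m21 M) (- m22 M)"
definition "M * N = Mat2 (m11 M * m11 N + m12 M * m21 N) (m11 M * m12 N + m12 M * m22 N)
                         (m21 M * m11 N + m22 M * m21 N) (m21 M * m12 N + m22 M * m22 N)"

lemmas mat2_defs =
  zero_mat2_def one_mat2_def plus_mat2_def minus_mat2_def uminus_mat2_def times_mat2_def

instance
  by standard (simp_all add: mat2_defs mat2.expand algebra_simps)

end

definition dt :: "mat2 \<Rightarrow> int" where "dt M = m11 M * m22 M - m12 M * m21 M"
definition tr :: "mat2 \<Rightarrow> int" where "tr M = m11 M + m22 M"
text \<open>The adjugate, which is the inverse when \<open>dt M = 1\<close>; being polynomial in the
  entries it avoids division.\<close>

definition adj :: "mat2 \<Rightarrow> mat2" where "adj M = Mat2 (m22 M) (- m12 M) (- m21 M) (m11 M)"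

lemma mat2_eq_iff:
  "M = N \<longleftrightarrow> m11 M = m11 N \<and> m12 M = m12 N \<and> m21 M = m21 N \<and> m22 M = m22 N"
  by (cases M; cases N) simp

lemma of_int_mat2: "(of_int k :: mat2) = Mat2 k 0 0 k"
proof -
  have "(of_nat n :: mat2) = Mat2 (int n) 0 0 (int n)" for n
    by (induction n) (simp_all add: mat2_defs)
  then show ?thesis
    by (cases k) (simp_all add: mat2_defs)
qed

lemma sel_mat2 [simp]:
  "m11 0 = 0" "m12 0 = 0" "m21 0 = 0" "m22 0 = 0"
  "m11 1 = 1" "m12 1 = 0" "m21 1 = 0" "m22 1 = 1"
  "m11 (of_int k) = k" "m12 (of_int k) = 0" "m21 (of_int k) = 0" "m22 (of_int k) = k"
  "m11 (M + N) = m11 M + m11 N" "m12 (M + N) = m12 M + m12 N"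
  "m21 (M + N) = m21 M + m21 N" "m22 (M + N) = m22 M + m22 N"
  "m11 (M - N) = m11 M - m11 N" "m12 (M - N) = m12 M - m12 N"
  "m21 (M - N) = m21 M - m21 N" "m22 (M - N) = m22 M - m22 N"
  "m11 (- M) = - m11 M" "m12 (- M) = - m12 M" "m21 (- M) = - m21 M" "m22 (- M) = - m22 M"
  "m11 (adj M) = m22 M" "m12 (adj M) = - m12 M" "m21 (adj M) = - m21 M" "m22 (adj M) = m11 M"
  by (simp_all add: mat2_defs adj_def of_int_mat2)

lemma sel_times:
  "m11 (M * N) = m11 M * m11 N + m12 M * m21 N" "m12 (M * N) = m11 M * m12 N + m12 M * m22 N"
  "m21 (M * N) = m21 M * m11 N + m22 M * m21 N" "m22 (M * N) = m21 M * m12 N + m22 M * m22 N"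
  by (simp_all add: mat2_defs)

lemma dt_mult [simp]: "dt (M * N) = dt M * dt N"
  by (simp add: dt_def sel_times algebra_simps)

lemma dt_simps [simp]: "dt 1 = 1" "dt (- M) = dt M" "dt (adj M) = dt M"
  by (simp_all add: dt_def)

lemma dt_power [simp]: "dt (M ^ n) = dt M ^ n"
  by (induction n) simp_all

lemma tr_simps [simp]:
  "tr 0 = 0" "tr 1 = 2" "tr (- M) = - tr M" "tr (adj M) = tr M"
  "tr (M + N) = tr M + tr N" "tr (M - N) = tr M - tr N" "tr (of_int k) = 2 * k"
  by (simp_all add: tr_def)

lemma tr_of_int_mult [simp]: "tr (of_int k * M) = k * tr M"
  by (simp add: tr_def sel_times algebra_simps)

lemma tr_mult_commute: "tr (M * N) = tr (N * M)"
  by (simp add: tr_def sel_times)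

lemma adj_mult: "adj (M * N) = adj N * adj M"
  by (simp add: mat2_eq_iff sel_times)

lemma adj_simps [simp]: "adj (adj M) = M" "adj 1 = 1" "adj (- M) = - adj M"
  by (simp_all add: mat2_eq_iff)

lemma adj_power: "adj (M ^ n) = adj M ^ n"
  by (induction n) (simp_all add: adj_mult power_commutes)

lemma mult_adj: "M * adj M = of_int (dt M)" "adj M * M = of_int (dt M)"
  by (simp_all add: mat2_eq_iff sel_times dt_def)

lemma mult_adj_1:
  assumes "dt M = 1"
  shows "M * adj M = 1" "adj M * M = 1" "M * (adj M * N) = N" "adj M * (M * N) = N"
    "(N * M) * adj M = N" "(N * adj M) * M = N"
  by (simp_all add: mult_adj assms mult.assoc) (simp_all add: mult_adj assms flip: mult.assoc)

lemma cayley_hamilton: "M * M = of_int (tr M) * M - of_int (dt M)"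
  by (simp add: mat2_eq_iff tr_def dt_def sel_times algebra_simps)

lemma tr_square: "tr (M * M) = (tr M)\<^sup>2 - 2 * dt M"
  by (simp add: tr_def dt_def sel_times power2_eq_square algebra_simps)

definition conj_by :: "mat2 \<Rightarrow> mat2 \<Rightarrow> mat2" where
  "conj_by g M = g * M * adj g"

lemma conj_by_conj_by: "conj_by g (conj_by h M) = conj_by (g * h) M"
  by (simp add: conj_by_def adj_mult mult.assoc)

lemma conj_by_1 [simp]: "conj_by 1 M = M" "conj_by (-1) M = M"
  by (simp_all add: conj_by_def)

lemma conj_by_minus [simp]: "conj_by g (- M) = - conj_by g M" "conj_by (- g) M = conj_by g M"
  by (simp_all add: conj_by_def)

lemma conj_by_mult: "dt g = 1 \<Longrightarrow> conj_by g (M * N) = conj_by g M * conj_by g N"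
  by (simp add: conj_by_def mult.assoc mult_adj_1)

lemma conj_by_one: "dt g = 1 \<Longrightarrow> conj_by g 1 = 1"
  by (simp add: conj_by_def mult_adj_1)

lemma conj_by_power: "dt g = 1 \<Longrightarrow> conj_by g (M ^ n) = conj_by g M ^ n"
  by (induction n) (simp_all add: conj_by_mult conj_by_one)

lemma dt_conj_by: "dt g = 1 \<Longrightarrow> dt (conj_by g M) = dt M"
  by (simp add: conj_by_def)

lemma tr_conj_by: "dt g = 1 \<Longrightarrow> tr (conj_by g M) = tr M"
  unfolding conj_by_def by (subst tr_mult_commute) (simp add: mult_adj_1 flip: mult.assoc)

lemma conj_by_inverse: "dt g = 1 \<Longrightarrow> conj_by (adj g) (conj_by g M) = M" "dt g = 1 \<Longrightarrow> conj_by g (conj_by (adj g) M) = M"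
  by (simp_all add: conj_by_conj_by mult_adj_1)

lemma conj_by_eq_self_iff: "dt g = 1 \<Longrightarrow> conj_by g M = M \<longleftrightarrow> g * M = M * g"
  unfolding conj_by_def by (metis mult_adj_1(5,6))

section \<open>Elements of the modular group\<close>

definition to_matrix :: "mat2 \<Rightarrow> int ^ 2 ^ 2" where
  "to_matrix M = vector [vector [m11 M, m12 M], vector [m21 M, m22 M]]"

lemma to_matrix_nth [simp]:
  "to_matrix M $ 1 $ 1 = m11 M" "to_matrix M $ 1 $ 2 = m12 M" "to_matrix M $ 2 $ 1 = m21 M" "to_matrix M $ 2 $ 2 = m22 M"
  by (simp_all add: to_matrix_def)

lemma to_matrix_inject [simp]: "to_matrix M = to_matrix N \<longleftrightarrow> M = N"
  by (auto simp: vec_eq_iff forall_2 mat2_eq_iff)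

lemma to_matrix_surj: "\<exists>M. A = to_matrix M"
  by (rule exI[of _ "Mat2 (A$1$1) (A$1$2) (A$2$1) (A$2$2)"]) (simp add: vec_eq_iff forall_2)

lemma to_matrix_simps: "to_matrix M ** to_matrix N = to_matrix (M * N)" "- to_matrix M = to_matrix (- M)" "mat 1 = to_matrix 1"
  "det (to_matrix M) = dt M" "trace (to_matrix M) = tr M"
  by (simp_all add: vec_eq_iff forall_2 matrix_matrix_mult_def sum_2 sel_times mat_def det_2 dt_def
      trace_def tr_def)

definition psl :: "mat2 \<Rightarrow> (int ^ 2 ^ 2) set" where
  "psl M = {to_matrix M, - to_matrix M}"

lemma psl_eq_iff: "psl M = psl N \<longleftrightarrow> M = N \<or> M = - N"
  by (auto simp: psl_def to_matrix_simps doubleton_eq_iff)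

lemma carrier_PSL2Z_psl: "carrier PSL2Z = {psl M | M. dt M = 1}"
  unfolding carrier_PSL2Z psl_def
  by (auto simp: to_matrix_simps) (metis to_matrix_simps(2,4) to_matrix_surj)+

lemma psl_in_carrier [simp]: "dt M = 1 \<Longrightarrow> psl M \<in> carrier PSL2Z"
  by (auto simp: carrier_PSL2Z_psl)

lemma psl_mult: "psl M \<otimes>\<^bsub>PSL2Z\<^esub> psl N = psl (M * N)"
  unfolding PSL2Z_def psl_def
  by (auto simp: FactGroup_def set_mult_def SL2Z_def to_matrix_simps)

lemma psl_one: "\<one>\<^bsub>PSL2Z\<^esub> = psl 1"
  by (simp add: PSL2Z_def psl_def to_matrix_simps)

lemma psl_inv: "dt M = 1 \<Longrightarrow> inv\<^bsub>PSL2Z\<^esub> (psl M) = psl (adj M)"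
  by (rule group.inv_equality[OF group_PSL2Z]) (simp_all add: psl_mult psl_one mult_adj_1)

lemma psl_power: "psl M [^]\<^bsub>PSL2Z\<^esub> (n::nat) = psl (M ^ n)"
  by (induction n) (simp_all add: psl_one psl_mult power_commutes nat_pow_def)

lemma conj_class_psl: "conj_class (psl M) = {psl (conj_by g M) | g. dt g = 1}"
proof -
  have "psl g \<otimes>\<^bsub>PSL2Z\<^esub> psl M \<otimes>\<^bsub>PSL2Z\<^esub> inv\<^bsub>PSL2Z\<^esub> psl g = psl (conj_by g M)" if "dt g = 1" for g
    using that by (simp add: psl_inv psl_mult conj_by_def)
  then show ?thesis
    by (fastforce simp: conj_class_def orbit_def carrier_PSL2Z_psl)
qed

text \<open>Of the two matrices in a hyperbolic coset, the one with positive trace. Fixing the sign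
  this way turns conjugacy in PSL_2(Z) into conjugacy in SL_2(Z).\<close>

definition hyp_rep :: "mat2 \<Rightarrow> bool" where
  "hyp_rep M \<longleftrightarrow> dt M = 1 \<and> 2 < tr M"

text \<open>Both signs of \<open>B ^ n\<close> are listed because being a proper power is a
  condition in PSL_2(Z).\<close>

definition prim_rep :: "mat2 \<Rightarrow> bool" where
  "prim_rep M \<longleftrightarrow> \<not> (\<exists>B n. dt B = 1 \<and> 2 \<le> n \<and> (M = B ^ n \<or> M = - (B ^ n)))"

lemma hyperbolic_psl: "hyperbolic (psl M) \<longleftrightarrow> 2 < \<bar>tr M\<bar>"
  by (simp add: hyperbolic_def psl_def to_matrix_simps)

lemma primitive_psl: "primitive (psl M) \<longleftrightarrow> prim_rep M"
proof -
  have "primitive (psl M) \<longleftrightarrow> \<not> (\<exists>B n. dt B = 1 \<and> 2 \<le> n \<and> psl M = psl B [^]\<^bsub>PSL2Z\<^esub> (n::nat))"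
    unfolding primitive_def carrier_PSL2Z_psl by blast
  then show ?thesis
    by (simp add: psl_power psl_eq_iff prim_rep_def)
qed

lemma psl_act_psl:
  "psl_act (psl M) z = (of_int (m11 M) * z + of_int (m12 M)) / (of_int (m21 M) * z + of_int (m22 M))"
  by (simp add: psl_def psl_act_rep mat_act_def moebius_def)

lemma hyp_prim_cases:
  assumes "\<gamma> \<in> carrier PSL2Z" "hyperbolic \<gamma>" "primitive \<gamma>"
  obtains M where "\<gamma> = psl M" "hyp_rep M" "prim_rep M"
proof -
  obtain M where M: "\<gamma> = psl M" "dt M = 1"
    using assms(1) by (auto simp: carrier_PSL2Z_psl)
  show ?thesis
  proof (cases "tr M > 0")
    case True
    then show ?thesis using M assms that[of M] by (auto simp: hyperbolic_psl primitive_psl hyp_rep_def)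
  next
    case False
    have "\<gamma> = psl (- M)" using M by (simp add: psl_eq_iff)
    then show ?thesis using M assms that[of "- M"] False
      by (auto simp: hyperbolic_psl primitive_psl hyp_rep_def)
  qed
qed

lemma prim_rep_conj: "dt g = 1 \<Longrightarrow> prim_rep (conj_by g M) \<longleftrightarrow> prim_rep M"
proof -
  have "prim_rep (conj_by g M)" if "prim_rep M" "dt g = 1" for g M
    unfolding prim_rep_def
  proof clarify
    fix B n assume B: "dt B = 1" "2 \<le> n" "conj_by g M = B ^ n \<or> conj_by g M = - (B ^ n)"
    have "M = conj_by (adj g) B ^ n \<or> M = - (conj_by (adj g) B ^ n)"
      using B(3) that(2) by (metis conj_by_inverse(1) conj_by_minus(1) conj_by_power dt_simps(3))
    then show False
      using that B by (auto simp: prim_rep_def dt_conj_by)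
  qed
  from this[of M g] this[of "conj_by g M" "adj g"] show "dt g = 1 \<Longrightarrow> ?thesis"
    by (auto simp: conj_by_inverse)
qed

lemma hyp_rep_conj: "dt g = 1 \<Longrightarrow> hyp_rep (conj_by g M) \<longleftrightarrow> hyp_rep M"
  by (simp add: hyp_rep_def dt_conj_by tr_conj_by)

text \<open>Conjugation preserves the trace, so positive traces exclude
  \<open>N = - conj_by g M\<close>, the other way in which the cosets could agree.\<close>

lemma conj_class_eq_iff:
  assumes "dt M = 1" "tr M > 0" "tr N > 0"
  shows "conj_class (psl M) = conj_class (psl N) \<longleftrightarrow> (\<exists>g. dt g = 1 \<and> N = conj_by g M)"
proof
  assume "conj_class (psl M) = conj_class (psl N)"
  moreover have "psl N \<in> conj_class (psl N)"
    unfolding conj_class_psl by (rule CollectI, rule exI[of _ 1]) simp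
  ultimately have "psl N \<in> conj_class (psl M)"
    by simp
  then obtain g where "dt g = 1" "N = conj_by g M \<or> N = - conj_by g M"
    by (auto simp: conj_class_psl psl_eq_iff)
  then show "\<exists>g. dt g = 1 \<and> N = conj_by g M"
    using assms by (metis neg_0_less_iff_less not_less_iff_gr_or_eq tr_conj_by tr_simps(3))
next
  assume "\<exists>g. dt g = 1 \<and> N = conj_by g M"
  then obtain g where g: "dt g = 1" "N = conj_by g M" by blast
  have "\<exists>h'. psl (conj_by h M) = psl (conj_by h' N) \<and> dt h' = 1" if "dt h = 1" for h
    using that g by (intro exI[of _ "h * adj g"]) (simp add: conj_by_conj_by mult_adj_1)
  moreover have "\<exists>h'. psl (conj_by h N) = psl (conj_by h' M) \<and> dt h' = 1" if "dt h = 1" for h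
    using that g by (intro exI[of _ "h * g"]) (simp add: conj_by_conj_by)
  ultimately show "conj_class (psl M) = conj_class (psl N)"
    unfolding conj_class_psl by auto
qed

section \<open>Involutions\<close>

text \<open>As a map of the upper half-plane \<open>J n\<close> fixes the line Re z = n / 2
  pointwise; \<open>S\<close> is the half turn about the point i.\<close>

definition J :: "int \<Rightarrow> mat2" where "J n = Mat2 (-1) n 0 1"
definition S :: mat2 where "S = Mat2 0 (-1) 1 0"
definition T :: "int \<Rightarrow> mat2" where "T k = Mat2 1 k 0 1"

lemma JST_simps [simp]:
  "m11 (J n) = -1" "m12 (J n) = n" "m21 (J n) = 0" "m22 (J n) = 1"
  "m11 S = 0" "m12 S = -1" "m21 S = 1" "m22 S = 0"
  "m11 (T k) = 1" "m12 (T k) = k" "m21 (T k) = 0" "m22 (T k) = 1"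
  "dt (J n) = -1" "tr (J n) = 0" "dt S = 1" "tr S = 0" "dt (T k) = 1"
  by (simp_all add: J_def S_def T_def dt_def tr_def)

text \<open>R has eigenvalue -1 and integral entries, hence a primitive integral eigenvector for it.
  Completing this vector to a matrix \<open>h\<close> of determinant 1 makes the conjugate of R
  upper triangular, and translations then change its corner by even numbers.\<close>

lemma reflection_conj_J:
  assumes "dt R = -1" "tr R = 0"
  obtains g n where "n \<in> {0, 1}" "dt g = 1" "conj_by g R = J n"
proof -
  define x y z where "x = m11 R" "y = m12 R" "z = m21 R"
  have "m22 R = - m11 R" using assms by (simp add: tr_def)
  then have R: "R = Mat2 x y z (- x)" and xyz: "x * x + y * z = 1"
    using assms by (auto simp: mat2_eq_iff tr_def dt_def x_y_z_def)
  \<comment> \<open>By \<open>xyz\<close> the vector (-y, x + 1) solves the eigenvector equation; it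
    vanishes only for y = 0 and x = -1, and then (-2, z) is a solution.\<close>
  obtain w1 w2 :: int where w: "(w1, w2) \<noteq> (0, 0)" "x * w1 + y * w2 = - w1" "z * w1 - x * w2 = - w2"
  proof (cases "y = 0 \<and> x = -1")
    case True
    then show ?thesis by (intro that[of "-2" z]) auto
  next
    case False
    then show ?thesis using xyz by (intro that[of "-y" "x + 1"]) (auto simp: algebra_simps)
  qed
  define k where "k = gcd w1 w2"
  have k: "k \<noteq> 0" using w(1) by (auto simp: k_def)
  define v1 v2 where "v1 = w1 div k" "v2 = w2 div k"
  have wv: "w1 = k * v1" "w2 = k * v2" by (simp_all add: v1_v2_def k_def)
  have "coprime v1 v2"
    unfolding v1_v2_def k_def using w(1) by (intro div_gcd_coprime) auto
  then obtain s r' where "s * v1 + r' * v2 = 1"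
    using bezout_int[of v1 v2] by auto
  then have sr: "v1 * s - v2 * r = 1" if "r = - r'" for r
    by (simp add: that mult.commute)
  define r where "r = - r'"
  note sr = sr[OF r_def]
  have v: "x * v1 + y * v2 = - v1" "z * v1 - x * v2 = - v2"
  proof -
    have "k * (x * v1 + y * v2) = k * (- v1)" "k * (z * v1 - x * v2) = k * (- v2)"
      using w wv by (simp_all add: algebra_simps)
    then show "x * v1 + y * v2 = - v1" "z * v1 - x * v2 = - v2"
      using k by (simp_all only: mult_cancel_left) simp_all
  qed
  define h where "h = Mat2 v1 r v2 s"
  have dth: "dt h = 1" using sr by (simp add: h_def dt_def algebra_simps)
  define R' where "R' = conj_by (adj h) R"
  have Rh1: "m11 (R * h) = - v1" "m21 (R * h) = - v2"
    using v by (simp_all add: R h_def sel_times)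
  define X where "X = R * h"
  have "R' = adj h * X"
    by (simp add: R'_def X_def conj_by_def mult.assoc)
  then have "m11 R' = - (v1 * s - v2 * r)" "m21 R' = 0"
    using Rh1[folded X_def] by (simp_all add: sel_times) (simp_all add: h_def algebra_simps)
  moreover have "tr R' = 0" unfolding R'_def using assms dth by (simp add: tr_conj_by)
  moreover define m where "m = m12 R'"
  ultimately have R': "R' = Mat2 (-1) m 0 1"
    using sr by (simp add: mat2_eq_iff tr_def)
  \<comment> \<open>Conjugation by \<open>T k\<close> adds 2 k to the corner \<open>m\<close>, so
    exactly its parity remains.\<close>
  have "conj_by (T (- (m div 2))) R' = J (m mod 2)"
    using minus_mult_div_eq_mod[of m 2] unfolding R' conj_by_def
    by (simp add: mat2_eq_iff sel_times)
  then have "conj_by (T (- (m div 2)) * adj h) R = J (m mod 2)"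
    by (simp add: R'_def conj_by_conj_by)
  then show ?thesis
    using dth by (intro that[of "m mod 2" "T (- (m div 2)) * adj h"]) auto
qed

text \<open>Comparing entries of \<open>g * J n = J m * g\<close> makes g triangular with equal
  diagonal entries 1 or -1, and then n - m is, up to sign, twice the off-diagonal entry. It follows
  that the matrix which normalizes a reflection is unique up to sign.\<close>

lemma J_conj_J:
  assumes "dt g = 1" "conj_by g (J n) = J m" "n \<in> {0, 1}" "m \<in> {0, 1}"
  shows "n = m" "g = 1 \<or> g = -1"
proof -
  have "g * J n = conj_by g (J n) * g"
    using assms(1) by (simp add: conj_by_def mult_adj_1)
  then have "g * J n = J m * g"
    by (simp add: assms(2))
  then have c: "m21 g = 0" and b: "m11 g * n + m12 g = - m12 g + m * m22 g"
    by (auto simp: mat2_eq_iff sel_times)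
  then have "m11 g * m22 g = 1" using assms(1) by (simp add: dt_def)
  then consider "m11 g = 1" "m22 g = 1" | "m11 g = -1" "m22 g = -1"
    by (auto simp: zmult_eq_1_iff)
  then have "n = m \<and> (g = 1 \<or> g = -1)"
    by cases (use b c assms(3,4) in \<open>auto simp: mat2_eq_iff\<close>, presburger+)
  then show "n = m" "g = 1 \<or> g = -1" by auto
qed

text \<open>Reduction of definite binary quadratic forms: a translation makes the diagonal entry at
  most half the lower left corner in absolute value, and \<open>S\<close> swaps the corners as long
  as this makes the left one smaller. Only \<open>S\<close> and \<open>- S\<close> are
  reduced.\<close>

lemma elliptic_conj_S:
  assumes "dt E = 1" "tr E = 0"
  obtains g where "dt g = 1" "conj_by g E = S \<or> conj_by g E = - S"
proof -
  have "\<exists>g. dt g = 1 \<and> (conj_by g E = S \<or> conj_by g E = - S)"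
    using assms
  proof (induction "nat \<bar>m21 E\<bar>" arbitrary: E rule: less_induct)
    case less
    define x y z where "x = m11 E" "y = m12 E" "z = m21 E"
    have "m22 E = - m11 E" using less.prems by (simp add: tr_def)
  then have E: "E = Mat2 x y z (- x)" and xyz: "x * x + y * z = -1"
      using less.prems by (auto simp: mat2_eq_iff tr_def dt_def x_y_z_def)
    have z0: "z \<noteq> 0"
      using xyz zero_le_square[of x] by (cases "z = 0") auto
    \<comment> \<open>q is x / |z| rounded to a nearest integer; the sign of z is put into
      \<open>k\<close>.\<close>
    define q where "q = (2 * x + \<bar>z\<bar>) div (2 * \<bar>z\<bar>)"
    define k where "k = - q * sgn z"
    define x' where "x' = x + k * z"
    have "x' = x - q * \<bar>z\<bar>"
      by (cases z "0::int" rule: linorder_cases) (simp_all add: x'_def k_def)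
    then have "2 * x' = (2 * x + \<bar>z\<bar>) mod (2 * \<bar>z\<bar>) - \<bar>z\<bar>"
      using minus_mult_div_eq_mod[of "2 * x + \<bar>z\<bar>" "2 * \<bar>z\<bar>", folded q_def] by algebra
    moreover have "0 \<le> (2 * x + \<bar>z\<bar>) mod (2 * \<bar>z\<bar>)" "(2 * x + \<bar>z\<bar>) mod (2 * \<bar>z\<bar>) < 2 * \<bar>z\<bar>"
      using z0 by auto
    ultimately have x'z: "2 * \<bar>x'\<bar> \<le> \<bar>z\<bar>" by linarith
    define E' where "E' = conj_by (T k) E"
    have E'z: "m21 E' = z" "m11 E' = x'"
      by (simp_all add: E'_def E conj_by_def sel_times x'_def)
    have dtE': "dt E' = 1" "tr E' = 0"
      using less.prems by (simp_all add: E'_def dt_conj_by tr_conj_by)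
    define y' where "y' = m12 E'"
    have "m22 E' = - x'" using dtE' E'z by (simp add: tr_def)
    then have E': "E' = Mat2 x' y' z (- x')" and xyz': "x' * x' + y' * z = -1"
      using dtE' E'z by (auto simp: mat2_eq_iff tr_def dt_def y'_def)
    show ?case
    proof (cases "\<bar>y'\<bar> < \<bar>z\<bar>")
      case True
      define E'' where "E'' = conj_by S E'"
      have "m21 E'' = - y'" by (simp add: E''_def E' conj_by_def sel_times)
      moreover have "dt E'' = 1" "tr E'' = 0"
        using dtE' by (simp_all add: E''_def dt_conj_by tr_conj_by)
      ultimately obtain g where g: "dt g = 1" "conj_by g E'' = S \<or> conj_by g E'' = - S"
        using less.hyps[of E''] True z0 by (auto simp: x_y_z_def)
      have "conj_by g E'' = conj_by (g * S * T k) E"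
        by (simp add: E''_def E'_def conj_by_conj_by mult.assoc)
      then show ?thesis using g by (intro exI[of _ "g * S * T k"]) auto
    next
      case False
      \<comment> \<open>No swap helps any more: z^2 <= |y' z| = 1 + x'^2 together with 4 x'^2 <= z^2
        leaves only x' = 0 and y' z = -1.\<close>
      have "\<bar>z\<bar> * \<bar>z\<bar> \<le> \<bar>y'\<bar> * \<bar>z\<bar>" using False by (intro mult_right_mono) auto
      also have "\<dots> = 1 + x' * x'"
        using xyz' zero_le_square[of x'] unfolding abs_mult[symmetric] by linarith
      finally have "\<bar>z\<bar> * \<bar>z\<bar> \<le> 1 + x' * x'" .
      moreover have "(2 * \<bar>x'\<bar>) * (2 * \<bar>x'\<bar>) \<le> \<bar>z\<bar> * \<bar>z\<bar>"
        using x'z by (intro mult_mono) auto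
      ultimately have "\<bar>x'\<bar> * \<bar>x'\<bar> < 1"
        by (simp add: abs_mult[symmetric])
      then have x0: "x' = 0"
        using mult_mono[of 1 "\<bar>x'\<bar>" 1 "\<bar>x'\<bar>"] by linarith
      with xyz' have "y' * z = -1" by simp
      then have "z = 1 \<and> y' = -1 \<or> z = -1 \<and> y' = 1"
        using zmult_eq_1_iff[of "- y'" z] by auto
      then have "E' = S \<or> E' = - S"
        using x0 E' by (auto simp: mat2_eq_iff)
      then show ?thesis unfolding E'_def by (intro exI[of _ "T k"]) auto
    qed
  qed
  then show ?thesis using that by blast
qed

text \<open>Matrices commuting with \<open>S\<close> have the form a + b S and multiply like
  Gaussian integers, so determinant 1 means a^2 + b^2 = 1: the four units.\<close>

lemma S_commute:
  assumes "dt g = 1" "conj_by g S = S"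
  shows "g \<in> {1, -1, S, - S}"
proof -
  have gS: "g * S = S * g" using assms conj_by_eq_self_iff by blast
  have e: "m12 g = - m21 g" "m11 g = m22 g"
    using arg_cong[OF gS, of m11] arg_cong[OF gS, of m21] by (simp_all add: sel_times)
  then have s: "m22 g * m22 g + m21 g * m21 g = 1"
    using assms(1) by (simp add: dt_def)
  have "m22 g * m22 g \<le> 1" "m21 g * m21 g \<le> 1"
    using s zero_le_square[of "m22 g"] zero_le_square[of "m21 g"] by linarith+
  then have "\<bar>m22 g\<bar> \<le> 1" "\<bar>m21 g\<bar> \<le> 1"
    using abs_le_square_iff[of "m22 g" 1] abs_le_square_iff[of "m21 g" 1]
    by (simp_all add: power2_eq_square)
  then have "m22 g \<in> {-1, 0, 1}" "m21 g \<in> {-1, 0, 1}"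
    by auto
  then show ?thesis using s by (elim insertE emptyE) (simp_all add: mat2_eq_iff e)
qed

section \<open>Traces of powers\<close>

lemma tr_power_rec:
  assumes "dt A = 1"
  shows "tr (A ^ Suc (Suc n)) = tr A * tr (A ^ Suc n) - tr (A ^ n)"
proof -
  have "A ^ Suc (Suc n) = (A * A) * A ^ n" by (simp add: mult.assoc)
  also have "\<dots> = of_int (tr A) * A ^ Suc n - A ^ n"
    using assms by (simp add: cayley_hamilton left_diff_distrib mult.assoc)
  finally show ?thesis by simp
qed

text \<open>The two claims support each other: the recursion gives the factor
  \<open>tr A - 1\<close> once the preceding trace is not larger, and this factor is at least 2, so
  the traces keep growing.\<close>

lemma tr_power_mono:
  assumes "hyp_rep A"
  shows "(tr A - 1) * tr (A ^ Suc n) \<le> tr (A ^ Suc (Suc n)) \<and> 2 < tr (A ^ Suc n)"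
proof (induction n)
  case 0
  have "tr A * 2 < tr A * tr A" using assms by (intro mult_strict_left_mono) (auto simp: hyp_rep_def)
  then show ?case using assms tr_square[of A] by (simp add: hyp_rep_def power2_eq_square left_diff_distrib)
next
  case (Suc n)
  have t: "2 < tr A" "dt A = 1" using assms by (auto simp: hyp_rep_def)
  have "2 * tr (A ^ Suc n) \<le> (tr A - 1) * tr (A ^ Suc n)"
    using t Suc by (intro mult_right_mono) auto
  then have "tr (A ^ Suc n) \<le> tr (A ^ Suc (Suc n))" "2 < tr (A ^ Suc (Suc n))"
    using Suc by linarith+
  then show ?case
    using tr_power_rec[OF t(2), of "Suc n"] by (simp add: left_diff_distrib)
qed

lemma tr_power_gt_2: "hyp_rep A \<Longrightarrow> 0 < n \<Longrightarrow> 2 < tr (A ^ n)"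
  using tr_power_mono[of A "n - 1"] by simp

lemma tr_power_ge: 
  assumes "hyp_rep A" "0 < n"
  shows "(tr A - 1) ^ n \<le> tr (A ^ n)"
  using \<open>0 < n\<close>
proof (induction n rule: nat_induct_non_zero)
  case (Suc n)
  have "(tr A - 1) ^ Suc n \<le> (tr A - 1) * tr (A ^ n)"
    using Suc assms by (auto simp: hyp_rep_def intro!: mult_left_mono)
  also have "\<dots> \<le> tr (A ^ Suc n)"
    using tr_power_mono[OF assms(1), of "n - 1"] Suc by simp
  finally show ?case .
qed simp

section \<open>The centralizer of a primitive hyperbolic element\<close>

text \<open>The vector \<open>(\<xi>, 1)\<close> is an eigenvector of \<open>C\<close>, and \<open>eigval \<xi> C\<close> the eigenvalue.\<close>

definition eigval :: "real \<Rightarrow> mat2 \<Rightarrow> real" where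
  "eigval \<xi> C = real_of_int (m21 C) * \<xi> + real_of_int (m22 C)"

definition eigvec :: "real \<Rightarrow> mat2 \<Rightarrow> bool" where
  "eigvec \<xi> C \<longleftrightarrow> real_of_int (m11 C) * \<xi> + real_of_int (m12 C) = \<xi> * eigval \<xi> C"

lemma eigval_mult: "eigvec \<xi> D \<Longrightarrow> eigval \<xi> (C * D) = eigval \<xi> C * eigval \<xi> D"
proof -
  assume D: "eigvec \<xi> D"
  have "eigval \<xi> (C * D) = real_of_int (m21 C) * (real_of_int (m11 D) * \<xi> + real_of_int (m12 D))
      + real_of_int (m22 C) * (real_of_int (m21 D) * \<xi> + real_of_int (m22 D))"
    by (simp add: eigval_def sel_times algebra_simps)
  also have "\<dots> = real_of_int (m21 C) * (\<xi> * eigval \<xi> D) + real_of_int (m22 C) * eigval \<xi> D"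
    using D by (simp add: eigvec_def eigval_def)
  finally show ?thesis by (simp add: eigval_def algebra_simps)
qed

lemma eigval_adj_add: "eigval \<xi> C + eigval \<xi> (adj C) = tr C"
  by (simp add: eigval_def tr_def)

lemma eigval_simps [simp]: "eigval \<xi> 1 = 1" "eigval \<xi> (- C) = - eigval \<xi> C"
  by (simp_all add: eigval_def)

text \<open>A triangular integral matrix of determinant 1 has diagonal entries 1, 1 or -1, -1, hence
  trace 2 or -2.\<close>

lemma hyp_m21_nz: "hyp_rep A \<Longrightarrow> m21 A \<noteq> 0"
  by (auto simp: hyp_rep_def dt_def tr_def zmult_eq_1_iff)

text \<open>Commuting matrices have proportional triples (m21, m11 - m22, m12), that is,
  proportional fixed-point equations; these are two of the proportions.\<close>

lemma commute_entries:
  assumes "C * A = A * C"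
  shows "m21 C * (m11 A - m22 A) = m21 A * (m11 C - m22 C)" "m12 C * m21 A = m12 A * m21 C"
  using arg_cong[OF assms, of m21] arg_cong[OF assms, of m11] by (simp_all add: sel_times algebra_simps)

lemma hyp_eigenvector:
  assumes "hyp_rep A"
  obtains \<xi> where "eigvec \<xi> A" "1 < eigval \<xi> A"
proof -
  define a b c d where "a = real_of_int (m11 A)" "b = real_of_int (m12 A)"
    "c = real_of_int (m21 A)" "d = real_of_int (m22 A)"
  have c: "c \<noteq> 0" using hyp_m21_nz[OF assms] by (simp add: a_b_c_d_def)
  have det: "a * d - b * c = 1" and t: "a + d > 2"
  proof -
    have "real_of_int (dt A) = 1" "real_of_int (tr A) > 2" using assms by (simp_all add: hyp_rep_def)
    then show "a * d - b * c = 1" "a + d > 2" by (simp_all add: a_b_c_d_def dt_def tr_def)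
  qed
  define r where "r = sqrt ((a + d)\<^sup>2 - 4)"
  have "2\<^sup>2 \<le> (a + d)\<^sup>2" using t by (intro power_mono) auto
  then have r2: "r * r = (a + d)\<^sup>2 - 4" and r0: "r \<ge> 0" by (simp_all add: r_def)
  define \<xi> where "\<xi> = (a - d + r) / (2 * c)"
  have cx: "c * \<xi> = (a - d + r) / 2" using c by (simp add: \<xi>_def)
  have "c * (a * \<xi> + b) = c * (\<xi> * (c * \<xi> + d))"
  proof -
    have "c * (a * \<xi> + b) = a * (c * \<xi>) + b * c" by (simp add: algebra_simps)
    also have "\<dots> = (c * \<xi>) * (c * \<xi> + d)"
      unfolding cx using r2 det by (simp add: field_simps power2_eq_square)
    finally show ?thesis by (simp add: algebra_simps)
  qed
  then have "eigvec \<xi> A" using c by (simp add: eigvec_def eigval_def a_b_c_d_def)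
  moreover have "1 < eigval \<xi> A"
  proof -
    have "eigval \<xi> A = (a + d + r) / 2"
      using cx by (simp add: eigval_def a_b_c_d_def field_simps)
    then show ?thesis using t r0 by simp
  qed
  ultimately show ?thesis using that by blast
qed

text \<open>By \<open>commute_entries\<close> the fixed-point equation of C times
  \<open>m21 A\<close> is that of A times \<open>m21 C\<close>, and \<open>m21 A\<close> is
  nonzero.\<close>

lemma eigvec_commute:
  assumes "hyp_rep A" "eigvec \<xi> A" "C * A = A * C"
  shows "eigvec \<xi> C"
proof -
  define a b c d where "a = real_of_int (m11 A)" "b = real_of_int (m12 A)"
    "c = real_of_int (m21 A)" "d = real_of_int (m22 A)"
  define a' b' c' d' where "a' = real_of_int (m11 C)" "b' = real_of_int (m12 C)"
    "c' = real_of_int (m21 C)" "d' = real_of_int (m22 C)"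
  note defs = a_b_c_d_def a'_b'_c'_d'_def
  have c: "c \<noteq> 0" using hyp_m21_nz[OF assms(1)] by (simp add: defs)
  have e1: "c' * (a - d) = c * (a' - d')" and e2: "b' * c = b * c'"
    using commute_entries[OF assms(3)] unfolding defs
    by (metis of_int_diff of_int_mult)+
  have A: "a * \<xi> + b = \<xi> * (c * \<xi> + d)" using assms(2) by (simp add: eigvec_def eigval_def defs)
  have "c * (a' * \<xi> + b' - \<xi> * (c' * \<xi> + d')) = (c * (a' - d')) * \<xi> + b' * c - c * c' * \<xi> * \<xi>"
    by (simp add: algebra_simps)
  also have "\<dots> = c' * (a * \<xi> + b - \<xi> * (c * \<xi> + d))"
    unfolding e1[symmetric] e2 by (simp add: algebra_simps)
  also have "\<dots> = 0" using A by simp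
  finally show ?thesis using c by (simp add: eigvec_def eigval_def defs)
qed

text \<open>Proportionality turns \<open>m21 C\<close> squared times the discriminant of A into
  \<open>m21 A\<close> squared times that of C, which is 0, while A has positive discriminant. So no
  parabolic element commutes with a hyperbolic one.\<close>

lemma commuting_trace_2:
  assumes "hyp_rep A" "C * A = A * C" "dt C = 1" "tr C = 2"
  shows "C = 1"
proof -
  note e = commute_entries[OF assms(2)]
  have "(m21 C)\<^sup>2 * ((tr A)\<^sup>2 - 4 * dt A) = (m21 C * (m11 A - m22 A))\<^sup>2 + 4 * m21 C * m21 A * (m12 A * m21 C)"
    by (simp add: tr_def dt_def algebra_simps power2_eq_square)
  also have "\<dots> = (m21 A)\<^sup>2 * ((tr C)\<^sup>2 - 4 * dt C)"
    unfolding e(1) e(2)[symmetric] by (simp add: tr_def dt_def algebra_simps power2_eq_square)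
  also have "\<dots> = 0" using assms by simp
  finally have *: "(m21 C)\<^sup>2 * ((tr A)\<^sup>2 - 4) = 0" using assms by (simp add: hyp_rep_def)
  have "2\<^sup>2 < (tr A)\<^sup>2" using assms by (intro power_strict_mono) (auto simp: hyp_rep_def)
  with * have c: "m21 C = 0" by simp
  then have "m12 C = 0" "m11 C = m22 C" using e hyp_m21_nz[OF assms(1)] by simp_all
  with c assms(4) show ?thesis by (simp add: mat2_eq_iff tr_def)
qed

lemma adj_commute:
  assumes "dt C = 1" "C * A = A * C"
  shows "adj C * A = A * adj C"
proof -
  have "adj C * A = adj C * ((A * C) * adj C)"
    using assms(1) by (simp add: mult_adj_1)
  also have "\<dots> = (adj C * (C * A)) * adj C"
    by (simp add: mult.assoc assms(2))
  finally show ?thesis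
    using assms(1) by (simp add: mult_adj_1)
qed

lemma add_inverse_strict_mono:
  fixes x y :: real
  assumes "1 \<le> x" "x < y"
  shows "x + 1 / x < y + 1 / y"
proof -
  have "1 < x * y" using assms mult_right_mono[of 1 x y] by linarith
  then have "0 < (y - x) * (1 - 1 / (x * y))" using assms by (intro mult_pos_pos) auto
  also have "\<dots> = y + 1 / y - (x + 1 / x)" using assms by (simp add: field_simps)
  finally show ?thesis by simp
qed

text \<open>The eigenvalue embeds the centralizer in the nonzero reals. Integrality makes the image
  discrete: for an eigenvalue l >= 1 the trace l + 1 / l is an integer that increases with l.
  Division by the element B of least trace among those with l > 1 shows that all of these are powers
  of B, and primitivity forces A = B.\<close>

lemma centralizer_primitive:
  assumes A: "hyp_rep A" and prim: "prim_rep A" and C: "dt C = 1" "C * A = A * C"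
  obtains k where "C \<in> {A ^ k, - (A ^ k), adj A ^ k, - (adj A ^ k)}"
proof -
  obtain \<xi> where \<xi>: "eigvec \<xi> A" "1 < eigval \<xi> A" using hyp_eigenvector[OF A] .
  let ?l = "eigval \<xi>"
  define Z where "Z = {C. dt C = 1 \<and> C * A = A * C}"
  have ZE: "eigvec \<xi> C" if "C \<in> Z" for C using that eigvec_commute[OF A \<xi>(1)] by (simp add: Z_def)
  have Zm: "C * D \<in> Z" if "C \<in> Z" "D \<in> Z" for C D
    using that by (simp add: Z_def) (metis mult.assoc)
  have Zadj: "adj C \<in> Z" if "C \<in> Z" for C
    using that by (simp add: Z_def adj_commute)
  have ZA: "A \<in> Z" using A by (simp add: Z_def hyp_rep_def)
  have ladj: "?l C * ?l (adj C) = 1" if "C \<in> Z" for C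
    using eigval_mult[OF ZE[OF Zadj[OF that]], of C] that by (simp add: mult_adj_1 Z_def)
  have trC: "real_of_int (tr C) = ?l C + 1 / ?l C" if "C \<in> Z" for C
  proof -
    have "?l C \<noteq> 0" using ladj[OF that] by auto
    then have "?l (adj C) = 1 / ?l C" using ladj[OF that] by (simp add: field_simps)
    then show ?thesis using eigval_adj_add[of \<xi> C] by simp
  qed
  have one: "C = 1" if "C \<in> Z" "?l C = 1" for C
    using commuting_trace_2[OF A, of C] trC[OF that(1)] that by (simp add: Z_def)
  define Y where "Y = {C \<in> Z. 1 < ?l C}"
  have trY: "2 < tr C" if "C \<in> Y" for C
    using add_inverse_strict_mono[of 1 "?l C"] trC[of C] that by (simp add: Y_def)
  have tr_less: "tr C < tr D \<longleftrightarrow> ?l C < ?l D" if "C \<in> Z" "D \<in> Z" "1 \<le> ?l C" "1 \<le> ?l D" for C D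
  proof -
    have "real_of_int (tr C) < real_of_int (tr D) \<longleftrightarrow> ?l C < ?l D"
      unfolding trC[OF that(1)] trC[OF that(2)]
      using add_inverse_strict_mono[of "?l C" "?l D"] add_inverse_strict_mono[of "?l D" "?l C"] that
      by (cases "?l C" "?l D" rule: linorder_cases) auto
    then show ?thesis by simp
  qed
  have "A \<in> Y" using ZA \<xi> by (simp add: Y_def)
  then obtain B where B: "B \<in> Y" and Bmin: "\<And>D. D \<in> Y \<Longrightarrow> nat (tr B) \<le> nat (tr D)"
    using ex_has_least_nat[of "\<lambda>C. C \<in> Y" A "\<lambda>C. nat (tr C)"] by blast
  have powB: "\<exists>k\<ge>1. C = B ^ k" if "C \<in> Y" for C
    using that
  proof (induction "nat (tr C)" arbitrary: C rule: less_induct)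
    case less
    have CB: "C \<in> Z" "B \<in> Z" "1 < ?l C" "1 < ?l B" using less.prems B by (auto simp: Y_def)
    \<comment> \<open>Division step: the eigenvalue of D is that of C divided by that of B, so it is
      still at least 1.\<close>
    define D where "D = C * adj B"
    have DZ: "D \<in> Z" unfolding D_def by (intro Zm Zadj CB)
    have CD: "C = D * B" using CB by (simp add: D_def mult_adj_1 Z_def)
    then have lC: "?l C = ?l D * ?l B" using eigval_mult ZE CB by metis
    have "\<not> tr C < tr B" using Bmin[OF less.prems] trY[OF B] by linarith
    then have "?l B \<le> ?l C" using tr_less[of C B] CB by auto
    then have D1: "1 \<le> ?l D" using lC CB(4) by (simp add: mult_le_cancel_right1)
    show ?case
    proof (cases "?l D = 1")
      case True
      then have "C = B ^ 1" using one[OF DZ] CD by simp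
      then show ?thesis by blast
    next
      case False
      then have DY: "D \<in> Y" using DZ D1 by (simp add: Y_def)
      have "?l D < ?l C" using lC CB D1 by simp
      then have "tr D < tr C" using tr_less[of D C] DZ CB D1 by simp
      then obtain k where "D = B ^ k" using less.hyps[of D] DY trY[OF DY] by auto
      then have "C = B ^ Suc k" using CD by (simp add: power_commutes)
      then show ?thesis by (intro exI[of _ "Suc k"]) auto
    qed
  qed
  obtain k where k: "k \<ge> 1" "A = B ^ k" using powB[OF \<open>A \<in> Y\<close>] by blast
  have "\<not> 2 \<le> k" using prim k(2) B by (auto simp: prim_rep_def Y_def Z_def)
  with k(1) have "k = 1" by linarith
  with k(2) have AB: "A = B" by simp
  have pos: "\<exists>k. C = A ^ k \<or> C = adj A ^ k" if C: "C \<in> Z" "0 < ?l C" for C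
  proof (cases "?l C" "1::real" rule: linorder_cases)
    case less
    have "?l (adj C) = 1 / ?l C" using ladj[OF C(1)] C(2) by (simp add: field_simps)
    then have "1 < ?l (adj C)" using less C(2) by simp
    then have "adj C \<in> Y" using Zadj[OF C(1)] by (simp add: Y_def)
    then obtain k where "adj C = A ^ k" using powB AB by blast
    then have "adj (adj C) = adj A ^ k" by (simp add: adj_power)
    then have "C = adj A ^ k" by simp
    then show ?thesis by blast
  next
    case equal
    then show ?thesis using one[OF C(1)] by (intro exI[of _ 0]) simp
  next
    case greater
    then show ?thesis using powB[of C] C AB by (auto simp: Y_def)
  qed
  have CZ: "C \<in> Z" "- C \<in> Z" using C by (auto simp: Z_def)
  have "?l C \<noteq> 0" using ladj[OF CZ(1)] by auto
  then consider "0 < ?l C" | "0 < ?l (- C)" by (auto simp: neq_iff)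
  then show ?thesis
  proof cases
    case 1
    then obtain k where "C = A ^ k \<or> C = adj A ^ k" using pos[OF CZ(1)] by blast
    then have "C \<in> {A ^ k, - (A ^ k), adj A ^ k, - (adj A ^ k)}" by blast
    then show ?thesis by (rule that)
  next
    case 2
    then obtain k where "- C = A ^ k \<or> - C = adj A ^ k" using pos[OF CZ(2)] by blast
    then have "C = - (A ^ k) \<or> C = - (adj A ^ k)" by (metis minus_minus)
    then have "C \<in> {A ^ k, - (A ^ k), adj A ^ k, - (adj A ^ k)}" by blast
    then show ?thesis by (rule that)
  qed
qed

section \<open>Reflections inverting a hyperbolic element\<close>

text \<open>For \<open>dt A = 1\<close> the linear condition \<open>tr (R * A) = 0\<close> encodes
  that R inverts A: it says that R A squares to 1, as R does, which amounts to R A R =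
  A^{-1}.\<close>

definition reflections :: "mat2 \<Rightarrow> mat2 set" where
  "reflections A = {R. dt R = -1 \<and> tr R = 0 \<and> tr (R * A) = 0}"

lemma tr_mult_add: "tr (R * (M + N)) = tr (R * M) + tr (R * N)" "tr (R * (M - N)) = tr (R * M) - tr (R * N)"
    "tr (R * (of_int k * M)) = k * tr (R * M)" "tr (R * of_int k) = k * tr R"
  by (simp_all add: tr_def sel_times algebra_simps)

lemma reflections_square: "R \<in> reflections A \<Longrightarrow> R * R = 1"
  by (simp add: reflections_def cayley_hamilton)

text \<open>R and R A both square to -\<delta>, whence A R A = R. The sign \<delta> lets the lemma
  serve reflections (\<delta> = -1) and half turns (\<delta> = 1).\<close>

lemma anticommute:
  assumes "dt A = 1" "dt R = \<delta>" "\<delta> * \<delta> = 1" "tr R = 0" "tr (R * A) = 0"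
  shows "A * R = R * adj A" "R * A = adj A * R"
proof -
  have sq: "R * R = of_int (- \<delta>)" using assms by (simp add: cayley_hamilton)
  have RA: "(R * A) * (R * A) = of_int (- \<delta>)" using assms by (simp add: cayley_hamilton[of "R * A"])
  have comm: "of_int k * M = M * of_int k" for k and M :: mat2
    by (simp add: mat2_eq_iff sel_times)
  have dd: "of_int \<delta> * (of_int \<delta> * M) = (M :: mat2)" for M
    using assms(3) by (simp flip: mult.assoc of_int_mult)
  have "R * ((R * A) * (R * A)) = of_int (- \<delta>) * (A * R * A)"
    using sq by (simp flip: mult.assoc)
  then have "of_int (- \<delta>) * (A * R * A) = of_int (- \<delta>) * R" unfolding RA by (simp only: comm)
  then have ARA: "A * R * A = R" using dd by (metis mult_minus_left of_int_minus minus_minus neg_equal_iff_equal)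
  have "A * R = (A * R * A) * adj A" using assms(1) by (simp add: mult_adj_1)
  then show "A * R = R * adj A" by (simp add: ARA)
  have "R * A = adj A * (A * R * A)" using assms(1) by (simp add: mult_adj_1 mult.assoc)
  then show "R * A = adj A * R" by (simp add: ARA)
qed

lemma power_anticommute:
  assumes "A * R = R * (B :: 'a :: monoid_mult)"
  shows "A ^ k * R = R * B ^ k"
proof (induction k)
  case (Suc k)
  have "A ^ Suc k * R = A * (A ^ k * R)" by (simp add: mult.assoc)
  also have "\<dots> = (A * R) * B ^ k" by (simp add: Suc mult.assoc)
  finally show ?case by (simp add: assms mult.assoc)
qed simp

lemma conj_by_power_reflections:
  assumes "dt A = 1" "R \<in> reflections A"
  shows "conj_by (A ^ k) R = R * adj A ^ (2 * k)" "conj_by (adj A ^ k) R = R * A ^ (2 * k)"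
proof -
  have "A * R = R * adj A" "adj A * R = R * A"
    using anticommute[of A R "-1"] assms by (auto simp: reflections_def)
  from this[THEN power_anticommute]
  show "conj_by (A ^ k) R = R * adj A ^ (2 * k)" "conj_by (adj A ^ k) R = R * A ^ (2 * k)"
    by (simp_all add: conj_by_def adj_power mult.assoc mult_2 power_add)
qed

lemma reflections_mult: 
  assumes "dt A = 1" "R \<in> reflections A"
  shows "R * A \<in> reflections A" "- R \<in> reflections A"
proof -
  have "tr (R * (A * A)) = 0"
    using assms by (simp add: cayley_hamilton tr_mult_add reflections_def)
  then show "R * A \<in> reflections A"
    using assms by (simp add: reflections_def mult.assoc)
  have "tr (- R * A) = - tr (R * A)" by simp
  then show "- R \<in> reflections A"
    using assms by (simp add: reflections_def)
qed

lemma reflections_cancel: "R \<in> reflections A \<Longrightarrow> R * X = R * Y \<longleftrightarrow> X = Y"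
  by (metis reflections_square mult.assoc mult.left_neutral)

lemma reflections_conj_by: "dt g = 1 \<Longrightarrow> conj_by g R \<in> reflections (conj_by g A) \<longleftrightarrow> R \<in> reflections A"
  by (simp add: reflections_def dt_conj_by tr_conj_by flip: conj_by_mult)

definition centralizer_conj :: "mat2 \<Rightarrow> mat2 \<Rightarrow> mat2 \<Rightarrow> bool" where
  "centralizer_conj A R R' \<longleftrightarrow> (\<exists>h. dt h = 1 \<and> h * A = A * h \<and> conj_by h R = R')"

lemma centralizer_conj_cases:
  assumes "hyp_rep A" "prim_rep A" "R \<in> reflections A" "centralizer_conj A R R'"
  obtains k where "R' = R * A ^ (2 * k)" | k where "R' = R * adj A ^ (2 * k)"
proof -
  have A: "dt A = 1" using assms by (simp add: hyp_rep_def)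
  obtain h where h: "dt h = 1" "h * A = A * h" "conj_by h R = R'" using assms(4) by (auto simp: centralizer_conj_def)
  obtain k where "h \<in> {A ^ k, - (A ^ k), adj A ^ k, - (adj A ^ k)}"
    using centralizer_primitive[OF assms(1,2) h(1,2)] .
  then have "conj_by h R = conj_by (A ^ k) R \<or> conj_by h R = conj_by (adj A ^ k) R"
    by auto
  then show ?thesis
    using that conj_by_power_reflections[OF A assms(3)] h(3) by auto
qed

lemma adj_power_cancel: "dt A = 1 \<Longrightarrow> A ^ k * adj A ^ k = 1" "dt A = 1 \<Longrightarrow> adj A ^ k * A ^ k = 1"
  using mult_adj_1(1)[of "A ^ k"] mult_adj_1(2)[of "A ^ k"] by (simp_all add: adj_power)

lemma hyp_power_tr: "hyp_rep A \<Longrightarrow> 2 \<le> tr (A ^ k)" "hyp_rep A \<Longrightarrow> 2 \<le> tr (adj A ^ k)"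
  "hyp_rep A \<Longrightarrow> A ^ Suc k \<noteq> 1"
  using tr_power_gt_2[of A k] tr_power_gt_2[of A "Suc k"] tr_simps(2)
  by (cases "k = 0"; fastforce simp flip: adj_power)+

text \<open>After R is cancelled, a conjugacy would make -1, A or -A an even power of A. Powers of A
  have trace at least 2, which excludes -1 and -A; and A would be 1 or have a positive power equal
  to 1.\<close>

lemma not_centralizer_conj:
  assumes "hyp_rep A" "prim_rep A" "R \<in> reflections A"
  shows "\<not> centralizer_conj A R (- R)" "\<not> centralizer_conj A R (R * A)" "\<not> centralizer_conj A R (- (R * A))"
proof -
  note tr = hyp_power_tr[OF assms(1)]
  have A: "dt A = 1" "2 < tr A" using assms by (auto simp: hyp_rep_def)
  have mm: "- R = R * (-1)" "- (R * A) = R * (- A)" by simp_all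
  note c = reflections_cancel[OF assms(3)]
  show "\<not> centralizer_conj A R (- R)"
  proof
    assume "centralizer_conj A R (- R)"
    then obtain k where "R * (-1) = R * A ^ (2 * k) \<or> R * (-1) = R * adj A ^ (2 * k)"
      unfolding mm(1) by (rule centralizer_conj_cases[OF assms]) blast+
    then have "2 \<le> tr (-1)" unfolding c using tr by metis
    then show False by simp
  qed
  show "\<not> centralizer_conj A R (- (R * A))"
  proof
    assume "centralizer_conj A R (- (R * A))"
    then obtain k where "R * (- A) = R * A ^ (2 * k) \<or> R * (- A) = R * adj A ^ (2 * k)"
      unfolding mm(2) by (rule centralizer_conj_cases[OF assms]) blast+
    then have "2 \<le> tr (- A)" unfolding c using tr by metis
    then show False using A by simp
  qed
  show "\<not> centralizer_conj A R (R * A)"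
  proof
    assume "centralizer_conj A R (R * A)"
    then consider k where "A = A ^ (2 * k)" | k where "A = adj A ^ (2 * k)"
      by (rule centralizer_conj_cases[OF assms]) (unfold c, blast+)
    then show False
    proof cases
      case 1
      show False
      proof (cases k)
        case 0
        then show False using 1 A by (metis mult_0_right power_0 tr_simps(2) less_irrefl)
      next
        case (Suc j)
        have "A ^ (2 * k) = A * A ^ Suc (2 * j)" by (simp add: Suc)
        then have "adj A * A = adj A * (A * A ^ Suc (2 * j))" using 1 by simp
        then have "A ^ Suc (2 * j) = 1" using A by (simp only: mult_adj_1)
        then show False using tr(3) by blast
      qed
    next
      case 2
      then have "A ^ (2 * k) * A = 1" using adj_power_cancel[OF A(1)] by metis
      then have "A ^ Suc (2 * k) = 1" by (simp add: power_commutes)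
      then show False using tr(3) by blast
    qed
  qed
qed

lemma centralizer_conj_uminus: "centralizer_conj A R R' \<Longrightarrow> centralizer_conj A (- R) (- R')"
  by (auto simp: centralizer_conj_def)

text \<open>The product \<open>R0 * R\<close> commutes with A, hence is a power of A up to sign.
  Even exponents are reached by conjugating R0, odd ones by conjugating
  \<open>R0 * A\<close>.\<close>

lemma reflections_centralizer_conj_base:
  assumes "hyp_rep A" "prim_rep A" "R0 \<in> reflections A" "R \<in> reflections A"
  shows "\<exists>R1 \<in> {R0, - R0, R0 * A, - (R0 * A)}. centralizer_conj A R1 R"
proof -
  have A: "dt A = 1" using assms by (simp add: hyp_rep_def)
  note ac0 = anticommute[of A R0 "-1"] and ac = anticommute[of A R "-1"]
  have "(R0 * R) * A = A * (R0 * R)"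
    using ac0 ac A assms(3,4) by (simp add: reflections_def mult.assoc) (simp flip: mult.assoc)
  then obtain k where "R0 * R \<in> {A ^ k, - (A ^ k), adj A ^ k, - (adj A ^ k)}"
    using centralizer_primitive[OF assms(1,2), of "R0 * R"] assms(3,4) by (auto simp: reflections_def)
  moreover have "R = R0 * (R0 * R)"
    using reflections_square[OF assms(3)] by (simp flip: mult.assoc)
  ultimately have R: "R \<in> {R0 * A ^ k, - (R0 * A ^ k), R0 * adj A ^ k, - (R0 * adj A ^ k)}"
    by auto
  have relA: "centralizer_conj A R' (conj_by (A ^ j) R')" "centralizer_conj A R' (conj_by (adj A ^ j) R')" for j R'
  proof -
    have "A ^ j * A = A * A ^ j" by (simp add: power_commutes)
    moreover have "adj A * A = A * adj A" using A by (simp add: mult_adj_1)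
    then have "adj A ^ j * A = A * adj A ^ j" by (rule power_anticommute)
    ultimately show "centralizer_conj A R' (conj_by (A ^ j) R')" "centralizer_conj A R' (conj_by (adj A ^ j) R')"
      using A unfolding centralizer_conj_def by (metis dt_power dt_simps(3) power_one)+
  qed
  have "\<exists>R1 \<in> {R0, R0 * A}. centralizer_conj A R1 (R0 * A ^ k)"
  proof (cases "even k")
    case True
    then obtain j where "k = 2 * j" by (elim evenE)
    then show ?thesis using relA(2)[of R0 j] conj_by_power_reflections(2)[OF A assms(3)] by auto
  next
    case False
    then obtain j where "k = Suc (2 * j)" by (auto elim: oddE)
    then have "R0 * A ^ k = conj_by (adj A ^ j) (R0 * A)"
      using conj_by_power_reflections(2)[OF A reflections_mult(1)[OF A assms(3)]] by (simp add: mult.assoc)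
    then show ?thesis using relA(2)[of "R0 * A" j] by auto
  qed
  moreover have "\<exists>R1 \<in> {R0, R0 * A}. centralizer_conj A R1 (R0 * adj A ^ k)"
  proof (cases "even k")
    case True
    then obtain j where "k = 2 * j" by (elim evenE)
    then show ?thesis using relA(1)[of R0 j] conj_by_power_reflections(1)[OF A assms(3)] by auto
  next
    case False
    then obtain j where k: "k = Suc (2 * j)" by (auto elim: oddE)
    \<comment> \<open>The negative odd exponent -k is written as 1 - 2 (j + 1), so that it also
      starts from \<open>R0 * A\<close>.\<close>
    have "A * adj A ^ (2 * Suc j) = adj A ^ k" using A k by (simp add: mult_adj_1)
    then have "R0 * adj A ^ k = conj_by (A ^ Suc j) (R0 * A)"
      using conj_by_power_reflections(1)[OF A reflections_mult(1)[OF A assms(3)], of "Suc j"] by (simp add: mult.assoc)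
    then show ?thesis using relA(1)[of "R0 * A" "Suc j"] by auto
  qed
  ultimately show ?thesis
    using R centralizer_conj_uminus by blast
qed

text \<open>The pairs below correspond to the reflections inverting \<open>A\<close> modulo the centralizer of \<open>A\<close>,
  and these fall into the classes of \<open>R, -R, R A, -R A\<close>.\<close>

definition fibre :: "mat2 \<Rightarrow> (int \<times> mat2) set" where
  "fibre A = {(n, M). n \<in> {0, 1} \<and> tr (J n * M) = 0 \<and> (\<exists>g. dt g = 1 \<and> M = conj_by g A)}"

text \<open>Normalizing a reflection R to some \<open>J n\<close> carries A along to a matrix
  inverted by \<open>J n\<close>. By \<open>J_conj_J\<close> the result does not depend on the
  normalizing matrix, and two reflections give the same pair exactly when an element of the
  centralizer of A conjugates one to the other.\<close>

lemma card_fibre: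
  assumes A: "hyp_rep A" "prim_rep A" and R0: "R0 \<in> reflections A"
  shows "card (fibre A) = 4"
proof -
  have dA: "dt A = 1" using A by (simp add: hyp_rep_def)
  have "\<forall>R\<in>reflections A. \<exists>p. fst p \<in> {0, 1} \<and> dt (snd p) = 1 \<and> conj_by (snd p) R = J (fst p)"
  proof
    fix R assume "R \<in> reflections A"
    then obtain g n where "n \<in> {0, 1}" "dt g = 1" "conj_by g R = J n"
      using reflection_conj_J[of R] unfolding reflections_def by blast
    then show "\<exists>p. fst p \<in> {0, 1} \<and> dt (snd p) = 1 \<and> conj_by (snd p) R = J (fst p)"
      by (intro exI[of _ "(n, g)"]) simp
  qed
  from bchoice[OF this] obtain P where
    P: "\<forall>R\<in>reflections A. fst (P R) \<in> {0, 1} \<and> dt (snd (P R)) = 1 \<and> conj_by (snd (P R)) R = J (fst (P R))" ..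
  define N G where "N R = fst (P R)" and "G R = snd (P R)" for R
  have NG: "N R \<in> {0, 1} \<and> dt (G R) = 1 \<and> conj_by (G R) R = J (N R)" if "R \<in> reflections A" for R
    using P that unfolding N_def G_def by blast
  define F where "F R = (N R, conj_by (G R) A)" for R
  have F_mem: "F R \<in> fibre A" if "R \<in> reflections A" for R
  proof -
    have "J (N R) \<in> reflections (conj_by (G R) A)" using reflections_conj_by[of "G R" R A] NG[OF that] that by auto
    then show ?thesis using NG[OF that] by (auto simp: F_def fibre_def reflections_def)
  qed
  have F_centralizer_conj: "centralizer_conj A R R'" if "R \<in> reflections A" "R' \<in> reflections A" "F R = F R'" for R R'
  proof -
    let ?h = "adj (G R') * G R"
    have d: "dt (G R) = 1" "dt (G R') = 1" using NG that by auto
    have "conj_by ?h A = conj_by (adj (G R')) (conj_by (G R') A)" using that(3) by (simp add: F_def flip: conj_by_conj_by)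
    also have "\<dots> = A" using d by (simp add: conj_by_inverse)
    finally have "?h * A = A * ?h" using d by (subst (asm) conj_by_eq_self_iff) auto
    moreover have "conj_by ?h R = conj_by (adj (G R')) (conj_by (G R') R')"
      using NG[OF that(1)] NG[OF that(2)] that(3) by (simp add: F_def flip: conj_by_conj_by)
    then have "conj_by ?h R = R'" using d by (simp add: conj_by_inverse)
    ultimately show ?thesis using d unfolding centralizer_conj_def by (intro exI[of _ ?h]) auto
  qed
  have F_uniq: "F R = (n, M)" if R: "R \<in> reflections A" and "n \<in> {0, 1}" "dt g = 1" "M = conj_by g A" "conj_by g R = J n" for R n M g
  proof -
    have d: "dt (G R) = 1" using NG[OF R] by auto
    have "conj_by (G R * adj g) (conj_by g R) = conj_by (G R) (conj_by (adj g) (conj_by g R))"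
      by (simp only: conj_by_conj_by mult.assoc)
    then have "conj_by (G R * adj g) (J n) = J (N R)"
      unfolding conj_by_inverse(1)[OF that(3)] using that(5) NG[OF R] by simp
    moreover have "dt (G R * adj g) = 1" using d that by simp
    ultimately have "n = N R" and "G R * adj g = 1 \<or> G R * adj g = -1"
      using J_conj_J[of "G R * adj g" n "N R"] that NG[OF R] by blast+
    then have "G R * adj g * g = 1 * g \<or> G R * adj g * g = -1 * g" by auto
    then have "G R = g \<or> G R = - g" using that(3) by (simp add: mult_adj_1)
    then show ?thesis using \<open>n = N R\<close> that by (auto simp: F_def)
  qed
  have F_cong: "F R = F R'" if "R \<in> reflections A" "R' \<in> reflections A" and centralizer_conj: "centralizer_conj A R R'" for R R'
  proof -
    obtain h where h: "dt h = 1" "h * A = A * h" "conj_by h R = R'" using centralizer_conj by (auto simp: centralizer_conj_def)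
    have "conj_by h A = A" using h by (simp add: conj_by_eq_self_iff)
    then have "conj_by (G R' * h) A = conj_by (G R') A" "conj_by (G R' * h) R = J (N R')"
      using h NG[OF that(2)] by (auto simp flip: conj_by_conj_by)
    then show ?thesis
      using F_uniq[OF that(1), of "N R'" "G R' * h" "conj_by (G R') A"] NG[OF that(2)] h by (simp add: F_def)
  qed
  let ?B = "{R0, - R0, R0 * A, - (R0 * A)}"
  have B: "?B \<subseteq> reflections A" using R0 reflections_mult[OF dA] by auto
  have "fibre A = F ` reflections A"
  proof
    show "fibre A \<subseteq> F ` reflections A"
    proof
      fix x assume "x \<in> fibre A"
      then obtain n M g where x: "x = (n, M)" "n \<in> {0, 1}" "tr (J n * M) = 0" "dt g = 1" "M = conj_by g A"
        by (auto simp: fibre_def)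
      have "J n \<in> reflections M" using x by (simp add: reflections_def)
      then have "conj_by g (conj_by (adj g) (J n)) \<in> reflections (conj_by g A)" using x by (simp add: conj_by_inverse)
      then have R: "conj_by (adj g) (J n) \<in> reflections A" using x(4) by (simp add: reflections_conj_by)
      have "F (conj_by (adj g) (J n)) = (n, M)"
        by (rule F_uniq[OF R]) (use x in \<open>auto simp: conj_by_inverse\<close>)
      then show "x \<in> F ` reflections A" using R x(1) by (metis image_eqI)
    qed
  qed (use F_mem in auto)
  also have "\<dots> = F ` ?B"
  proof
    show "F ` reflections A \<subseteq> F ` ?B"
    proof
      fix x assume "x \<in> F ` reflections A"
      then obtain R where R: "R \<in> reflections A" "x = F R" by blast
      obtain R1 where R1: "R1 \<in> ?B" "centralizer_conj A R1 R" using reflections_centralizer_conj_base[OF A R0 R(1)] by blast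
      then have "F R1 = F R" using B F_cong[OF _ R(1)] by blast
      then show "x \<in> F ` ?B" using R R1(1) by (intro image_eqI[of _ _ R1]) simp_all
    qed
  qed (use B in blast)
  finally have "fibre A = F ` ?B" .
  moreover have "F R0 \<noteq> F (- R0)" "F R0 \<noteq> F (R0 * A)" "F R0 \<noteq> F (- (R0 * A))"
    "F (- R0) \<noteq> F (R0 * A)" "F (- R0) \<noteq> F (- (R0 * A))" "F (R0 * A) \<noteq> F (- (R0 * A))"
  proof -
    have mem: "R0 \<in> reflections A" "- R0 \<in> reflections A" "R0 * A \<in> reflections A" "- (R0 * A) \<in> reflections A"
      using B by auto
    note nr = not_centralizer_conj[OF A mem(1)] not_centralizer_conj[OF A mem(2)] not_centralizer_conj[OF A mem(3)]
    show "F R0 \<noteq> F (- R0)" "F R0 \<noteq> F (R0 * A)" "F R0 \<noteq> F (- (R0 * A))"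
      "F (- R0) \<noteq> F (R0 * A)" "F (- R0) \<noteq> F (- (R0 * A))" "F (R0 * A) \<noteq> F (- (R0 * A))"
      using F_centralizer_conj[OF mem(1) mem(2)] F_centralizer_conj[OF mem(1) mem(3)] F_centralizer_conj[OF mem(1) mem(4)]
        F_centralizer_conj[OF mem(2) mem(3)] F_centralizer_conj[OF mem(2) mem(4)] F_centralizer_conj[OF mem(3) mem(4)] nr
      by auto
  qed
  ultimately show ?thesis by simp
qed

section \<open>Square roots of determinant \<open>-1\<close>\<close>

text \<open>An involution of determinant -1 has trace 0, so it is conjugate to some
  \<open>J n\<close>, and the only elements of SL_2(Z) commuting with \<open>J n\<close> are 1 and
  -1.\<close>

lemma no_commuting_reflection:
  assumes "hyp_rep A" "\<eta> * A = A * \<eta>" "dt \<eta> = -1" "\<eta> * \<eta> = 1"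
  shows False
proof -
  have "tr \<eta> = 0" using tr_square[of \<eta>] assms by simp
  then obtain g n where g: "n \<in> {0, 1}" "dt g = 1" "conj_by g \<eta> = J n"
    using reflection_conj_J[OF assms(3)] by blast
  have dA: "dt A = 1" using assms by (simp add: hyp_rep_def)
  have "conj_by g A * J n = J n * conj_by g A"
    using g(2,3) assms(2) by (simp flip: conj_by_mult g(3))
  then have "conj_by (conj_by g A) (J n) = J n" using g dA by (simp add: conj_by_eq_self_iff dt_conj_by)
  then have "conj_by g A = 1 \<or> conj_by g A = -1" using J_conj_J[of "conj_by g A" n n] g dA by (auto simp: dt_conj_by)
  then have "tr (conj_by g A) \<le> 2" by auto
  then show False using assms(1) g by (simp add: tr_conj_by hyp_rep_def)
qed

text \<open>The trace of the square determines the positive trace of the root, and by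
  Cayley-Hamilton the root times its trace is the square minus 1.\<close>

lemma square_root_unique:
  assumes "dt \<epsilon> = -1" "dt \<epsilon>' = -1" "0 < tr \<epsilon>" "0 < tr \<epsilon>'" "\<epsilon> * \<epsilon> = \<epsilon>' * \<epsilon>'"
  shows "\<epsilon> = \<epsilon>'"
proof -
  have "(tr \<epsilon>)\<^sup>2 = (tr \<epsilon>')\<^sup>2" using assms tr_square[of \<epsilon>] tr_square[of \<epsilon>'] by simp
  then have "tr \<epsilon> = tr \<epsilon>'" using assms by (simp add: power2_eq_iff_nonneg)
  then have "of_int (tr \<epsilon>) * \<epsilon> = of_int (tr \<epsilon>) * \<epsilon>'"
    using assms by (simp add: cayley_hamilton)
  then show ?thesis using assms(3) by (auto simp: mat2_eq_iff sel_times)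
qed

lemma mult_swap_commute: "x * y = y * x \<Longrightarrow> (x * y) * (x * y) = (x * x) * (y * (y :: 'a :: monoid_mult))"
  by (metis mult.assoc)

text \<open>R and E both invert A, so x = R E commutes with A and has determinant -1. Its square is
  a power of A; multiplying x by a power of A makes the square A or 1, and 1 is excluded by
  \<open>no_commuting_reflection\<close>.\<close>

lemma square_root_exists:
  assumes A: "hyp_rep A" "prim_rep A" and R: "R \<in> reflections A"
    and E: "dt E = 1" "tr E = 0" "tr (E * A) = 0"
  shows "\<exists>\<epsilon>. dt \<epsilon> = -1 \<and> 0 < tr \<epsilon> \<and> \<epsilon> * \<epsilon> = A"
proof -
  have dA: "dt A = 1" using A by (simp add: hyp_rep_def)
  have com_adj: "x * adj A = adj A * x" if "x * A = A * x" for x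
    using that adj_commute[OF dA that[symmetric]] by simp
  define x where "x = R * E"
  have "x * A = R * (adj A * E)"
    using anticommute(2)[of A E 1] dA E by (simp add: x_def mult.assoc)
  also have "\<dots> = A * x"
    using anticommute(1)[of A R "-1"] dA R by (simp add: x_def reflections_def flip: mult.assoc)
  finally have xA: "x * A = A * x" .
  have dx: "dt x = -1" using R E by (simp add: x_def reflections_def)
  have "(x * x) * A = A * (x * x)" using xA by (metis mult.assoc)
  then obtain k where k: "x * x \<in> {A ^ k, - (A ^ k), adj A ^ k, - (adj A ^ k)}"
    using centralizer_primitive[OF A, of "x * x"] dx by auto
  \<comment> \<open>Determinant -1 makes the trace of x^2 equal to the squared trace of x plus 2,
    which excludes the negatives of powers of A.\<close>
  have "tr (x * x) > 0" using dx tr_square[of x] zero_le_power2[of "tr x"] by linarith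
  then have k: "x * x = A ^ k \<or> x * x = adj A ^ k"
    using k hyp_power_tr[OF A(1), of k] by auto
  have c: "x * A ^ j = A ^ j * x" "x * adj A ^ j = adj A ^ j * x" for j
    using power_anticommute[OF xA[symmetric], of j] power_anticommute[OF com_adj[OF xA, symmetric], of j] by simp_all
  have ex: "\<exists>y. dt y = -1 \<and> y * A = A * y \<and> (y * y = A \<or> y * y = 1)"
  proof -
    have *: "dt (x * A ^ j) = -1" "dt (x * adj A ^ j) = -1" "(x * A ^ j) * A = A * (x * A ^ j)"
      "(x * adj A ^ j) * A = A * (x * adj A ^ j)"
      "(x * A ^ j) * (x * A ^ j) = (x * x) * A ^ (2 * j)"
      "(x * adj A ^ j) * (x * adj A ^ j) = (x * x) * adj A ^ (2 * j)" for j
    proof -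
      show "dt (x * A ^ j) = -1" "dt (x * adj A ^ j) = -1" using dx dA by simp_all
      show "(x * A ^ j) * A = A * (x * A ^ j)" using xA by (metis mult.assoc power_commutes)
      have "adj A ^ j * A = A * adj A ^ j"
        by (rule power_anticommute) (simp add: mult_adj_1 dA)
      then show "(x * adj A ^ j) * A = A * (x * adj A ^ j)" using xA by (metis mult.assoc)
      show "(x * A ^ j) * (x * A ^ j) = (x * x) * A ^ (2 * j)"
        using mult_swap_commute[OF c(1)] by (simp add: mult_2 power_add)
      show "(x * adj A ^ j) * (x * adj A ^ j) = (x * x) * adj A ^ (2 * j)"
        using mult_swap_commute[OF c(2)] by (simp add: mult_2 power_add)
    qed
    show ?thesis
    proof (cases "even k")
      case True
      then obtain j where j: "k = 2 * j" by (elim evenE)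
      from k show ?thesis
      proof
        assume "x * x = A ^ k"
        then have "(x * x) * adj A ^ (2 * j) = 1" using j adj_power_cancel[OF dA] by simp
        then show ?thesis using * by metis
      next
        assume "x * x = adj A ^ k"
        then have "(x * x) * A ^ (2 * j) = 1" using j adj_power_cancel[OF dA] by simp
        then show ?thesis using * by metis
      qed
    next
      case False
      then obtain j where j: "k = Suc (2 * j)" by (auto elim: oddE)
      from k show ?thesis
      proof
        assume "x * x = A ^ k"
        then have "(x * x) * adj A ^ (2 * j) = A"
          using j adj_power_cancel[OF dA, of "2 * j"] by (simp add: mult.assoc)
        then show ?thesis using * by metis
      next
        assume "x * x = adj A ^ k"
        moreover have "A ^ (2 * Suc j) = A ^ k * A" using j by (simp add: power_commutes mult.assoc)
        ultimately have "(x * x) * A ^ (2 * Suc j) = A"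
          using adj_power_cancel[OF dA, of k] by (simp flip: mult.assoc)
        then show ?thesis using * by metis
      qed
    qed
  qed
  then obtain y where y: "dt y = -1" "y * A = A * y" "y * y = A \<or> y * y = 1" by blast
  with no_commuting_reflection[OF A(1) y(2,1)] have yA: "y * y = A" by blast
  have "tr y \<noteq> 0"
    using tr_square[of y] y(1) yA A(1) by (auto simp: hyp_rep_def)
  then consider "0 < tr y" | "0 < tr (- y)" by fastforce
  then show ?thesis
  proof cases
    case 1 then show ?thesis using y yA by blast
  next
    case 2 then show ?thesis using y yA by (intro exI[of _ "- y"]) auto
  qed
qed

lemma square_not_even_power:
  assumes "dt \<epsilon> = -1" "0 < tr \<epsilon>" "dt B = 1" "\<epsilon> * \<epsilon> = B ^ (2 * j) \<or> \<epsilon> * \<epsilon> = - (B ^ (2 * j))"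
  shows False
proof -
  define D where "D = B ^ j"
  have D: "dt D = 1" "B ^ (2 * j) = D * D" using assms(3) by (simp_all add: D_def mult_2 power_add)
  have te: "tr (\<epsilon> * \<epsilon>) = (tr \<epsilon>)\<^sup>2 + 2" using tr_square[of \<epsilon>] assms by simp
  have e2: "\<epsilon> * \<epsilon> = D * D"
  proof (rule ccontr)
    assume "\<epsilon> * \<epsilon> \<noteq> D * D"
    then have "\<epsilon> * \<epsilon> = - (D * D)" using assms(4) D(2) by auto
    then have "(tr \<epsilon>)\<^sup>2 + 2 = - ((tr D)\<^sup>2 - 2)" using te tr_square[of D] D(1) by simp
    then have "(tr \<epsilon>)\<^sup>2 \<le> 0" using zero_le_power2[of "tr D"] by linarith
    then show False using assms(2) by simp
  qed
  have A: "hyp_rep (\<epsilon> * \<epsilon>)"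
    using te assms(1,2) by (simp add: hyp_rep_def)
  \<comment> \<open>Up to an integer factor \<epsilon> is a polynomial in D, so it commutes with
    D.\<close>
  have "of_int (tr \<epsilon>) * \<epsilon> = D * D - 1"
    using cayley_hamilton[of \<epsilon>] e2 assms(1) by (simp add: algebra_simps)
  then have "D * (of_int (tr \<epsilon>) * \<epsilon>) = (of_int (tr \<epsilon>) * \<epsilon>) * D"
    by (simp add: right_diff_distrib left_diff_distrib mult.assoc)
  moreover have "D * (of_int (tr \<epsilon>) * \<epsilon>) = of_int (tr \<epsilon>) * (D * \<epsilon>)"
    "(of_int (tr \<epsilon>) * \<epsilon>) * D = of_int (tr \<epsilon>) * (\<epsilon> * D)"
    by (simp_all add: mat2_eq_iff sel_times algebra_simps)
  ultimately have "of_int (tr \<epsilon>) * (D * \<epsilon>) = of_int (tr \<epsilon>) * (\<epsilon> * D)" by simp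
  then have De: "D * \<epsilon> = \<epsilon> * D" using assms(2) by (auto simp: mat2_eq_iff sel_times[of "of_int _"])
  then have aDe: "adj D * \<epsilon> = \<epsilon> * adj D" by (rule adj_commute[OF D(1)])
  have "(\<epsilon> * adj D) * (\<epsilon> * \<epsilon>) = (\<epsilon> * \<epsilon>) * (\<epsilon> * adj D)" using aDe by (metis mult.assoc)
  moreover have "(\<epsilon> * adj D) * (\<epsilon> * adj D) = (\<epsilon> * \<epsilon>) * (adj D * adj D)"
    by (rule mult_swap_commute) (simp add: aDe)
  then have "(\<epsilon> * adj D) * (\<epsilon> * adj D) = 1"
    using D(1) by (simp add: e2 mult.assoc mult_adj_1)
  ultimately show False
    using no_commuting_reflection[OF A, of "\<epsilon> * adj D"] assms(1) D(1) by simp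
qed

section \<open>Hyperbolic geometry: lengths, axes and right angles as conditions on traces\<close>

section \<open>Isometries of the upper half-plane\<close>

definition act :: "mat2 \<Rightarrow> complex \<Rightarrow> complex" where
  "act M z = (of_int (m11 M) * z + of_int (m12 M)) / (of_int (m21 M) * z + of_int (m22 M))"

definition den :: "mat2 \<Rightarrow> complex \<Rightarrow> complex" where
  "den M z = of_int (m21 M) * z + of_int (m22 M)"

definition num :: "mat2 \<Rightarrow> complex \<Rightarrow> complex" where
  "num M z = of_int (m11 M) * z + of_int (m12 M)"

lemma act_eq: "act M z = num M z / den M z"
  by (simp add: act_def num_def den_def)

lemma psl_act_eq: "psl_act (psl M) = act M"
  by (simp add: psl_act_psl act_def fun_eq_iff)

lemma den_nz:
  assumes "dt M = 1" "z \<in> uhp"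
  shows "den M z \<noteq> 0"
proof
  assume *: "den M z = 0"
  then have "Im (den M z) = 0" by simp
  then have "m21 M = 0" using assms(2) by (auto simp: uhp_def den_def)
  moreover from this have "m22 M = 0" using * by (simp add: den_def)
  ultimately show False using assms(1) by (simp add: dt_def)
qed

lemma det_complex: "dt M = 1 \<Longrightarrow> complex_of_int (m11 M) * of_int (m22 M) - of_int (m12 M) * of_int (m21 M) = 1"
  unfolding dt_def by (metis of_int_1 of_int_diff of_int_mult)

lemma det_real: "dt M = 1 \<Longrightarrow> real_of_int (m11 M) * of_int (m22 M) - of_int (m12 M) * of_int (m21 M) = 1"
  unfolding dt_def by (metis of_int_1 of_int_diff of_int_mult)

lemma act_diff:
  assumes "dt M = 1" "z \<in> uhp" "w \<in> uhp"
  shows "act M z - act M w = (z - w) / (den M z * den M w)"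
proof -
  have "num M z * den M w - num M w * den M z = (z - w) * (complex_of_int (m11 M) * of_int (m22 M) - of_int (m12 M) * of_int (m21 M))"
    by (simp add: num_def den_def algebra_simps)
  then show ?thesis
    using den_nz[OF assms(1,2)] den_nz[OF assms(1,3)] det_complex[OF assms(1)]
    by (simp add: act_eq diff_frac_eq)
qed

lemma Im_act:
  assumes "dt M = 1" "z \<in> uhp"
  shows "Im (act M z) = Im z / (cmod (den M z))\<^sup>2"
proof -
  have "act M z = num M z * cnj (den M z) / of_real ((cmod (den M z))\<^sup>2)"
    unfolding act_eq by (rule complex_div_cnj)
  then have "Im (act M z) = Im (num M z * cnj (den M z)) / (cmod (den M z))\<^sup>2"
    by (simp only: Im_divide_of_real)
  also have "Im (num M z * cnj (den M z)) = Im z * (real_of_int (m11 M) * of_int (m22 M) - of_int (m12 M) * of_int (m21 M))"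
    by (simp add: num_def den_def algebra_simps)
  finally show ?thesis by (simp add: det_real[OF assms(1)])
qed

lemma act_uhp: "dt M = 1 \<Longrightarrow> z \<in> uhp \<Longrightarrow> act M z \<in> uhp"
  using Im_act[of M z] den_nz[of M z] by (simp add: uhp_def)

lemma act_mult:
  assumes "dt N = 1" "z \<in> uhp"
  shows "act (M * N) z = act M (act N z)"
proof -
  have d: "den N z \<noteq> 0" using den_nz[OF assms] .
  have "num (M * N) z = of_int (m11 M) * num N z + of_int (m12 M) * den N z"
    "den (M * N) z = of_int (m21 M) * num N z + of_int (m22 M) * den N z"
    by (simp_all add: num_def den_def sel_times algebra_simps)
  then have "num (M * N) z = num M (act N z) * den N z" "den (M * N) z = den M (act N z) * den N z"
    using d by (simp_all add: act_eq num_def[of M] den_def[of M] field_simps)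
  then show ?thesis using d by (simp add: act_eq)
qed

lemma act_1 [simp]: "act 1 z = z"
  by (simp add: act_def)

lemma act_1_image [simp]: "act 1 ` L = L"
  by simp

lemma act_image_mult: "dt N = 1 \<Longrightarrow> L \<subseteq> uhp \<Longrightarrow> act (M * N) ` L = act M ` act N ` L"
  unfolding image_image by (intro image_cong refl act_mult) auto

text \<open>Complex differentiability is included because it makes f conformal, which is what
  carries perpendicular lines to perpendicular lines.\<close>

definition uhp_isometry :: "(complex \<Rightarrow> complex) \<Rightarrow> bool" where
  "uhp_isometry f \<longleftrightarrow> f ` uhp \<subseteq> uhp \<and> (\<forall>z\<in>uhp. \<forall>w\<in>uhp. hyp_dist (f z) (f w) = hyp_dist z w) \<and>
     (\<forall>z\<in>uhp. \<exists>D. (f has_field_derivative D) (at z))"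

lemma hyp_dist_act:
  assumes "dt M = 1" "z \<in> uhp" "w \<in> uhp"
  shows "hyp_dist (act M z) (act M w) = hyp_dist z w"
proof -
  define p q where "p = cmod (den M z)" "q = cmod (den M w)"
  have "p \<noteq> 0" "q \<noteq> 0" using den_nz[OF assms(1,2)] den_nz[OF assms(1,3)] by (simp_all add: p_q_def)
  moreover have "cmod (act M z - act M w) = cmod (z - w) / (p * q)"
    by (simp add: act_diff[OF assms] norm_divide norm_mult p_q_def)
  ultimately have "(cmod (act M z - act M w))\<^sup>2 / (2 * Im (act M z) * Im (act M w)) = (cmod (z - w))\<^sup>2 / (2 * Im z * Im w)"
    by (simp add: Im_act assms flip: p_q_def) (simp add: power2_eq_square)
  then show ?thesis by (simp add: hyp_dist_def)
qed

lemma uhp_isometry_act: "dt M = 1 \<Longrightarrow> uhp_isometry (act M)"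
  unfolding uhp_isometry_def
proof (intro conjI ballI)
  fix z assume M: "dt M = 1" and z: "z \<in> uhp"
  have "den M z \<noteq> 0" using den_nz[OF M z] .
  then show "\<exists>D. (act M has_field_derivative D) (at z)"
    unfolding act_def [abs_def] den_def by (intro exI) (auto intro!: derivative_eq_intros)
qed (auto simp: act_uhp hyp_dist_act)

lemma uhp_isometry_affine:
  assumes "0 < r"
  shows "uhp_isometry (\<lambda>z. of_real r * z + of_real x)"
  unfolding uhp_isometry_def
proof (intro conjI ballI)
  fix z w assume "z \<in> uhp" "w \<in> uhp"
  have "(of_real r * z + of_real x) - (of_real r * w + of_real x) = of_real r * (z - w)"
    by (simp add: algebra_simps)
  then have "cmod ((of_real r * z + of_real x) - (of_real r * w + of_real x)) = r * cmod (z - w)"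
    using assms by (simp add: norm_mult)
  then show "hyp_dist (of_real r * z + of_real x) (of_real r * w + of_real x) = hyp_dist z w"
    using assms by (simp add: hyp_dist_def power2_eq_square mult.assoc)
qed (use assms in \<open>auto simp: uhp_def intro!: derivative_eq_intros exI\<close>)

lemma hyp_geodesic_isometry:
  assumes "uhp_isometry f" "hyp_geodesic c"
  shows "hyp_geodesic (f \<circ> c)"
  using assms unfolding hyp_geodesic_def uhp_isometry_def by (auto simp: image_subset_iff)

lemma meet_perpendicularly_isometry:
  assumes f: "uhp_isometry f" and "meet_perpendicularly L L'"
  shows "meet_perpendicularly (f ` L) (f ` L')"
proof -
  obtain c c' v v' where c: "hyp_geodesic c" "range c = L" "hyp_geodesic c'" "range c' = L'"
    "c 0 = c' 0" "(c has_vector_derivative v) (at 0)" "(c' has_vector_derivative v') (at 0)" "inner v v' = 0"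
    using assms(2) unfolding meet_perpendicularly_def by blast
  have "c 0 \<in> uhp" using c(1) by (auto simp: hyp_geodesic_def)
  then obtain D where D: "(f has_field_derivative D) (at (c 0))"
    using f by (auto simp: uhp_isometry_def)
  \<comment> \<open>Multiplication by the complex derivative is a similarity of the plane.\<close>
  have "inner (v * D) (v' * D) = (Re D * Re D + Im D * Im D) * inner v v'"
    by (simp add: inner_complex_def algebra_simps)
  then have i: "inner (v * D) (v' * D) = 0" using c by simp
  have d: "((f \<circ> c) has_vector_derivative (v * D)) (at 0)" "((f \<circ> c') has_vector_derivative (v' * D)) (at 0)"
    using field_vector_diff_chain_at[OF c(6)] field_vector_diff_chain_at[OF c(7)] D c(5) by simp_all
  have "range (f \<circ> c) = f ` L" "range (f \<circ> c') = f ` L'" "(f \<circ> c) 0 = (f \<circ> c') 0"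
    using c by (auto simp flip: image_image simp: image_comp)
  then show ?thesis
    unfolding meet_perpendicularly_def
    using hyp_geodesic_isometry[OF f c(1)] hyp_geodesic_isometry[OF f c(3)] d i by blast
qed

section \<open>Translation lengths and axes\<close>

text \<open>On the real line this is the fixed-point polynomial of M. For hyperbolic M with integral
  entries the zero set is the circle through the two fixed points that is orthogonal to the real
  line.\<close>

definition qf :: "mat2 \<Rightarrow> complex \<Rightarrow> real" where
  "qf M z = of_int (m21 M) * ((Re z)\<^sup>2 + (Im z)\<^sup>2) + of_int (m22 M - m11 M) * Re z - of_int (m12 M)"

text \<open>The displacement depends on z only through \<open>qf M z / Im z\<close>. For hyperbolic
  M it is therefore least exactly where \<open>qf\<close> vanishes, which yields the translation
  length and the axis at once.\<close>

lemma hyp_dist_act_self: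
  assumes "dt M = 1" "z \<in> uhp"
  shows "hyp_dist z (act M z) = arcosh ((of_int (tr M))\<^sup>2 / 2 - 1 + (qf M z / Im z)\<^sup>2 / 2)"
proof -
  have d: "den M z \<noteq> 0" using den_nz[OF assms] .
  define p where "p = cmod (den M z)"
  have p: "p \<noteq> 0" using d by (simp add: p_def)
  have y: "Im z > 0" using assms(2) by (simp add: uhp_def)
  have "z - act M z = (z * den M z - num M z) / den M z"
    using d by (simp add: act_eq field_simps)
  then have "cmod (z - act M z) = cmod (z * den M z - num M z) / p"
    by (simp add: norm_divide p_def)
  then have "(cmod (z - act M z))\<^sup>2 / (2 * Im z * Im (act M z)) = (cmod (z * den M z - num M z))\<^sup>2 / (2 * (Im z)\<^sup>2)"
    using p by (simp add: Im_act[OF assms] power_divide power2_eq_square flip: p_def)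
  \<comment> \<open>Expanding the squared modulus of m21 z^2 + (m22 - m11) z - m12 separates the
    square of \<open>qf\<close> from the discriminant of M.\<close>
  also have "(cmod (z * den M z - num M z))\<^sup>2 = (qf M z)\<^sup>2 + (Im z)\<^sup>2 * ((of_int (tr M))\<^sup>2 - 4 * of_int (dt M))"
    unfolding cmod_power2 by (simp add: qf_def num_def den_def tr_def dt_def power2_eq_square algebra_simps)
  finally have "1 + (cmod (z - act M z))\<^sup>2 / (2 * Im z * Im (act M z))
      = 1 + ((qf M z)\<^sup>2 + (Im z)\<^sup>2 * ((of_int (tr M))\<^sup>2 - 4)) / (2 * (Im z)\<^sup>2)"
    using assms(1) by simp
  also have "\<dots> = (of_int (tr M))\<^sup>2 / 2 - 1 + (qf M z / Im z)\<^sup>2 / 2"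
    using y by (simp add: field_simps power_divide)
  finally show ?thesis unfolding hyp_dist_def by (simp only:)
qed

lemma arcosh_le_iff: "1 \<le> x \<Longrightarrow> 1 \<le> y \<Longrightarrow> arcosh x \<le> arcosh y \<longleftrightarrow> x \<le> (y::real)"
  by (metis arcosh_less_iff_real not_le)

lemma arcosh_eq_iff: "1 \<le> x \<Longrightarrow> 1 \<le> y \<Longrightarrow> arcosh x = arcosh y \<longleftrightarrow> x = (y::real)"
  by (metis cosh_arcosh_real)

lemma hyp_half_trace: "hyp_rep M \<Longrightarrow> 1 < (real_of_int (tr M))\<^sup>2 / 2 - 1"
proof -
  assume "hyp_rep M"
  then have "2\<^sup>2 < (real_of_int (tr M))\<^sup>2" by (intro power_strict_mono) (auto simp: hyp_rep_def)
  then show ?thesis by simp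
qed

lemma qf_zero_exists:
  assumes "hyp_rep M"
  obtains z where "z \<in> uhp" "qf M z = 0"
proof -
  define a b c d where "a = real_of_int (m11 M)" "b = real_of_int (m12 M)"
    "c = real_of_int (m21 M)" "d = real_of_int (m22 M)"
  have c: "c \<noteq> 0" using hyp_m21_nz[OF assms] by (simp add: a_b_c_d_def)
  have det: "a * d - b * c = 1" using det_real[of M] assms by (simp add: a_b_c_d_def hyp_rep_def)
  have t: "(a + d)\<^sup>2 - 4 > 0" using hyp_half_trace[OF assms] by (simp add: a_b_c_d_def tr_def)
  define z where "z = Complex ((a - d) / (2 * c)) (sqrt ((a + d)\<^sup>2 - 4) / (2 * \<bar>c\<bar>))"
  have "z \<in> uhp" using c t by (simp add: z_def uhp_def)
  moreover have "qf M z = 0"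
  proof -
    have "(Im z)\<^sup>2 = ((a + d)\<^sup>2 - 4) / (2 * c)\<^sup>2"
      using t by (simp add: z_def power_divide power_mult_distrib)
    then have "qf M z = c * (((a - d) / (2 * c))\<^sup>2 + ((a + d)\<^sup>2 - 4) / (2 * c)\<^sup>2) + (d - a) * ((a - d) / (2 * c)) - b"
      by (simp add: qf_def z_def a_b_c_d_def)
    also have "\<dots> = (a * d - b * c - 1) / c"
      using c by (simp add: field_simps power2_eq_square)
    finally show ?thesis using det by simp
  qed
  ultimately show ?thesis using that by blast
qed

lemma translation_length_psl:
  assumes "hyp_rep M"
  shows "translation_length (psl M) = arcosh ((of_int (tr M))\<^sup>2 / 2 - 1)"
proof -
  have M: "dt M = 1" using assms by (simp add: hyp_rep_def)
  note h = hyp_half_trace[OF assms]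
  obtain z where z: "z \<in> uhp" "qf M z = 0" using qf_zero_exists[OF assms] .
  show ?thesis
    unfolding translation_length_def psl_act_eq
  proof (rule cInf_eq_minimum)
    show "arcosh ((of_int (tr M))\<^sup>2 / 2 - 1) \<in> (\<lambda>z. hyp_dist z (act M z)) ` uhp"
      using z by (intro image_eqI[of _ _ z]) (simp_all add: hyp_dist_act_self[OF M])
  next
    fix x assume "x \<in> (\<lambda>z. hyp_dist z (act M z)) ` uhp"
    then obtain w where w: "w \<in> uhp" "x = hyp_dist w (act M w)" by auto
    then show "arcosh ((of_int (tr M))\<^sup>2 / 2 - 1) \<le> x"
      using h by (simp add: hyp_dist_act_self[OF M] arcosh_le_iff add_increasing2)
  qed
qed

lemma axis_psl:
  assumes "hyp_rep M"
  shows "axis (psl M) = {z \<in> uhp. qf M z = 0}"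
proof -
  have M: "dt M = 1" using assms by (simp add: hyp_rep_def)
  note h = hyp_half_trace[OF assms]
  have "hyp_dist z (act M z) = translation_length (psl M) \<longleftrightarrow> qf M z = 0" if "z \<in> uhp" for z
  proof -
    have "Im z \<noteq> 0" using that by (simp add: uhp_def)
    moreover have "hyp_dist z (act M z) = translation_length (psl M) \<longleftrightarrow> (qf M z / Im z)\<^sup>2 / 2 = 0"
      unfolding hyp_dist_act_self[OF M that] translation_length_psl[OF assms]
      using h by (subst arcosh_eq_iff) (auto simp: add_increasing2)
    ultimately show ?thesis by simp
  qed
  then show ?thesis by (auto simp: axis_def psl_act_eq)
qed

lemma axis_subset_uhp: "axis \<gamma> \<subseteq> uhp"
  by (auto simp: axis_def)

lemma axis_conj_subset:
  assumes "hyp_rep M" "dt g = 1"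
  shows "act g ` axis (psl M) \<subseteq> axis (psl (conj_by g M))"
proof
  fix w assume "w \<in> act g ` axis (psl M)"
  then obtain z where z: "z \<in> uhp" "hyp_dist z (act M z) = translation_length (psl M)" "w = act g z"
    by (auto simp: axis_def psl_act_eq)
  have M: "dt M = 1" using assms by (simp add: hyp_rep_def)
  have "conj_by g M * g = g * M" using assms by (simp add: conj_by_def mult_adj_1)
  then have "act (conj_by g M) w = act g (act M z)"
    unfolding z(3) using z(1) M assms(2) by (metis act_mult)
  then have "hyp_dist w (act (conj_by g M) w) = translation_length (psl (conj_by g M))"
    using z M assms by (simp add: hyp_dist_act act_uhp translation_length_psl hyp_rep_conj tr_conj_by)
  then show "w \<in> axis (psl (conj_by g M))"
    using z assms(2) by (simp add: axis_def psl_act_eq act_uhp)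
qed

lemma axis_conj:
  assumes "hyp_rep M" "dt g = 1"
  shows "axis (psl (conj_by g M)) = act g ` axis (psl M)"
proof
  have "act (adj g) ` axis (psl (conj_by g M)) \<subseteq> axis (psl (conj_by (adj g) (conj_by g M)))"
    using assms by (intro axis_conj_subset) (auto simp: hyp_rep_conj)
  then have "act (adj g) ` axis (psl (conj_by g M)) \<subseteq> axis (psl M)" using assms by (simp add: conj_by_inverse)
  then have "act g ` act (adj g) ` axis (psl (conj_by g M)) \<subseteq> act g ` axis (psl M)" by (rule image_mono)
  then show "axis (psl (conj_by g M)) \<subseteq> act g ` axis (psl M)"
    using act_image_mult[OF _ axis_subset_uhp, of "adj g" g "psl (conj_by g M)"] assms(2)
    by (simp only: dt_simps mult_adj_1 act_1_image simp_thms)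
qed (rule axis_conj_subset[OF assms])

lemma geodesic_length_psl:
  assumes "hyp_rep M"
  shows "geodesic_length (conj_class (psl M)) = arcosh ((of_int (tr M))\<^sup>2 / 2 - 1)"
proof -
  have "translation_length ` conj_class (psl M) = {arcosh ((of_int (tr M))\<^sup>2 / 2 - 1)}"
  proof -
    have "translation_length (psl (conj_by g M)) = arcosh ((of_int (tr M))\<^sup>2 / 2 - 1)" if "dt g = 1" for g
      using that assms by (simp add: translation_length_psl hyp_rep_conj tr_conj_by)
    then have "\<forall>\<gamma>\<in>conj_class (psl M). translation_length \<gamma> = arcosh ((of_int (tr M))\<^sup>2 / 2 - 1)"
      by (auto simp: conj_class_psl)
    moreover have "psl (conj_by 1 M) \<in> conj_class (psl M)"
      unfolding conj_class_psl using dt_simps(1) by blast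
    ultimately show ?thesis by (auto simp: image_iff)
  qed
  then show ?thesis by (simp add: geodesic_length_def)
qed

section \<open>Perpendicularity to vertical lines\<close>

definition vline :: "real \<Rightarrow> complex set" where
  "vline x = {z \<in> uhp. Re z = x}"

text \<open>A zero velocity would be orthogonal to everything. It is excluded because cosh t - 1 >=
  t^2 / 2 bounds the Euclidean speed of a unit-speed geodesic at time 0 from below by its height
  there.\<close>

lemma hyp_geodesic_velocity_nz:
  assumes "hyp_geodesic c" "(c has_vector_derivative v) (at 0)"
  shows "v \<noteq> 0"
proof
  assume "v = 0"
  define y where "y t = Im (c t)" for t
  have y: "y t > 0" for t using assms(1) by (auto simp: hyp_geodesic_def uhp_def y_def)
  have lower: "y 0 * y t \<le> (norm (c t - c 0) / norm t)\<^sup>2" if "t \<noteq> 0" for t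
  proof -
    define X where "X = (cmod (c t - c 0))\<^sup>2 / (2 * y t * y 0)"
    have "0 \<le> X" using y[of t] y[of 0] by (simp add: X_def)
    have "hyp_dist (c t) (c 0) = \<bar>t - 0\<bar>" using assms(1) unfolding hyp_geodesic_def by blast
    then have "arcosh (1 + X) = \<bar>t\<bar>" by (simp add: hyp_dist_def X_def y_def)
    then have "cosh \<bar>t\<bar> = 1 + X" using \<open>0 \<le> X\<close> by (metis cosh_arcosh_real le_add_same_cancel1)
    then have "X = cosh (2 * (\<bar>t\<bar> / 2)) - 1" by simp
    also have "\<dots> = 2 * (sinh (\<bar>t\<bar> / 2))\<^sup>2"
      unfolding cosh_double using hyperbolic_pythagoras[of "\<bar>t\<bar> / 2"] by simp
    also have "\<dots> \<ge> 2 * (\<bar>t\<bar> / 2)\<^sup>2"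
      using real_le_x_sinh[of "\<bar>t\<bar> / 2"] by (intro mult_left_mono power_mono) (simp_all add: sinh_def exp_minus)
    finally have "t\<^sup>2 / 2 \<le> X" by (simp add: power_divide)
    then have "(y 0 * y t) * t\<^sup>2 \<le> (cmod (c t - c 0))\<^sup>2"
      using y[of t] y[of 0] by (simp add: X_def field_simps)
    then show ?thesis using that by (simp add: power_divide field_simps)
  qed
  have "((\<lambda>t. norm (c t - c 0) / norm t) \<longlongrightarrow> 0) (at 0)"
    using assms(2) \<open>v = 0\<close> by (simp add: has_vector_derivative_def has_derivative_iff_norm)
  then have "((\<lambda>t. (norm (c t - c 0) / norm t)\<^sup>2) \<longlongrightarrow> 0\<^sup>2) (at 0)"
    by (rule tendsto_power)
  moreover have "isCont c 0"
    using assms(2) by (rule has_vector_derivative_continuous)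
  then have "(y \<longlongrightarrow> y 0) (at 0)"
    unfolding y_def by (auto simp: isCont_def intro!: tendsto_intros)
  then have "((\<lambda>t. y 0 * y t) \<longlongrightarrow> y 0 * y 0) (at 0)"
    by (intro tendsto_intros)
  moreover have "\<forall>\<^sub>F t in at 0. y 0 * y t \<le> (norm (c t - c 0) / norm t)\<^sup>2"
    using lower by (auto simp: eventually_at_filter)
  ultimately have "y 0 * y 0 \<le> 0\<^sup>2"
    by (intro tendsto_le[of "at (0::real)"]) auto
  then show False using y[of 0] by (simp add: mult_le_0_iff)
qed

text \<open>At the crossing the vertical line forces a horizontal velocity on the axis.
  Differentiating \<open>qf A = 0\<close> in this direction shows that the centre of the half circle
  has abscissa x.\<close>

lemma perpendicular_vline_imp:
  assumes A: "hyp_rep A" and "meet_perpendicularly (axis (psl A)) (vline x)"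
  shows "of_int (m11 A - m22 A) = 2 * of_int (m21 A) * x"
proof -
  obtain c c' v v' where c: "hyp_geodesic c" "range c = axis (psl A)" "hyp_geodesic c'" "range c' = vline x"
    "c 0 = c' 0" "(c has_vector_derivative v) (at 0)" "(c' has_vector_derivative v') (at 0)" "inner v v' = 0"
    using assms(2) unfolding meet_perpendicularly_def by blast
  have nz: "v \<noteq> 0" "v' \<noteq> 0" using hyp_geodesic_velocity_nz c by blast+
  note cd = c(6,7)[unfolded has_vector_derivative_complex_iff]
  have "((\<lambda>t. Re (c' t)) has_field_derivative 0) (at 0)"
  proof -
    have "(\<lambda>t. Re (c' t)) = (\<lambda>t. x)" using c(4) by (auto simp: vline_def)
    then show ?thesis by simp
  qed
  then have v': "Re v' = 0" using cd by (blast intro: DERIV_unique)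
  then have "Im v' \<noteq> 0" using nz by (simp add: complex_eq_iff)
  then have v: "Im v = 0" using c(8) v' by (simp add: inner_complex_def)
  then have Rev: "Re v \<noteq> 0" using nz by (simp add: complex_eq_iff)
  have "Re (c 0) = x" using c(4,5) by (auto simp: vline_def)
  define \<alpha> \<beta> where "\<alpha> = real_of_int (m21 A)" "\<beta> = real_of_int (m22 A - m11 A)"
  have "qf A (c t) = 0" for t using c(2) axis_psl[OF A] by auto
  then have "(\<lambda>t. qf A (c t)) = (\<lambda>t. 0)" by auto
  then have "((\<lambda>t. qf A (c t)) has_field_derivative 0) (at 0)" by simp
  moreover have "((\<lambda>t. qf A (c t)) has_field_derivative
      (\<alpha> * (2 * Re (c 0) * Re v + 2 * Im (c 0) * Im v) + \<beta> * Re v)) (at 0)"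
  proof -
    define X Y where "X t = Re (c t)" and "Y t = Im (c t)" for t
    have "(X has_field_derivative Re v) (at 0)" "(Y has_field_derivative Im v) (at 0)"
      unfolding X_def Y_def using cd by blast+
    then show ?thesis
      unfolding qf_def \<alpha>_\<beta>_def X_def[symmetric] Y_def[symmetric]
      by (auto intro!: derivative_eq_intros)
  qed
  ultimately have "\<alpha> * (2 * Re (c 0) * Re v + 2 * Im (c 0) * Im v) + \<beta> * Re v = 0"
    by (blast intro: DERIV_unique)
  then have "(2 * \<alpha> * x + \<beta>) * Re v = 0" using v \<open>Re (c 0) = x\<close> by (simp add: algebra_simps)
  then show ?thesis using Rev by (simp add: \<alpha>_\<beta>_def)
qed

lemma meet_perpendicularly_line_0_2: "meet_perpendicularly line_0_2 (vline 1)"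
proof -
  let ?c = "\<lambda>t::real. Complex (1 + tanh t) (1 / cosh t)" and ?c' = "\<lambda>t::real. Complex 0 (exp t)"
  have iso: "uhp_isometry (\<lambda>z. of_real 1 * z + of_real 1)" by (rule uhp_isometry_affine) simp
  have "hyp_geodesic ((\<lambda>z. of_real 1 * z + of_real 1) \<circ> ?c')"
    by (rule hyp_geodesic_isometry[OF iso hyp_geodesic_0_inf(1)])
  moreover have "((\<lambda>z. of_real 1 * z + of_real 1) \<circ> ?c') = (\<lambda>t. Complex 1 (exp t))"
    by (simp add: fun_eq_iff complex_eq_iff)
  ultimately have g: "hyp_geodesic (\<lambda>t. Complex 1 (exp t))" by simp
  have "z \<in> range (\<lambda>t. Complex 1 (exp t))" if "0 < Im z" "Re z = 1" for z
    using that by (intro range_eqI[of _ _ "ln (Im z)"]) (simp add: complex_eq_iff)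
  then have r: "range (\<lambda>t. Complex 1 (exp t)) = vline 1"
    by (auto simp: vline_def uhp_def)
  have d: "(?c has_vector_derivative 1) (at 0)" "((\<lambda>t. Complex 1 (exp t)) has_vector_derivative \<i>) (at 0)"
    unfolding has_vector_derivative_complex_iff
    by (auto intro!: derivative_eq_intros)
  show ?thesis
    unfolding meet_perpendicularly_def
    by (intro exI conjI) (rule hyp_geodesic_0_2 g r d | simp add: inner_complex_def)+
qed

text \<open>The axis is the half circle of radius r centred at n / 2, which is the image of the one
  from 0 to 2 under z |-> r z + n / 2 - r. This real affine isometry transports the model pair of
  \<open>meet_perpendicularly_line_0_2\<close>, which cross at the top point 1 + i.\<close>

lemma perpendicular_vline:
  assumes A: "hyp_rep A" and n: "m11 A = m22 A + n * m21 A"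
  shows "meet_perpendicularly (axis (psl A)) (vline (of_int n / 2))"
proof -
  define a b c d where "a = real_of_int (m11 A)" "b = real_of_int (m12 A)"
    "c = real_of_int (m21 A)" "d = real_of_int (m22 A)"
  define n' where "n' = real_of_int n"
  have c: "c \<noteq> 0" using hyp_m21_nz[OF A] by (simp add: a_b_c_d_def)
  have det: "a * d - b * c = 1" using det_real[of A] A by (simp add: a_b_c_d_def hyp_rep_def)
  have t: "(a + d)\<^sup>2 - 4 > 0" using hyp_half_trace[OF A] by (simp add: a_b_c_d_def tr_def)
  have an: "a = d + n' * c" using n by (simp add: a_b_c_d_def n'_def)
  define r where "r = sqrt ((a + d)\<^sup>2 - 4) / (2 * \<bar>c\<bar>)"
  have r0: "r > 0" using c t by (simp add: r_def)
  have r2: "r\<^sup>2 = ((a + d)\<^sup>2 - 4) / (4 * c\<^sup>2)"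
    using t by (simp add: r_def power_divide power_mult_distrib)
  have r2: "r\<^sup>2 = b / c + n'\<^sup>2 / 4"
  proof -
    have "(a + d)\<^sup>2 - 4 * (a * d - b * c) = 4 * c\<^sup>2 * (b / c + n'\<^sup>2 / 4)"
      using c by (simp add: an power2_eq_square algebra_simps)
    then show ?thesis using r2 det c by simp
  qed
  let ?f = "\<lambda>z. of_real r * z + of_real (n' / 2 - r)"
  have qf: "qf A z = c * ((Re z - n' / 2)\<^sup>2 + (Im z)\<^sup>2 - r\<^sup>2)" for z
    unfolding r2 using an c by (simp add: qf_def a_b_c_d_def(1)[symmetric] a_b_c_d_def(2)[symmetric]
        a_b_c_d_def(3)[symmetric] a_b_c_d_def(4)[symmetric] power2_eq_square field_simps)
  have inv: "?f ((z - of_real (n' / 2 - r)) / of_real r) = z" for z :: complex using r0 by simp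
  have "?f ` line_0_2 = axis (psl A)"
  proof
    have "cmod (z - 1) = 1 \<Longrightarrow> qf A (?f z) = 0" for z
    proof -
      assume "cmod (z - 1) = 1"
      then have "(Re z - 1)\<^sup>2 + (Im z)\<^sup>2 = 1" by (simp add: cmod_def)
      moreover have "(Re (?f z) - n' / 2)\<^sup>2 + (Im (?f z))\<^sup>2 = r\<^sup>2 * ((Re z - 1)\<^sup>2 + (Im z)\<^sup>2)"
        by (simp add: power2_eq_square algebra_simps)
      ultimately show "qf A (?f z) = 0" by (simp add: qf)
    qed
    then show "?f ` line_0_2 \<subseteq> axis (psl A)"
      using r0 unfolding axis_psl[OF A] line_0_2_def by (auto simp: uhp_def)
    show "axis (psl A) \<subseteq> ?f ` line_0_2"
    proof
      fix z assume "z \<in> axis (psl A)"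
      then have z: "z \<in> uhp" "(Re z - n' / 2)\<^sup>2 + (Im z)\<^sup>2 = r\<^sup>2"
        using c by (auto simp: axis_psl[OF A] qf)
      let ?w = "(z - of_real (n' / 2 - r)) / of_real r"
      have "?w - 1 = (z - of_real (n' / 2)) / of_real r" using r0 by (simp add: field_simps)
      moreover have "cmod (z - of_real (n' / 2)) = r"
        using z(2) r0 by (simp add: cmod_def)
      ultimately have "cmod (?w - 1) = 1" using r0 by (simp add: norm_divide)
      moreover have "?w \<in> uhp" using z(1) r0 by (simp add: uhp_def Im_divide_of_real)
      ultimately show "z \<in> ?f ` line_0_2" using inv[of z] by (intro image_eqI[of _ _ ?w]) (simp_all add: line_0_2_def)
    qed
  qed
  moreover have "?f ` vline 1 = vline (n' / 2)"
  proof
    show "vline (n' / 2) \<subseteq> ?f ` vline 1"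
    proof
      fix z assume z: "z \<in> vline (n' / 2)"
      let ?w = "(z - of_real (n' / 2 - r)) / of_real r"
      have "?w \<in> vline 1" using z r0 by (simp add: vline_def uhp_def Im_divide_of_real Re_divide_of_real)
      then show "z \<in> ?f ` vline 1" using inv[of z] by (intro image_eqI[of _ _ ?w]) simp_all
    qed
  qed (use r0 in \<open>auto simp: vline_def uhp_def\<close>)
  ultimately show ?thesis
    using meet_perpendicularly_isometry[OF uhp_isometry_affine[OF r0] meet_perpendicularly_line_0_2, of "n' / 2 - r"]
    by (simp add: n'_def)
qed

lemma line_0_inf_eq: "line_0_inf = vline (of_int 0 / 2)"
  by (simp add: line_0_inf_def vline_def)

text \<open>The homography -1 / (z - 1) takes infinity to 0 and 1 / 2 to 2, so the second line in
  the definition of ambiguity is a translate of the mirror of \<open>J 1\<close>.\<close>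

lemma line_0_2_eq: "line_0_2 = act (S * T (-1)) ` vline (of_int 1 / 2)"
proof -
  have d: "dt (S * T (-1)) = 1" by simp
  have a: "act (S * T (-1)) z = - 1 / (z - 1)" for z by (simp add: act_def sel_times)
  have b: "act (adj (S * T (-1))) z = (z - 1) / z" for z
    by (simp add: act_def sel_times diff_divide_distrib add_divide_distrib)
  show ?thesis
  proof
    show "act (S * T (-1)) ` vline (of_int 1 / 2) \<subseteq> line_0_2"
    proof clarify
      fix z assume z: "z \<in> vline (of_int 1 / 2)"
      then have zu: "z \<in> uhp" by (simp add: vline_def)
      have nz: "z - 1 \<noteq> 0" using zu by (auto simp: uhp_def)
      have "Re z = 1 / 2" using z by (simp add: vline_def)
      then have "Re z - 1 = - Re z" by simp
      then have "cmod z = cmod (z - 1)" by (simp only: cmod_def minus_complex.sel one_complex.sel power2_minus diff_zero)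
      moreover have "act (S * T (-1)) z - 1 = - z / (z - 1)" using nz unfolding a by (simp add: field_simps)
      ultimately have "cmod (act (S * T (-1)) z - 1) = 1" using nz by (simp add: norm_divide)
      then show "act (S * T (-1)) z \<in> line_0_2"
        using act_uhp[OF d zu] by (simp add: line_0_2_def)
    qed
    show "line_0_2 \<subseteq> act (S * T (-1)) ` vline (of_int 1 / 2)"
    proof
      fix z assume "z \<in> line_0_2"
      then have z: "z \<in> uhp" "cmod (z - 1) = 1" by (auto simp: line_0_2_def)
      let ?w = "act (adj (S * T (-1))) z"
      have w: "?w \<in> uhp" using z by (intro act_uhp) simp_all
      have "act (S * T (-1)) ?w = z" using act_mult[of "adj (S * T (-1))" z "S * T (-1)"] z
        by (simp add: mult_adj_1 d)
      moreover have "Re ?w = 1 / 2"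
      proof -
        have e: "(Re z)\<^sup>2 + (Im z)\<^sup>2 = 2 * Re z" using z(2) by (simp add: cmod_def power2_eq_square algebra_simps)
        have "Re z > 0" using e z(1) by (smt (verit) uhp_def mem_Collect_eq zero_less_power2 zero_le_power2)
        have "Re ?w = ((Re z - 1) * Re z + (Im z)\<^sup>2) / ((Re z)\<^sup>2 + (Im z)\<^sup>2)"
          unfolding b by (simp add: Re_divide power2_eq_square)
        also have "(Re z - 1) * Re z + (Im z)\<^sup>2 = Re z" using e by (simp add: algebra_simps power2_eq_square)
        finally show ?thesis using \<open>Re z > 0\<close> unfolding e by simp
      qed
      ultimately show "z \<in> act (S * T (-1)) ` vline (of_int 1 / 2)"
        using w by (intro image_eqI[of _ _ ?w]) (simp_all add: vline_def)
    qed
  qed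
qed

lemma vline_subset_uhp: "vline x \<subseteq> uhp"
  by (auto simp: vline_def)

lemma ambiguous_lines:
  obtains k where "\<And>n. dt (k n) = 1" "{line_0_inf, line_0_2} = (\<lambda>n. act (k n) ` vline (of_int n / 2)) ` {0, 1}"
  by (rule that[of "\<lambda>n. if n = 0 then 1 else S * T (-1)"])
     (auto simp: line_0_inf_eq line_0_2_eq)

lemma tr_J_mult: "tr (J n * M) = 0 \<longleftrightarrow> m11 M = m22 M + n * m21 M"
  by (auto simp: tr_def sel_times)

text \<open>In normal form both sides become the equation m11 = m22 + n m21: geometrically it puts
  the centre of the axis at n / 2, and as the trace condition of \<open>tr_J_mult\<close> it says
  that \<open>J n\<close> inverts the matrix.\<close>

lemma ambiguous_psl:
  assumes A: "hyp_rep A"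
  shows "ambiguous (conj_class (psl A)) \<longleftrightarrow> reflections A \<noteq> {}"
proof
  assume "ambiguous (conj_class (psl A))"
  then obtain \<gamma> \<delta> L where *: "\<gamma> \<in> conj_class (psl A)" "\<delta> \<in> carrier PSL2Z"
    "L \<in> {line_0_inf, line_0_2}" "meet_perpendicularly (axis \<gamma>) (psl_act \<delta> ` L)"
    unfolding ambiguous_def by blast
  from *(1) obtain h where h: "\<gamma> = psl (conj_by h A)" "dt h = 1" by (auto simp: conj_class_psl)
  from *(2) obtain e where e: "\<delta> = psl e" "dt e = 1" by (auto simp: carrier_PSL2Z_psl)
  obtain k :: "int \<Rightarrow> mat2" and n where k: "dt (k n) = 1" "L = act (k n) ` vline (of_int n / 2)" "n \<in> {0, 1}"
    using *(3) ambiguous_lines by (metis (no_types, lifting) imageE)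
  define u where "u = e * k n"
  have u: "dt u = 1" using e k by (simp add: u_def)
  have "psl_act \<delta> ` L = act u ` vline (of_int n / 2)"
    unfolding k(2) e(1) psl_act_eq u_def using k vline_subset_uhp by (simp add: act_image_mult)
  then have "meet_perpendicularly (act (adj u) ` axis (psl (conj_by h A))) (act (adj u) ` act u ` vline (of_int n / 2))"
    using *(4) h(1) u by (intro meet_perpendicularly_isometry uhp_isometry_act) simp_all
  moreover have "act (adj u) ` act u ` vline (of_int n / 2) = vline (of_int n / 2)"
    using act_image_mult[OF u vline_subset_uhp, of "adj u"] u by (simp add: mult_adj_1)
  moreover have "act (adj u) ` axis (psl (conj_by h A)) = axis (psl (conj_by (adj u * h) A))"
    using A h u by (simp add: hyp_rep_conj flip: axis_conj conj_by_conj_by)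
  ultimately have "meet_perpendicularly (axis (psl (conj_by (adj u * h) A))) (vline (of_int n / 2))"
    by simp
  moreover have "hyp_rep (conj_by (adj u * h) A)" using A h u by (simp add: hyp_rep_conj)
  ultimately have "real_of_int (m11 (conj_by (adj u * h) A) - m22 (conj_by (adj u * h) A)) = 2 * of_int (m21 (conj_by (adj u * h) A)) * (of_int n / 2)"
    by (intro perpendicular_vline_imp)
  also have "\<dots> = real_of_int (n * m21 (conj_by (adj u * h) A))" by simp
  finally have "m11 (conj_by (adj u * h) A) = m22 (conj_by (adj u * h) A) + n * m21 (conj_by (adj u * h) A)"
    by linarith
  then have J: "J n \<in> reflections (conj_by (adj u * h) A)" unfolding tr_J_mult[symmetric] by (simp add: reflections_def)
  let ?g = "adj u * h"
  have g: "dt ?g = 1" using u h by simp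
  have "conj_by ?g (conj_by (adj ?g) (J n)) \<in> reflections (conj_by ?g A)" using J g by (simp add: conj_by_inverse)
  then show "reflections A \<noteq> {}" using reflections_conj_by[OF g] by blast
next
  assume "reflections A \<noteq> {}"
  then obtain R where R: "R \<in> reflections A" by blast
  then obtain g n where g: "n \<in> {0, 1}" "dt g = 1" "conj_by g R = J n"
    using reflection_conj_J[of R] unfolding reflections_def by blast
  have "J n \<in> reflections (conj_by g A)" using reflections_conj_by[OF g(2), of R A] R g(3) by simp
  then have "m11 (conj_by g A) = m22 (conj_by g A) + n * m21 (conj_by g A)"
    unfolding tr_J_mult[symmetric] by (simp add: reflections_def)
  then have mp: "meet_perpendicularly (axis (psl (conj_by g A))) (vline (of_int n / 2))"
    using A g by (intro perpendicular_vline) (auto simp: hyp_rep_conj)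
  obtain k :: "int \<Rightarrow> mat2" where k: "\<And>n. dt (k n) = 1"
    "{line_0_inf, line_0_2} = (\<lambda>n. act (k n) ` vline (of_int n / 2)) ` {0, 1}"
    using ambiguous_lines by metis
  define L where "L = act (k n) ` vline (of_int n / 2)"
  have L: "L \<in> {line_0_inf, line_0_2}" unfolding k(2) L_def using g(1) by blast
  have "psl_act (psl (adj (k n))) ` L = vline (of_int n / 2)"
    unfolding psl_act_eq L_def
    using act_image_mult[OF k(1) vline_subset_uhp, of "adj (k n)" n] k(1) by (simp add: mult_adj_1)
  then have "meet_perpendicularly (axis (psl (conj_by g A))) (psl_act (psl (adj (k n))) ` L)" using mp by simp
  moreover have "psl (conj_by g A) \<in> conj_class (psl A)" using g by (auto simp: conj_class_psl)
  moreover have "psl (adj (k n)) \<in> carrier PSL2Z" using k(1) by simp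
  ultimately show "ambiguous (conj_class (psl A))" unfolding ambiguous_def using L by blast
qed

text \<open>The axis of M passes through i iff m21 = m12, which is \<open>tr (S * M) = 0\<close>,
  and every half turn is conjugate to \<open>S\<close> or \<open>- S\<close>.\<close>

lemma reciprocal_psl:
  assumes A: "hyp_rep A"
  shows "reciprocal (conj_class (psl A)) \<longleftrightarrow> (\<exists>E. dt E = 1 \<and> tr E = 0 \<and> tr (E * A) = 0)"
proof -
  have i: "\<i> \<in> axis (psl M) \<longleftrightarrow> tr (S * M) = 0" if "hyp_rep M" for M
    using that by (auto simp: axis_psl qf_def uhp_def tr_def sel_times)
  have trE: "tr (conj_by g E * conj_by g A) = tr (E * A)" if "dt g = 1" for g E
    using that by (simp add: tr_conj_by flip: conj_by_mult)
  show ?thesis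
  proof
    assume "reciprocal (conj_class (psl A))"
    then obtain h e where h: "dt h = 1" "dt e = 1" "act e \<i> \<in> axis (psl (conj_by h A))"
      by (auto simp: reciprocal_def conj_class_psl orbit_def carrier_PSL2Z_psl psl_act_eq)
    let ?u = "adj e * h"
    have u: "dt ?u = 1" using h by simp
    have "act (adj e) (act e \<i>) \<in> axis (psl (conj_by ?u A))"
      using axis_conj[of "conj_by h A" "adj e"] A h by (auto simp: hyp_rep_conj simp flip: conj_by_conj_by)
    then have "\<i> \<in> axis (psl (conj_by ?u A))"
      using act_mult[of e \<i> "adj e"] h by (simp add: uhp_def mult_adj_1)
    then have "tr (S * conj_by ?u A) = 0" using i A u by (simp add: hyp_rep_conj)
    then have "tr (conj_by ?u (conj_by (adj ?u) S) * conj_by ?u A) = 0" using conj_by_inverse(2)[OF u] by simp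
    then have "tr (conj_by (adj ?u) S * A) = 0" using trE[OF u] by simp
    moreover have "dt (conj_by (adj ?u) S) = 1" "tr (conj_by (adj ?u) S) = 0"
      using u by (simp_all add: dt_conj_by tr_conj_by del: adj_simps)
    ultimately show "\<exists>E. dt E = 1 \<and> tr E = 0 \<and> tr (E * A) = 0" by blast
  next
    assume "\<exists>E. dt E = 1 \<and> tr E = 0 \<and> tr (E * A) = 0"
    then obtain E where E: "dt E = 1" "tr E = 0" "tr (E * A) = 0" by blast
    obtain g where g: "dt g = 1" "conj_by g E = S \<or> conj_by g E = - S" using elliptic_conj_S[OF E(1,2)] .
    have "tr (S * conj_by g A) = 0" using trE[OF g(1), of E] g(2) E(3) by auto
    then have "\<i> \<in> axis (psl (conj_by g A))" using i A g by (simp add: hyp_rep_conj)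
    moreover have "\<i> \<in> orbit PSL2Z psl_act \<i>"
    proof -
      have "\<i> = psl_act (psl 1) \<i>" by (simp add: psl_act_eq)
      then show ?thesis unfolding orbit_def using psl_in_carrier[of 1] by auto
    qed
    moreover have "psl (conj_by g A) \<in> conj_class (psl A)" using g by (auto simp: conj_class_psl)
    ultimately show "reciprocal (conj_class (psl A))" unfolding reciprocal_def by blast
  qed
qed

section \<open>Closed geodesics counted as matrices of bounded trace\<close>

section \<open>Closed geodesics as matrices in normal form\<close>

text \<open>Used with \<delta> = 1 for the matrices of geodesics and with \<delta> = -1 for their
  square roots; the last condition says that the discriminant of M is positive.\<close>

definition mirror_forms :: "int \<Rightarrow> int \<Rightarrow> (int \<times> mat2) set" where
  "mirror_forms \<delta> W = {(n, M). n \<in> {0, 1} \<and> dt M = \<delta> \<and> tr (J n * M) = 0 \<and> 0 < tr M \<and> tr M \<le> W \<and> 4 * \<delta> < (tr M)\<^sup>2}"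

lemma mirror_forms_m21_nz:
  assumes "(n, M) \<in> mirror_forms \<delta> W"
  shows "m21 M \<noteq> 0"
proof
  assume c: "m21 M = 0"
  then have a: "m11 M = m22 M" using assms by (simp add: mirror_forms_def tr_J_mult)
  have "m22 M * m22 M = \<delta>" "4 * \<delta> < (2 * m22 M)\<^sup>2" using assms a c by (auto simp: mirror_forms_def dt_def tr_def)
  then show False by (simp add: power2_eq_square)
qed

text \<open>Substituting m11 = m22 + n m21 shows that m21 divides the positive discriminant, and n,
  m21 and the trace determine M.\<close>

lemma finite_mirror_forms: "\<delta> \<in> {1, -1} \<Longrightarrow> finite (mirror_forms \<delta> W)"
proof -
  assume \<delta>: "\<delta> \<in> {1, -1}"
  define f where "f = (\<lambda>(n::int, M). (n, m21 M, tr M))"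
  let ?B = "{0, 1} \<times> {- (W\<^sup>2 + 4)..W\<^sup>2 + 4} \<times> {0..W}"
  have "f ` mirror_forms \<delta> W \<subseteq> ?B"
  proof
    fix y assume "y \<in> f ` mirror_forms \<delta> W"
    then obtain n M where M: "(n, M) \<in> mirror_forms \<delta> W" "y = (n, m21 M, tr M)" by (auto simp: f_def)
    have t: "0 < tr M" "tr M \<le> W" "4 * \<delta> < (tr M)\<^sup>2" "n \<in> {0, 1}" using M by (auto simp: mirror_forms_def)
    have a: "m11 M = m22 M + n * m21 M" using M by (simp add: mirror_forms_def tr_J_mult)
    have "(tr M)\<^sup>2 - 4 * \<delta> = m21 M * (n * n * m21 M + 4 * m12 M)"
      using M by (auto simp: mirror_forms_def tr_def dt_def a power2_eq_square algebra_simps)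
    then have "m21 M dvd (tr M)\<^sup>2 - 4 * \<delta>" by simp
    then have "\<bar>m21 M\<bar> \<le> (tr M)\<^sup>2 - 4 * \<delta>" using t by (intro zdvd_imp_le) auto
    moreover have "(tr M)\<^sup>2 \<le> W\<^sup>2" using t by (intro power_mono) auto
    moreover have "- 4 * \<delta> \<le> 4" using \<delta> by auto
    ultimately have "\<bar>m21 M\<bar> \<le> W\<^sup>2 + 4" by linarith
    then show "y \<in> ?B" using M(2) t by (auto simp: abs_le_iff)
  qed
  then have "finite (f ` mirror_forms \<delta> W)" by (rule finite_subset) auto
  moreover have "inj_on f (mirror_forms \<delta> W)"
  proof (rule inj_onI)
    fix x y assume xy: "x \<in> mirror_forms \<delta> W" "y \<in> mirror_forms \<delta> W" "f x = f y"
    obtain n M where x: "x = (n, M)" by force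
    obtain n' N where y: "y = (n', N)" by force
    have e: "n' = n" "m21 N = m21 M" "tr N = tr M" using xy(3) x y by (auto simp: f_def)
    have a: "m11 M = m22 M + n * m21 M" "m11 N = m22 N + n * m21 N"
      using xy x y e by (auto simp: mirror_forms_def tr_J_mult)
    then have d: "m22 M = m22 N" using e by (simp add: tr_def)
    then have a': "m11 M = m11 N" using a e by simp
    have "dt M = dt N" using xy x y by (auto simp: mirror_forms_def)
    then have "m12 M * m21 M = m12 N * m21 M" using d a' e by (simp add: dt_def)
    then have "m12 M = m12 N" using mirror_forms_m21_nz xy x by auto
    then show "x = y" using x y e d a' by (simp add: mat2_eq_iff)
  qed
  ultimately show ?thesis by (rule finite_imageD)
qed

lemma mirror_forms_hyp: "(n, M) \<in> mirror_forms 1 W \<Longrightarrow> hyp_rep M"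
proof -
  assume "(n, M) \<in> mirror_forms 1 W"
  then have "dt M = 1" "0 < tr M" "2\<^sup>2 < (tr M)\<^sup>2" by (auto simp: mirror_forms_def)
  then show "hyp_rep M" using power2_less_imp_less[of 2 "tr M"] by (simp add: hyp_rep_def)
qed

lemma mirror_forms_I: "hyp_rep M \<Longrightarrow> n \<in> {0, 1} \<Longrightarrow> tr (J n * M) = 0 \<Longrightarrow> tr M \<le> W \<Longrightarrow> (n, M) \<in> mirror_forms 1 W"
proof -
  assume *: "hyp_rep M" "n \<in> {0, 1}" "tr (J n * M) = 0" "tr M \<le> W"
  then have "2\<^sup>2 < (tr M)\<^sup>2" by (intro power_strict_mono) (auto simp: hyp_rep_def)
  then show ?thesis using * by (auto simp: mirror_forms_def hyp_rep_def)
qed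

lemma card_eq_mult_card_image:
  assumes "finite P" "\<And>x. x \<in> P \<Longrightarrow> card {y \<in> P. f y = f x} = k"
  shows "card P = k * card (f ` P)"
proof -
  have "(\<Sum>x\<in>P. 1) = (\<Sum>y\<in>f ` P. \<Sum>x\<in>{x \<in> P. f x = y}. 1)"
    by (rule sum.image_gen) fact
  also have "\<dots> = (\<Sum>y\<in>f ` P. k)" using assms(2) by (intro sum.cong) auto
  finally show ?thesis by simp
qed

text \<open>The length l satisfies cosh l = t^2 / 2 - 1 for the trace t, that is t = 2 cosh (l /
  2).\<close>

lemma length_le_iff:
  assumes "hyp_rep M" "0 \<le> s"
  shows "geodesic_length (conj_class (psl M)) \<le> s \<longleftrightarrow> tr M \<le> \<lfloor>2 * cosh (s / 2)\<rfloor>"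
proof -
  have "geodesic_length (conj_class (psl M)) \<le> s \<longleftrightarrow>
      arcosh ((real_of_int (tr M))\<^sup>2 / 2 - 1) \<le> arcosh (cosh s)"
    using assms by (simp add: geodesic_length_psl arcosh_cosh_real)
  also have "\<dots> \<longleftrightarrow> (real_of_int (tr M))\<^sup>2 / 2 - 1 \<le> cosh s"
    using hyp_half_trace[OF assms(1)] cosh_real_ge_1[of s] by (intro arcosh_le_iff) auto
  also have "cosh s = 2 * (cosh (s / 2))\<^sup>2 - 1"
    using cosh_double[of "s / 2"] hyperbolic_pythagoras[of "s / 2"] by simp
  also have "(real_of_int (tr M))\<^sup>2 / 2 - 1 \<le> 2 * (cosh (s / 2))\<^sup>2 - 1 \<longleftrightarrow>
      (real_of_int (tr M))\<^sup>2 \<le> (2 * cosh (s / 2))\<^sup>2"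
    by (simp add: power_mult_distrib)
  also have "\<dots> \<longleftrightarrow> real_of_int (tr M) \<le> 2 * cosh (s / 2)"
    using assms(1) by (intro power_mono_iff) (auto simp: hyp_rep_def)
  finally show ?thesis by (simp add: le_floor_iff)
qed

text \<open>The map \<open>\<Phi>\<close> from normal forms to classes has the sets
  \<open>fibre\<close>, of size 4, as its fibres. The predicate Q lets one argument serve all
  ambiguous classes and the reciprocal ones among them.\<close>

lemma card_ambiguous_classes:
  assumes "0 \<le> s"
  shows "4 * card {C \<in> primitive_closed_geodesics. geodesic_length C \<le> s \<and> ambiguous C \<and> Q C} =
    card {x \<in> mirror_forms 1 \<lfloor>2 * cosh (s / 2)\<rfloor>. prim_rep (snd x) \<and> Q (conj_class (psl (snd x)))}"
proof -
  let ?W = "\<lfloor>2 * cosh (s / 2)\<rfloor>"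
  define \<Phi> where "\<Phi> x = conj_class (psl (snd x))" for x :: "int \<times> mat2"
  define P where "P = {x \<in> mirror_forms 1 ?W. prim_rep (snd x) \<and> Q (\<Phi> x)}"
  have fin: "finite P" unfolding P_def by (intro finite_subset[OF _ finite_mirror_forms]) auto
  have fib: "{y \<in> P. \<Phi> y = \<Phi> x} = fibre (snd x)" if x: "x \<in> P" for x
  proof -
    obtain n M where nM: "x = (n, M)" by force
    have M: "hyp_rep M" "prim_rep M" "Q (\<Phi> x)" "tr M \<le> ?W" using x mirror_forms_hyp nM by (auto simp: P_def mirror_forms_def)
    have "y \<in> P \<and> \<Phi> y = \<Phi> x \<longleftrightarrow> y \<in> fibre M" for y
    proof -
      obtain m N where mN: "y = (m, N)" by force
      show ?thesis
      proof
        assume y: "y \<in> P \<and> \<Phi> y = \<Phi> x"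
        then have N: "hyp_rep N" "m \<in> {0, 1}" "tr (J m * N) = 0" using mirror_forms_hyp mN by (auto simp: P_def mirror_forms_def)
        have "conj_class (psl M) = conj_class (psl N)" using y nM mN by (simp add: \<Phi>_def)
        then have "\<exists>g. dt g = 1 \<and> N = conj_by g M"
          using conj_class_eq_iff[of M N] M N by (auto simp: hyp_rep_def)
        then show "y \<in> fibre M" using N mN by (auto simp: fibre_def)
      next
        assume "y \<in> fibre M"
        then obtain g where N: "m \<in> {0, 1}" "tr (J m * N) = 0" "dt g = 1" "N = conj_by g M"
          using mN by (auto simp: fibre_def)
        have h: "hyp_rep N" "prim_rep N" "tr N = tr M" using N M by (auto simp: hyp_rep_conj prim_rep_conj tr_conj_by)
        have "conj_class (psl M) = conj_class (psl N)"
          using conj_class_eq_iff[of M N] M N h by (auto simp: hyp_rep_def)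
        then have "\<Phi> y = \<Phi> x" using nM mN by (simp add: \<Phi>_def)
        moreover have "y \<in> mirror_forms 1 ?W" using mirror_forms_I[OF h(1) N(1,2)] h(3) M(4) mN by simp
        ultimately show "y \<in> P \<and> \<Phi> y = \<Phi> x" using h M mN by (simp add: P_def)
      qed
    qed
    then show ?thesis using nM by auto
  qed
  have c4: "card {y \<in> P. \<Phi> y = \<Phi> x} = 4" if x: "x \<in> P" for x
  proof -
    obtain n M where nM: "x = (n, M)" by force
    have M: "hyp_rep M" "prim_rep M" "tr (J n * M) = 0" using x mirror_forms_hyp nM by (auto simp: P_def mirror_forms_def)
    then have "J n \<in> reflections M" by (simp add: reflections_def)
    then show ?thesis using fib[OF x] card_fibre[OF M(1,2)] nM by simp
  qed
  have "{C \<in> primitive_closed_geodesics. geodesic_length C \<le> s \<and> ambiguous C \<and> Q C} = \<Phi> ` P"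
  proof (intro subset_antisym subsetI)
    fix C assume C: "C \<in> {C \<in> primitive_closed_geodesics. geodesic_length C \<le> s \<and> ambiguous C \<and> Q C}"
    then obtain \<gamma> where "\<gamma> \<in> carrier PSL2Z" "hyperbolic \<gamma>" "primitive \<gamma>" and C\<gamma>: "C = conj_class \<gamma>"
      by (auto simp: primitive_closed_geodesics_def)
    then obtain A where A: "\<gamma> = psl A" "hyp_rep A" "prim_rep A" using hyp_prim_cases by blast
    have tA: "tr A \<le> ?W" using length_le_iff[OF A(2) assms] C C\<gamma> A(1) by simp
    obtain R where R: "R \<in> reflections A" using ambiguous_psl[OF A(2)] C C\<gamma> A(1) by auto
    then obtain g n where g: "n \<in> {0, 1}" "dt g = 1" "conj_by g R = J n"
      using reflection_conj_J[of R] unfolding reflections_def by blast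
    have "J n \<in> reflections (conj_by g A)" using reflections_conj_by[OF g(2), of R A] R g(3) by simp
    then have t0: "tr (J n * conj_by g A) = 0" by (simp add: reflections_def)
    have h: "hyp_rep (conj_by g A)" "prim_rep (conj_by g A)" "tr (conj_by g A) = tr A"
      using A g by (auto simp: hyp_rep_conj prim_rep_conj tr_conj_by)
    have "conj_class (psl A) = conj_class (psl (conj_by g A))"
      using conj_class_eq_iff[of A "conj_by g A"] A h g by (auto simp: hyp_rep_def)
    then have "C = \<Phi> (n, conj_by g A)" using C\<gamma> A(1) by (simp add: \<Phi>_def)
    moreover have "(n, conj_by g A) \<in> mirror_forms 1 ?W" using mirror_forms_I[OF h(1) g(1) t0] h(3) tA by simp
    ultimately show "C \<in> \<Phi> ` P" using h C by (intro image_eqI[of _ _ "(n, conj_by g A)"]) (auto simp: P_def)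
  next
    fix C assume "C \<in> \<Phi> ` P"
    then obtain n M where nM: "(n, M) \<in> P" "C = \<Phi> (n, M)" by auto
    have M: "hyp_rep M" "prim_rep M" "tr (J n * M) = 0" "tr M \<le> ?W" "Q C"
      using nM mirror_forms_hyp by (auto simp: P_def mirror_forms_def)
    have C: "C = conj_class (psl M)" using nM by (simp add: \<Phi>_def)
    have "J n \<in> reflections M" using M by (simp add: reflections_def)
    then have "ambiguous C" using ambiguous_psl[OF M(1)] C by auto
    moreover have "geodesic_length C \<le> s" using length_le_iff[OF M(1) assms] M C by simp
    moreover have "C \<in> primitive_closed_geodesics"
      unfolding primitive_closed_geodesics_def C
      using M by (intro imageI) (auto simp: hyperbolic_psl primitive_psl hyp_rep_def)
    ultimately show "C \<in> {C \<in> primitive_closed_geodesics. geodesic_length C \<le> s \<and> ambiguous C \<and> Q C}"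
      using M by simp
  qed
  then show ?thesis using card_eq_mult_card_image[OF fin c4] by (simp add: P_def \<Phi>_def)
qed

lemma N_A_eq_card:
  assumes "0 \<le> s"
  shows "4 * N_A s = card {x \<in> mirror_forms 1 \<lfloor>2 * cosh (s / 2)\<rfloor>. prim_rep (snd x)}"
  using card_ambiguous_classes[OF assms, of "\<lambda>_. True"] by (simp add: N_A_def)

lemma tr_J_square:
  assumes "dt \<epsilon> = -1" "tr \<epsilon> \<noteq> 0"
  shows "tr (J n * (\<epsilon> * \<epsilon>)) = 0 \<longleftrightarrow> tr (J n * \<epsilon>) = 0"
  using assms by (simp add: cayley_hamilton tr_mult_add)

lemma trace_le_sinh_iff:
  fixes s :: real
  assumes "0 \<le> s" "0 < (t::int)"
  shows "t\<^sup>2 + 2 \<le> \<lfloor>2 * cosh (s / 2)\<rfloor> \<longleftrightarrow> t \<le> \<lfloor>2 * sinh (s / 4)\<rfloor>"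
proof -
  have "2 * cosh (s / 2) = (2 * sinh (s / 4))\<^sup>2 + 2"
    using cosh_double[of "s / 4"] hyperbolic_pythagoras[of "s / 4"] by (simp add: power_mult_distrib)
  then have "t\<^sup>2 + 2 \<le> \<lfloor>2 * cosh (s / 2)\<rfloor> \<longleftrightarrow> (real_of_int t)\<^sup>2 \<le> (2 * sinh (s / 4))\<^sup>2"
    by (simp add: le_floor_iff)
  also have "\<dots> \<longleftrightarrow> real_of_int t \<le> 2 * sinh (s / 4)"
    using assms by (intro power_mono_iff) auto
  finally show ?thesis by (simp add: le_floor_iff)
qed

text \<open>Squaring is a bijection from the determinant -1 forms with primitive square to the
  reciprocal primitive forms with the same \<open>J n\<close>. The half turn that witnesses
  reciprocity of \<epsilon>^2 is \<open>J n * \<epsilon>\<close>.\<close>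

lemma N_AR_eq_card:
  assumes "0 \<le> s"
  shows "4 * N_AR s = card {x \<in> mirror_forms (-1) \<lfloor>2 * sinh (s / 4)\<rfloor>. prim_rep (snd x * snd x)}"
proof -
  let ?W = "\<lfloor>2 * cosh (s / 2)\<rfloor>" and ?V = "\<lfloor>2 * sinh (s / 4)\<rfloor>"
  let ?P = "{x \<in> mirror_forms 1 ?W. prim_rep (snd x) \<and> reciprocal (conj_class (psl (snd x)))}"
  let ?E = "{x \<in> mirror_forms (-1) ?V. prim_rep (snd x * snd x)}"
  define sq where "sq x = (fst x, snd x * snd x)" for x :: "int \<times> mat2"
  have inj: "inj_on sq ?E"
    by (rule inj_onI) (auto simp: sq_def mirror_forms_def intro: square_root_unique)
  have img: "sq ` ?E = ?P"
  proof
    show "sq ` ?E \<subseteq> ?P"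
    proof
      fix y assume "y \<in> sq ` ?E"
      then obtain n \<epsilon> where e: "(n, \<epsilon>) \<in> mirror_forms (-1) ?V" "prim_rep (\<epsilon> * \<epsilon>)" "y = (n, \<epsilon> * \<epsilon>)"
        by (auto simp: sq_def)
      have e': "n \<in> {0, 1}" "dt \<epsilon> = -1" "tr (J n * \<epsilon>) = 0" "0 < tr \<epsilon>" "tr \<epsilon> \<le> ?V"
        using e by (auto simp: mirror_forms_def)
      have t: "tr (\<epsilon> * \<epsilon>) = (tr \<epsilon>)\<^sup>2 + 2" using tr_square[of \<epsilon>] e' by simp
      have hyp: "hyp_rep (\<epsilon> * \<epsilon>)" using t e' by (simp add: hyp_rep_def)
      have J: "tr (J n * (\<epsilon> * \<epsilon>)) = 0" using tr_J_square e' by simp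
      have "tr (\<epsilon> * \<epsilon>) \<le> ?W" using trace_le_sinh_iff[OF assms e'(4)] t e'(5) by simp
      then have "y \<in> mirror_forms 1 ?W" using mirror_forms_I[OF hyp e'(1) J] e by simp
      moreover have "reciprocal (conj_class (psl (\<epsilon> * \<epsilon>)))"
        unfolding reciprocal_psl[OF hyp]
      proof (intro exI conjI)
        show "dt (J n * \<epsilon>) = 1" "tr (J n * \<epsilon>) = 0" using e' by simp_all
        have "\<epsilon> * (\<epsilon> * \<epsilon>) = of_int (tr \<epsilon>) * (\<epsilon> * \<epsilon>) + \<epsilon>"
        proof -
          have "\<epsilon> * \<epsilon> = of_int (tr \<epsilon>) * \<epsilon> + 1" using cayley_hamilton[of \<epsilon>] e'(2) by simp
          then have "(\<epsilon> * \<epsilon>) * \<epsilon> = (of_int (tr \<epsilon>) * \<epsilon> + 1) * \<epsilon>" by (rule arg_cong)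
          then show ?thesis by (simp add: distrib_right mult.assoc)
        qed
        then show "tr (J n * \<epsilon> * (\<epsilon> * \<epsilon>)) = 0"
          using J e' by (simp add: mult.assoc tr_mult_add)
      qed
      ultimately show "y \<in> ?P" using e by simp
    qed
    show "?P \<subseteq> sq ` ?E"
    proof
      fix y assume y: "y \<in> ?P"
      obtain n M where nM: "y = (n, M)" by force
      have M: "hyp_rep M" "prim_rep M" "tr (J n * M) = 0" "n \<in> {0, 1}" "tr M \<le> ?W"
        using y nM mirror_forms_hyp by (auto simp: mirror_forms_def)
      obtain E where E: "dt E = 1" "tr E = 0" "tr (E * M) = 0"
        using reciprocal_psl[OF M(1)] y nM by auto
      have "J n \<in> reflections M" using M by (simp add: reflections_def)
      then obtain \<epsilon> where e: "dt \<epsilon> = -1" "0 < tr \<epsilon>" "\<epsilon> * \<epsilon> = M"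
        using square_root_exists[OF M(1,2) _ E] by blast
      have "tr M = (tr \<epsilon>)\<^sup>2 + 2" using tr_square[of \<epsilon>] e by simp
      then have "tr \<epsilon> \<le> ?V" using trace_le_sinh_iff[OF assms e(2)] M(5) by simp
      moreover have "tr (J n * \<epsilon>) = 0" using tr_J_square[of \<epsilon> n] e M(3) by simp
      ultimately have "(n, \<epsilon>) \<in> ?E"
        using e M by (auto simp: mirror_forms_def intro: less_le_trans[OF _ zero_le_power2])
      then show "y \<in> sq ` ?E" using e nM by (intro image_eqI[of _ _ "(n, \<epsilon>)"]) (simp_all add: sq_def)
    qed
  qed
  have "card ?P = card ?E" unfolding img[symmetric] by (rule card_image[OF inj])
  then show ?thesis using card_ambiguous_classes[OF assms, of reciprocal] by (simp add: N_AR_def)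
qed

section \<open>Proper powers\<close>

lemma eigval_power: "eigvec \<xi> C \<Longrightarrow> eigval \<xi> (C ^ n) = eigval \<xi> C ^ n"
proof (induction n)
  case (Suc n)
  have "eigval \<xi> (C ^ Suc n) = eigval \<xi> (C ^ n * C)" by (simp add: power_commutes)
  also have "\<dots> = eigval \<xi> C ^ Suc n" using Suc by (simp only: eigval_mult power_Suc2)
  finally show ?case .
qed simp

text \<open>A root of M commutes with M, so its fixed-point equation is proportional to that of M
  and it is inverted by the same \<open>J n\<close>; its sign is chosen to make the trace positive.
  Thus proper powers are counted by normal forms of smaller trace.\<close>

lemma nonprimitive_root:
  assumes M: "(n, M) \<in> mirror_forms 1 W" and np: "\<not> prim_rep M"
  obtains B k where "2 \<le> k" "(n, B) \<in> mirror_forms 1 W" "M = B ^ k" "(tr B - 1) ^ k \<le> tr M" "2 < tr B"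
proof -
  have hM: "hyp_rep M" using mirror_forms_hyp[OF M] .
  obtain B k where B: "dt B = 1" "2 \<le> k" "M = B ^ k \<or> M = - (B ^ k)"
    using np by (auto simp: prim_rep_def)
  have BM: "B * M = M * B" using B(3) by (auto simp: power_commutes)
  obtain \<xi> where \<xi>: "eigvec \<xi> M" "1 < eigval \<xi> M" using hyp_eigenvector[OF hM] .
  define l where "l = eigval \<xi> B"
  have eB: "eigvec \<xi> B" using eigvec_commute[OF hM \<xi>(1) BM] .
  have "eigvec \<xi> (adj B)" using eigvec_commute[OF hM \<xi>(1) adj_commute[OF B(1) BM]] .
  then have inv: "l * eigval \<xi> (adj B) = 1"
    using eigval_mult[of \<xi> "adj B" B] B(1) by (simp add: mult_adj_1 l_def)
  have "eigval \<xi> M = l ^ k \<or> eigval \<xi> M = - (l ^ k)"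
    using B(3) eigval_power[OF eB, of k] by (auto simp: l_def)
  \<comment> \<open>An eigenvalue of absolute value above 1 makes B hyperbolic, since its trace then
    has absolute value |l| + 1 / |l| > 2.\<close>
  then have "\<bar>l\<bar> ^ k > 1" using \<xi>(2) by (auto simp flip: power_abs)
  then have l1: "\<bar>l\<bar> > 1" by (meson abs_ge_zero not_le power_le_one)
  have "l \<noteq> 0" using inv by auto
  then have "eigval \<xi> (adj B) = 1 / l" using inv by (simp add: field_simps)
  then have "real_of_int (tr B) = l + 1 / l"
    using eigval_adj_add[of \<xi> B] by (simp add: l_def)
  moreover have "\<bar>l + 1 / l\<bar> = \<bar>l\<bar> + 1 / \<bar>l\<bar>"
  proof (cases "0 < l")
    case True
    then have "0 < 1 / l" by simp
    then show ?thesis using True by linarith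
  next
    case False
    then have "l < 0" "1 / l < 0" using \<open>l \<noteq> 0\<close> by simp_all
    then have "\<bar>l\<bar> = - l" "\<bar>l + 1 / l\<bar> = - l - 1 / l" by linarith+
    then show ?thesis by simp
  qed
  ultimately have "\<bar>real_of_int (tr B)\<bar> = \<bar>l\<bar> + 1 / \<bar>l\<bar>" by simp
  then have "\<bar>tr B\<bar> > 2" using add_inverse_strict_mono[of 1 "\<bar>l\<bar>"] l1 by linarith
  then obtain B' where B': "hyp_rep B'" "B' = B \<or> B' = - B"
    using B(1) by (cases "tr B > 0") (auto simp: hyp_rep_def intro: that[of B] that[of "- B"])
  have "B' ^ k = B ^ k \<or> B' ^ k = - (B ^ k)"
    using B'(2) by (cases "even k") auto
  then have "M = B' ^ k \<or> M = - (B' ^ k)" using B(3) by auto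
  moreover have "2 < tr (B' ^ k)" using tr_power_gt_2[OF B'(1), of k] B(2) by simp
  ultimately have MB: "M = B' ^ k" using hM by (auto simp: hyp_rep_def)
  have B'M: "B' * M = M * B'" by (simp add: MB power_commutes)
  have "m21 B' * (n * m21 M) = m21 M * (m11 B' - m22 B')"
    using commute_entries(1)[OF B'M] M by (simp add: mirror_forms_def tr_J_mult)
  then have "m21 M * (n * m21 B') = m21 M * (m11 B' - m22 B')" by (simp add: algebra_simps)
  then have "n * m21 B' = m11 B' - m22 B'" using hyp_m21_nz[OF hM] by (simp only: mult_cancel_left) simp
  then have "tr (J n * B') = 0" by (simp add: tr_J_mult)
  moreover have ge: "(tr B' - 1) ^ k \<le> tr M" using tr_power_ge[OF B'(1), of k] B(2) MB by simp
  moreover have "tr B' \<le> W"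
  proof -
    have "tr B' \<le> (tr B' - 1)\<^sup>2"
    proof -
      have "3 * tr B' \<le> tr B' * tr B'" using B'(1) by (intro mult_right_mono) (auto simp: hyp_rep_def)
      moreover have "(tr B' - 1)\<^sup>2 = tr B' * tr B' - 2 * tr B' + 1"
        by (simp add: power2_eq_square algebra_simps)
      ultimately show ?thesis by linarith
    qed
    also have "\<dots> \<le> (tr B' - 1) ^ k" using B'(1) B(2) by (intro power_increasing) (auto simp: hyp_rep_def)
    also have "\<dots> \<le> tr M" by fact
    also have "\<dots> \<le> W" using M by (auto simp: mirror_forms_def)
    finally show ?thesis .
  qed
  ultimately show ?thesis
    using that[of k B'] B(2) MB mirror_forms_I[OF B'(1)] M B'(1) by (auto simp: mirror_forms_def hyp_rep_def)
qed

text \<open>A non-primitive form is determined by its root B, of trace at most V, and the exponent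
  k; the latter is below K because \<open>(tr B - 1) ^ k\<close> is at least
  \<open>2 ^ k\<close>.\<close>

lemma card_nonprimitive_le:
  assumes "\<And>t. 2 < t \<Longrightarrow> (t - 1)\<^sup>2 \<le> W \<Longrightarrow> t \<le> V" "W < 2 ^ K"
  shows "card {x \<in> mirror_forms 1 W. \<not> prim_rep (snd x)} \<le> K * card (mirror_forms 1 V)"
proof -
  let ?S = "{x \<in> mirror_forms 1 W. \<not> prim_rep (snd x)}"
  define f where "f = (\<lambda>(k, n, B :: mat2). (n :: int, B ^ k))"
  have "?S \<subseteq> f ` ({..<K} \<times> mirror_forms 1 V)"
  proof
    fix x assume "x \<in> ?S"
    then obtain n M where x: "x = (n, M)" "(n, M) \<in> mirror_forms 1 W" "\<not> prim_rep M" by (cases x) auto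
    obtain B k where B: "2 \<le> k" "(n, B) \<in> mirror_forms 1 W" "M = B ^ k" "(tr B - 1) ^ k \<le> tr M" "2 < tr B"
      using nonprimitive_root[OF x(2,3)] .
    have tM: "tr M \<le> W" using x by (auto simp: mirror_forms_def)
    have "(tr B - 1)\<^sup>2 \<le> (tr B - 1) ^ k" using B by (intro power_increasing) auto
    then have "tr B \<le> V" using assms(1)[of "tr B"] B tM by linarith
    then have BV: "(n, B) \<in> mirror_forms 1 V" using B(2) by (auto simp: mirror_forms_def)
    have "2 ^ k \<le> (tr B - 1) ^ k" using B by (intro power_mono) auto
    then have "(2::int) ^ k < 2 ^ K" using B tM assms(2) by linarith
    then have "k < K" by (simp add: power_strict_increasing_iff)
    then show "x \<in> f ` ({..<K} \<times> mirror_forms 1 V)"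
      using BV x B by (intro image_eqI[of _ _ "(k, n, B)"]) (auto simp: f_def)
  qed
  moreover have "finite ({..<K} \<times> mirror_forms 1 V)" by (intro finite_cartesian_product finite_mirror_forms) auto
  ultimately have "card ?S \<le> card ({..<K} \<times> mirror_forms 1 V)" by (rule surj_card_le[rotated])
  then show ?thesis by (simp add: card_cartesian_product)
qed

text \<open>The exponent 2 is excluded by \<open>square_not_even_power\<close>, so it is the cube of
  \<open>tr B - 1\<close>, not only its square, that is bounded by W^2 + 2.\<close>

lemma card_nonprimitive_square_le:
  assumes "\<And>t. 2 < t \<Longrightarrow> (t - 1) ^ 3 \<le> W\<^sup>2 + 2 \<Longrightarrow> t \<le> V" "W\<^sup>2 + 2 < 2 ^ K"
  shows "card {x \<in> mirror_forms (-1) W. \<not> prim_rep (snd x * snd x)} \<le> K * card (mirror_forms 1 V)"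
proof -
  let ?S = "{x \<in> mirror_forms (-1) W. \<not> prim_rep (snd x * snd x)}"
  define sq where "sq x = (fst x, snd x * snd x)" for x :: "int \<times> mat2"
  define f where "f = (\<lambda>(k, n, B :: mat2). (n :: int, B ^ k))"
  have inj: "inj_on sq ?S"
    by (rule inj_onI) (auto simp: sq_def mirror_forms_def intro: square_root_unique)
  have "sq ` ?S \<subseteq> f ` ({..<K} \<times> mirror_forms 1 V)"
  proof
    fix x assume "x \<in> sq ` ?S"
    then obtain n \<epsilon> where x: "x = (n, \<epsilon> * \<epsilon>)" "(n, \<epsilon>) \<in> mirror_forms (-1) W" "\<not> prim_rep (\<epsilon> * \<epsilon>)" by (auto simp: sq_def)
    have e: "n \<in> {0, 1}" "dt \<epsilon> = -1" "tr (J n * \<epsilon>) = 0" "0 < tr \<epsilon>" "tr \<epsilon> \<le> W"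
      using x by (auto simp: mirror_forms_def)
    have t: "tr (\<epsilon> * \<epsilon>) = (tr \<epsilon>)\<^sup>2 + 2" using tr_square[of \<epsilon>] e by simp
    also have "\<dots> \<le> W\<^sup>2 + 2" using e by simp
    finally have tW: "tr (\<epsilon> * \<epsilon>) \<le> W\<^sup>2 + 2" .
    have hyp: "hyp_rep (\<epsilon> * \<epsilon>)" using t e by (simp add: hyp_rep_def)
    have J: "tr (J n * (\<epsilon> * \<epsilon>)) = 0" using tr_J_square e by simp
    obtain B k where B: "2 \<le> k" "(n, B) \<in> mirror_forms 1 (W\<^sup>2 + 2)" "\<epsilon> * \<epsilon> = B ^ k" "(tr B - 1) ^ k \<le> tr (\<epsilon> * \<epsilon>)" "2 < tr B"
      using nonprimitive_root[OF mirror_forms_I[OF hyp e(1) J tW] x(3)] .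
    have "dt B = 1" using B(2) by (auto simp: mirror_forms_def)
    then have "k \<noteq> 2 * j" for j using square_not_even_power[OF e(2,4), of B j] B(3) by auto
    then have "k \<noteq> 2" by (metis mult_2_right nat_mult_1_right mult.commute)
    then have k3: "3 \<le> k" using B(1) by simp
    have "(tr B - 1) ^ 3 \<le> (tr B - 1) ^ k" using B k3 by (intro power_increasing) auto
    then have "tr B \<le> V" using assms(1)[of "tr B"] B tW by linarith
    then have BV: "(n, B) \<in> mirror_forms 1 V" using B(2) by (auto simp: mirror_forms_def)
    have "2 ^ k \<le> (tr B - 1) ^ k" using B by (intro power_mono) auto
    then have "(2::int) ^ k < 2 ^ K" using B tW assms(2) by linarith
    then have "k < K" by (simp add: power_strict_increasing_iff)
    then show "x \<in> f ` ({..<K} \<times> mirror_forms 1 V)"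
      using BV x B by (intro image_eqI[of _ _ "(k, n, B)"]) (auto simp: f_def)
  qed
  moreover have "finite ({..<K} \<times> mirror_forms 1 V)" by (intro finite_cartesian_product finite_mirror_forms) auto
  ultimately have "card (sq ` ?S) \<le> card ({..<K} \<times> mirror_forms 1 V)" by (rule surj_card_le[rotated])
  then show ?thesis using card_image[OF inj] by (simp add: card_cartesian_product)
qed

section \<open>Quadratic congruences and binary quadratic forms\<close>

section \<open>From matrices to quadratic congruences\<close>

text \<open>The pair is the bottom row of a normal form. Inversion by \<open>J n\<close> gives the
  entry d + n c above c, the determinant then fixes the last entry and requires c to divide d^2 -
  \<delta>, and 2 d + n c is the trace.\<close>

definition mirror_pairs :: "int \<Rightarrow> int \<Rightarrow> int \<Rightarrow> (int \<times> int) set" where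
  "mirror_pairs n \<delta> W = {(c, d). c \<noteq> 0 \<and> c dvd d\<^sup>2 - \<delta> \<and> 0 < 2 * d + n * c \<and> 2 * d + n * c \<le> W \<and> 4 * \<delta> < (2 * d + n * c)\<^sup>2}"

lemma bij_mirror_forms_mirror_pairs:
  "bij_betw (\<lambda>(n, M). (n, (m21 M, m22 M))) (mirror_forms \<delta> W) (SIGMA n:{0, 1}. mirror_pairs n \<delta> W)"
proof (rule bij_betw_byWitness[where f' = "\<lambda>(n, (c, d)). (n, Mat2 (d + n * c) ((d\<^sup>2 - \<delta>) div c + n * d) c d)"])
  have *: "m11 M = m22 M + n * m21 M" "m12 M = ((m22 M)\<^sup>2 - \<delta>) div m21 M + n * m22 M"
    "m21 M dvd (m22 M)\<^sup>2 - \<delta>" "m21 M \<noteq> 0" if M: "(n, M) \<in> mirror_forms \<delta> W" for n M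
  proof -
    show a: "m11 M = m22 M + n * m21 M" using M by (simp add: mirror_forms_def tr_J_mult)
    show c: "m21 M \<noteq> 0" using mirror_forms_m21_nz[OF M] .
    have e: "(m22 M)\<^sup>2 - \<delta> = m21 M * (m12 M - n * m22 M)"
      using M a by (auto simp: mirror_forms_def dt_def power2_eq_square algebra_simps)
    then show "m21 M dvd (m22 M)\<^sup>2 - \<delta>" by simp
    show "m12 M = ((m22 M)\<^sup>2 - \<delta>) div m21 M + n * m22 M" unfolding e using c by simp
  qed
  show "\<forall>x\<in>mirror_forms \<delta> W. (\<lambda>(n, (c, d)). (n, Mat2 (d + n * c) ((d\<^sup>2 - \<delta>) div c + n * d) c d))
      ((\<lambda>(n, M). (n, (m21 M, m22 M))) x) = x"
    using *(1,2) by (auto simp: mat2_eq_iff)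
  show "(\<lambda>(n, M). (n, (m21 M, m22 M))) ` mirror_forms \<delta> W \<subseteq> (SIGMA n:{0, 1}. mirror_pairs n \<delta> W)"
  proof
    fix y assume "y \<in> (\<lambda>(n, M). (n, (m21 M, m22 M))) ` mirror_forms \<delta> W"
    then obtain n M where M: "(n, M) \<in> mirror_forms \<delta> W" and y: "y = (n, m21 M, m22 M)" by auto
    have "tr M = 2 * m22 M + n * m21 M" using *(1)[OF M] by (simp add: tr_def)
    then have "(m21 M, m22 M) \<in> mirror_pairs n \<delta> W"
      using *(3,4)[OF M] M by (simp add: mirror_pairs_def mirror_forms_def)
    then show "y \<in> (SIGMA n:{0, 1}. mirror_pairs n \<delta> W)" using M y by (auto simp: mirror_forms_def)
  qed
  show "(\<lambda>(n, (c, d)). (n, Mat2 (d + n * c) ((d\<^sup>2 - \<delta>) div c + n * d) c d)) ` (SIGMA n:{0, 1}. mirror_pairs n \<delta> W) \<subseteq> mirror_forms \<delta> W"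
  proof
    fix y assume "y \<in> (\<lambda>(n, (c, d)). (n, Mat2 (d + n * c) ((d\<^sup>2 - \<delta>) div c + n * d) c d)) ` (SIGMA n:{0, 1}. mirror_pairs n \<delta> W)"
    then obtain n c d where n: "n \<in> {0, 1::int}" and cd: "(c, d) \<in> mirror_pairs n \<delta> W"
      and y: "y = (n, Mat2 (d + n * c) ((d\<^sup>2 - \<delta>) div c + n * d) c d)" by auto
    then have dv: "c dvd d\<^sup>2 - \<delta>" by (simp add: mirror_pairs_def)
    let ?M = "Mat2 (d + n * c) ((d\<^sup>2 - \<delta>) div c + n * d) c d"
    have "c * ((d\<^sup>2 - \<delta>) div c) = d\<^sup>2 - \<delta>" using dv by simp
    then have "dt ?M = \<delta>" by (simp add: dt_def power2_eq_square algebra_simps)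
    moreover have "tr ?M = 2 * d + n * c" by (simp add: tr_def)
    ultimately show "y \<in> mirror_forms \<delta> W" using n cd unfolding y mirror_forms_def tr_J_mult by (simp add: mirror_pairs_def)
  qed
qed auto

lemma card_mirror_forms_mirror_pairs:
  assumes "\<delta> \<in> {1, -1}"
  shows "card (mirror_forms \<delta> W) = card (mirror_pairs 0 \<delta> W) + card (mirror_pairs 1 \<delta> W)" "finite (mirror_pairs 0 \<delta> W)" "finite (mirror_pairs 1 \<delta> W)"
proof -
  have "finite (SIGMA n:{0, 1}. mirror_pairs n \<delta> W)"
    using bij_betw_finite[OF bij_mirror_forms_mirror_pairs] finite_mirror_forms[OF assms] by blast
  then have f: "finite (mirror_pairs n \<delta> W)" if "n \<in> {0, 1}" for n
    by (rule finite_surj[where f = snd]) (use that in force)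
  then show "finite (mirror_pairs 0 \<delta> W)" "finite (mirror_pairs 1 \<delta> W)" by simp_all
  have "card (mirror_forms \<delta> W) = card (SIGMA n:{0, 1}. mirror_pairs n \<delta> W)" by (rule bij_betw_same_card[OF bij_mirror_forms_mirror_pairs])
  also have "\<dots> = (\<Sum>n\<in>{0, 1}. card (mirror_pairs n \<delta> W))" using f by (intro card_SigmaI) auto
  finally show "card (mirror_forms \<delta> W) = card (mirror_pairs 0 \<delta> W) + card (mirror_pairs 1 \<delta> W)" by simp
qed

lemma card_involution:
  assumes "finite A" "\<And>x. x \<in> A \<Longrightarrow> f x \<in> A" "\<And>x. x \<in> A \<Longrightarrow> f (f x) = x" "\<And>x. x \<in> A \<Longrightarrow> P (f x) \<longleftrightarrow> \<not> P x"
  shows "card A = 2 * card {x \<in> A. P x}"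
proof -
  have "bij_betw f {x \<in> A. P x} {x \<in> A. \<not> P x}"
    by (rule bij_betw_byWitness[where f' = f]) (use assms in auto)
  then have "card {x \<in> A. \<not> P x} = card {x \<in> A. P x}" by (rule bij_betw_same_card[symmetric])
  moreover have "card A = card {x \<in> A. P x} + card {x \<in> A. \<not> P x}"
    using assms(1) by (subst card_Un_disjoint[symmetric]) (auto intro!: arg_cong[of _ _ card])
  ultimately show ?thesis by simp
qed

definition pos_mirror_pairs :: "int \<Rightarrow> int \<Rightarrow> int \<Rightarrow> (int \<times> int) set" where
  "pos_mirror_pairs n \<delta> W = {x \<in> mirror_pairs n \<delta> W. 0 < fst x}"

text \<open>The involution is the adjugate, read on bottom rows: it keeps trace and mirror and
  changes the sign of c.\<close>

lemma card_mirror_pairs_pos_mirror_pairs: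
  assumes "finite (mirror_pairs n \<delta> W)" "n \<in> {0, 1}"
  shows "card (mirror_pairs n \<delta> W) = 2 * card (pos_mirror_pairs n \<delta> W)"
  unfolding pos_mirror_pairs_def
proof (rule card_involution[where f = "\<lambda>(c, d). (- c, d + n * c)"])
  fix x assume "x \<in> mirror_pairs n \<delta> W"
  then obtain c d where x: "x = (c, d)" "(c, d) \<in> mirror_pairs n \<delta> W" by (cases x) auto
  have "(d + n * c)\<^sup>2 - \<delta> = (d\<^sup>2 - \<delta>) + c * (2 * n * d + n * n * c)"
    by (simp add: power2_eq_square algebra_simps)
  moreover have "c dvd (d\<^sup>2 - \<delta>) + c * (2 * n * d + n * n * c)" using x by (auto simp: mirror_pairs_def)
  ultimately have "c dvd (d + n * c)\<^sup>2 - \<delta>" by (simp only:)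
  moreover have "2 * (d + n * c) + n * - c = 2 * d + n * c" by simp
  ultimately show "(case x of (c, d) \<Rightarrow> (- c, d + n * c)) \<in> mirror_pairs n \<delta> W"
    using x by (simp add: mirror_pairs_def algebra_simps)
  show "(0 < fst (case x of (c, d) \<Rightarrow> (- c, d + n * c))) \<longleftrightarrow> \<not> 0 < fst x"
    using x by (auto simp: mirror_pairs_def)
qed (use assms in auto)

text \<open>Of two pairs exchanged by swapping the ends of the mirror, \<open>small0\<close> and
  \<open>small1\<close> contain the one with the smaller c. With e = (d^2 - \<delta>) / c the other
  value is e for n = 0 and c + 4 (d + e) for n = 1.\<close>

definition small0 :: "int \<Rightarrow> int \<Rightarrow> (int \<times> int) set" where
  "small0 \<delta> W = {x \<in> pos_mirror_pairs 0 \<delta> W. fst x < ((snd x)\<^sup>2 - \<delta>) div fst x}"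

definition small1 :: "int \<Rightarrow> int \<Rightarrow> (int \<times> int) set" where
  "small1 \<delta> W = {x \<in> pos_mirror_pairs 1 \<delta> W. 0 < snd x + ((snd x)\<^sup>2 - \<delta>) div fst x}"

text \<open>Exchanging c and e is conjugation by \<open>S\<close>, which swaps the ends 0 and
  infinity of the mirror, combined with the adjugate. A fixed pair c = e would give (d - c) (d + c)
  = \<delta>, although d + c >= 2.\<close>

lemma card_pos_mirror_pairs_small0:
  assumes \<delta>: "\<delta> \<in> {1, -1}" and fin: "finite (mirror_pairs 0 \<delta> W)"
  shows "card (pos_mirror_pairs 0 \<delta> W) = 2 * card (small0 \<delta> W)"
  unfolding small0_def
proof (rule card_involution[where f = "\<lambda>(c, d). ((d\<^sup>2 - \<delta>) div c, d)"])
  show "finite (pos_mirror_pairs 0 \<delta> W)" unfolding pos_mirror_pairs_def using fin by simp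
  fix x assume "x \<in> pos_mirror_pairs 0 \<delta> W"
  then obtain c d where x: "x = (c, d)" "(c, d) \<in> mirror_pairs 0 \<delta> W" "0 < c" by (cases x) (auto simp: pos_mirror_pairs_def)
  define e where "e = (d\<^sup>2 - \<delta>) div c"
  have ce: "d\<^sup>2 - \<delta> = c * e" using x by (simp add: e_def mirror_pairs_def)
  have d: "0 < d" "\<delta> < d\<^sup>2" using x by (auto simp: mirror_pairs_def power_mult_distrib)
  then have e0: "e > 0" using ce x(3) zero_less_mult_pos[of c e] by simp
  have de: "(d\<^sup>2 - \<delta>) div e = c" unfolding ce using e0 by simp
  show "(case x of (c, d) \<Rightarrow> ((d\<^sup>2 - \<delta>) div c, d)) \<in> pos_mirror_pairs 0 \<delta> W"
    using x e0 ce by (simp add: pos_mirror_pairs_def mirror_pairs_def flip: e_def)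
  show "(case (case x of (c, d) \<Rightarrow> ((d\<^sup>2 - \<delta>) div c, d)) of (c, d) \<Rightarrow> ((d\<^sup>2 - \<delta>) div c, d)) = x"
    using x de by (simp flip: e_def)
  have "c \<noteq> e"
  proof
    assume "c = e"
    then have *: "(d - c) * (d + c) = \<delta>" using ce by (simp add: power2_eq_square algebra_simps)
    have "d + c \<ge> 2" using d x(3) by linarith
    have "\<bar>d - c\<bar> * \<bar>d + c\<bar> = 1" using * \<delta> by (auto simp flip: abs_mult)
    then show False using \<open>d + c \<ge> 2\<close> by (auto simp: zmult_eq_1_iff)
  qed
  then show "(fst (case x of (c, d) \<Rightarrow> ((d\<^sup>2 - \<delta>) div c, d)) <
      ((snd (case x of (c, d) \<Rightarrow> ((d\<^sup>2 - \<delta>) div c, d)))\<^sup>2 - \<delta>) div fst (case x of (c, d) \<Rightarrow> ((d\<^sup>2 - \<delta>) div c, d)))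
      \<longleftrightarrow> \<not> fst x < ((snd x)\<^sup>2 - \<delta>) div fst x"
    using x de by (auto simp flip: e_def)
qed

text \<open>With \<open>d\<^sup>2 - \<delta> = c e\<close> the swap of the two endpoints of the mirror keeps \<open>e\<close>.\<close>

lemma card_pos_mirror_pairs_small1:
  assumes \<delta>: "\<delta> \<in> {1, -1}" and fin: "finite (mirror_pairs 1 \<delta> W)"
  shows "card (pos_mirror_pairs 1 \<delta> W) = 2 * card (small1 \<delta> W)"
proof -
  define f where "f = (\<lambda>(c, d). (c + 4 * d + 4 * ((d\<^sup>2 - \<delta>) div c), - d - 2 * ((d\<^sup>2 - \<delta>) div c)))"
  show ?thesis
    unfolding small1_def
  proof (rule card_involution[where f = f])
    show "finite (pos_mirror_pairs 1 \<delta> W)" unfolding pos_mirror_pairs_def using fin by simp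
    fix x assume "x \<in> pos_mirror_pairs 1 \<delta> W"
    then obtain c d where x: "x = (c, d)" "(c, d) \<in> mirror_pairs 1 \<delta> W" "0 < c" by (cases x) (auto simp: pos_mirror_pairs_def)
    define e where "e = (d\<^sup>2 - \<delta>) div c"
    have ce: "d\<^sup>2 - \<delta> = c * e" using x by (simp add: e_def mirror_pairs_def)
    define c' d' where "c' = c + 4 * d + 4 * e" "d' = - d - 2 * e"
    have fx: "f x = (c', d')" by (simp add: f_def x c'_d'_def e_def)
    have t: "2 * d' + c' = 2 * d + c" by (simp add: c'_d'_def)
    have cc: "c * c' = (2 * d + c)\<^sup>2 - 4 * \<delta>"
      using ce by (simp add: c'_d'_def power2_eq_square algebra_simps)
    also have "\<dots> > 0" using x by (simp add: mirror_pairs_def)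
    finally have c'0: "c' > 0" using x(3) zero_less_mult_pos[of c c'] by simp
    have d'e: "d'\<^sup>2 - \<delta> = c' * e"
      using ce by (simp add: c'_d'_def power2_eq_square algebra_simps)
    then have e': "(d'\<^sup>2 - \<delta>) div c' = e" using c'0 by simp
    show "f x \<in> pos_mirror_pairs 1 \<delta> W"
      using x c'0 d'e t unfolding fx by (simp add: pos_mirror_pairs_def mirror_pairs_def)
    have "f (c', d') = (c' + 4 * d' + 4 * e, - d' - 2 * e)"
      unfolding f_def prod.case e' ..
    also have "\<dots> = x" by (simp add: x(1) c'_d'_def)
    finally show "f (f x) = x" unfolding fx .
    have "d + e \<noteq> 0"
    proof
      assume "d + e = 0"
      then have "e = - d" by simp
      then have *: "d * (d + c) = \<delta>" using ce by (simp add: power2_eq_square algebra_simps)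
      have "\<bar>d\<bar> * \<bar>d + c\<bar> = 1" using * \<delta> by (auto simp flip: abs_mult)
      then have "\<bar>d\<bar> = 1" "\<bar>d + c\<bar> = 1" by (auto simp: zmult_eq_1_iff)
      moreover have "0 < 2 * d + c" using x by (simp add: mirror_pairs_def)
      ultimately show False using x(3) by linarith
    qed
    moreover have "d' + e = - (d + e)" by (simp add: c'_d'_def)
    ultimately show "(0 < snd (f x) + ((snd (f x))\<^sup>2 - \<delta>) div fst (f x)) \<longleftrightarrow>
        \<not> 0 < snd x + ((snd x)\<^sup>2 - \<delta>) div fst x"
      unfolding fx fst_conv snd_conv e' unfolding x(1) fst_conv snd_conv e_def[symmetric] by linarith
  qed
qed

definition short_pairs0 :: "int \<Rightarrow> int \<Rightarrow> (int \<times> int) set" where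
  "short_pairs0 \<delta> W = {(c, d). 0 < c \<and> c < d \<and> 2 * d \<le> W \<and> c dvd d\<^sup>2 - \<delta>}"

definition short_pairs1 :: "int \<Rightarrow> int \<Rightarrow> (int \<times> int) set" where
  "short_pairs1 \<delta> W = {(c, d). 0 < c \<and> 0 < d \<and> 2 * d + c \<le> W \<and> c dvd d\<^sup>2 - \<delta>}"

text \<open>Because c e = d^2 - \<delta>, the condition c < e is almost the same as c < d. The
  possible exception (1, 1) belongs to \<delta> = -1, where e = 2.\<close>

lemma small0_bounds:
  assumes \<delta>: "\<delta> \<in> {1, -1}"
  shows "short_pairs0 \<delta> W \<subseteq> small0 \<delta> W" "small0 \<delta> W \<subseteq> insert (1, 1) (short_pairs0 \<delta> W)"
proof -
  show "short_pairs0 \<delta> W \<subseteq> small0 \<delta> W"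
  proof
    fix x assume "x \<in> short_pairs0 \<delta> W"
    then obtain c d where x: "x = (c, d)" "0 < c" "c < d" "2 * d \<le> W" "c dvd d\<^sup>2 - \<delta>" by (auto simp: short_pairs0_def)
    define e where "e = (d\<^sup>2 - \<delta>) div c"
    have ce: "d\<^sup>2 - \<delta> = c * e" using x by (simp add: e_def)
    have dd: "2 * 2 \<le> d * d" using x by (intro mult_mono) auto
    have "c < e"
    proof (rule ccontr)
      assume "\<not> c < e"
      then have "c * e \<le> c * c" using x by (intro mult_left_mono) auto
      also have "\<dots> \<le> (d - 1) * (d - 1)" using x by (intro mult_mono) auto
      also have "\<dots> = d\<^sup>2 - 2 * d + 1" by (simp add: power2_eq_square algebra_simps)
      finally show False using ce x \<delta> by auto
    qed
    moreover have "4 * \<delta> < (2 * d)\<^sup>2" using dd x \<delta> by (auto simp: power2_eq_square)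
    ultimately show "x \<in> small0 \<delta> W" using x by (simp add: small0_def pos_mirror_pairs_def mirror_pairs_def e_def)
  qed
  show "small0 \<delta> W \<subseteq> insert (1, 1) (short_pairs0 \<delta> W)"
  proof
    fix x assume "x \<in> small0 \<delta> W"
    then obtain c d where x: "x = (c, d)" "0 < c" "0 < d" "2 * d \<le> W" "c dvd d\<^sup>2 - \<delta>" "c < (d\<^sup>2 - \<delta>) div c"
      by (cases x) (auto simp: small0_def pos_mirror_pairs_def mirror_pairs_def)
    define e where "e = (d\<^sup>2 - \<delta>) div c"
    have ce: "d\<^sup>2 - \<delta> = c * e" using x by (simp add: e_def)
    have "c * (c + 1) \<le> c * e" using x by (intro mult_left_mono) (auto simp: e_def)
    then have le: "c * c + c \<le> d * d - \<delta>" using ce by (simp add: power2_eq_square algebra_simps)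
    show "x \<in> insert (1, 1) (short_pairs0 \<delta> W)"
    proof (cases "c < d")
      case True
      then show ?thesis using x by (simp add: short_pairs0_def)
    next
      case False
      then have "d * d \<le> c * c" using x by (intro mult_mono) auto
      with le \<delta> x have "c = 1" by auto
      with False x show ?thesis by simp
    qed
  qed
qed

text \<open>Because c (d + e) = d (d + c) - \<delta>, the condition d + e > 0 is almost the same as
  d > 0. The possible exception (1, 0) belongs to \<delta> = -1.\<close>

lemma small1_bounds:
  assumes \<delta>: "\<delta> \<in> {1, -1}"
  shows "short_pairs1 \<delta> W \<subseteq> small1 \<delta> W" "small1 \<delta> W \<subseteq> insert (1, 0) (short_pairs1 \<delta> W)"
proof -
  show "short_pairs1 \<delta> W \<subseteq> small1 \<delta> W"
  proof
    fix x assume "x \<in> short_pairs1 \<delta> W"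
    then obtain c d where x: "x = (c, d)" "0 < c" "0 < d" "2 * d + c \<le> W" "c dvd d\<^sup>2 - \<delta>" by (auto simp: short_pairs1_def)
    have "1 * 1 \<le> d * d" using x by (intro mult_mono) auto
    then have "0 \<le> d\<^sup>2 - \<delta>" using \<delta> by (auto simp: power2_eq_square)
    then have "0 \<le> (d\<^sup>2 - \<delta>) div c" using x by (simp add: pos_imp_zdiv_nonneg_iff)
    moreover have "3\<^sup>2 \<le> (2 * d + c)\<^sup>2" using x by (intro power_mono) auto
    ultimately show "x \<in> small1 \<delta> W" using x \<delta> by (auto simp: small1_def pos_mirror_pairs_def mirror_pairs_def)
  qed
  show "small1 \<delta> W \<subseteq> insert (1, 0) (short_pairs1 \<delta> W)"
  proof
    fix x assume "x \<in> small1 \<delta> W"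
    then obtain c d where x: "x = (c, d)" "0 < c" "0 < 2 * d + c" "2 * d + c \<le> W" "c dvd d\<^sup>2 - \<delta>" "0 < d + (d\<^sup>2 - \<delta>) div c"
      by (cases x) (auto simp: small1_def pos_mirror_pairs_def mirror_pairs_def)
    define e where "e = (d\<^sup>2 - \<delta>) div c"
    have ce: "d\<^sup>2 - \<delta> = c * e" using x by (simp add: e_def)
    have "0 < c * (d + e)" using x by (simp add: e_def)
    then have pos: "\<delta> < d * (d + c)" using ce by (simp add: power2_eq_square algebra_simps)
    consider "d > 0" | "d = 0" | "d < 0" by linarith
    then show "x \<in> insert (1, 0) (short_pairs1 \<delta> W)"
    proof cases
      case 1
      then show ?thesis using x by (simp add: short_pairs1_def)
    next
      case 2
      then have "\<delta> = -1" using pos \<delta> by auto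
      then have "c dvd 1" using x 2 by simp
      then show ?thesis using x 2 by simp
    next
      case 3
      then have "1 * 2 \<le> (- d) * (d + c)" using x by (intro mult_mono) auto
      then show ?thesis using pos \<delta> by auto
    qed
  qed
qed

text \<open>The factor 4 comes from the sign of c and from the swap of the ends; 8 = 4 (1 + 1)
  allows one exceptional pair for each n.\<close>

lemma card_mirror_forms_bounds:
  assumes \<delta>: "\<delta> \<in> {1, -1}"
  shows "4 * (card (short_pairs0 \<delta> W) + card (short_pairs1 \<delta> W)) \<le> card (mirror_forms \<delta> W)"
    "card (mirror_forms \<delta> W) \<le> 4 * (card (short_pairs0 \<delta> W) + card (short_pairs1 \<delta> W)) + 8"
proof -
  note mirror_pairs = card_mirror_forms_mirror_pairs[OF \<delta>, of W]
  have f: "finite (small0 \<delta> W)" "finite (small1 \<delta> W)"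
    using mirror_pairs(2,3) by (auto simp: small0_def small1_def pos_mirror_pairs_def)
  have fA: "finite (short_pairs0 \<delta> W)" "finite (short_pairs1 \<delta> W)"
    using finite_subset[OF small0_bounds(1)[OF \<delta>] f(1)] finite_subset[OF small1_bounds(1)[OF \<delta>] f(2)] by blast+
  have eq: "card (mirror_forms \<delta> W) = 4 * (card (small0 \<delta> W) + card (small1 \<delta> W))"
    using mirror_pairs card_mirror_pairs_pos_mirror_pairs[OF mirror_pairs(2)] card_mirror_pairs_pos_mirror_pairs[OF mirror_pairs(3)] card_pos_mirror_pairs_small0[OF \<delta> mirror_pairs(2)] card_pos_mirror_pairs_small1[OF \<delta> mirror_pairs(3)] by simp
  have "card (short_pairs0 \<delta> W) \<le> card (small0 \<delta> W)" "card (short_pairs1 \<delta> W) \<le> card (small1 \<delta> W)"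
    using card_mono[OF f(1) small0_bounds(1)[OF \<delta>]] card_mono[OF f(2) small1_bounds(1)[OF \<delta>]] by blast+
  then show "4 * (card (short_pairs0 \<delta> W) + card (short_pairs1 \<delta> W)) \<le> card (mirror_forms \<delta> W)" using eq by simp
  have "card (small0 \<delta> W) \<le> card (insert (1, 1) (short_pairs0 \<delta> W))" "card (small1 \<delta> W) \<le> card (insert (1, 0) (short_pairs1 \<delta> W))"
    using card_mono[OF _ small0_bounds(2)[OF \<delta>]] card_mono[OF _ small1_bounds(2)[OF \<delta>]] fA by simp_all
  then have "card (small0 \<delta> W) \<le> Suc (card (short_pairs0 \<delta> W))" "card (small1 \<delta> W) \<le> Suc (card (short_pairs1 \<delta> W))"
    using fA by (simp_all add: card_insert_if split: if_splits)
  then show "card (mirror_forms \<delta> W) \<le> 4 * (card (short_pairs0 \<delta> W) + card (short_pairs1 \<delta> W)) + 8" using eq by simp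
qed

section \<open>Counting solutions of quadratic congruences\<close>

definition count_roots :: "int \<Rightarrow> int \<Rightarrow> int \<Rightarrow> nat" where
  "count_roots \<delta> c m = card {d \<in> {1..m}. c dvd d\<^sup>2 - \<delta>}"

definition rho :: "int \<Rightarrow> int \<Rightarrow> nat" where
  "rho \<delta> c = count_roots \<delta> c c"

lemma finite_solutions: "finite {d::int. a \<le> d \<and> d \<le> b \<and> P d}"
  by (rule finite_subset[of _ "{a..b}"]) auto

lemma count_roots_mono: "m \<le> m' \<Longrightarrow> count_roots \<delta> c m \<le> count_roots \<delta> c m'"
  unfolding count_roots_def by (rule card_mono[OF finite_subset[of _ "{1..m'}"]]) auto

lemma count_roots_multiple:
  assumes "0 < c" "0 \<le> q"
  shows "count_roots \<delta> c (c * q) = nat q * rho \<delta> c"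
proof -
  let ?f = "\<lambda>(k, r). k * c + r" and ?g = "\<lambda>d. ((d - 1) div c, (d - 1) mod c + 1)"
  have per: "c dvd (k * c + r)\<^sup>2 - \<delta> \<longleftrightarrow> c dvd r\<^sup>2 - \<delta>" for k r
  proof -
    have "(k * c + r)\<^sup>2 - \<delta> = c * (k * k * c + 2 * k * r) + (r\<^sup>2 - \<delta>)"
      by (simp add: power2_eq_square algebra_simps)
    then show ?thesis by (simp only: dvd_add_right_iff[OF dvd_triv_left])
  qed
  have "bij_betw ?f ({0..<q} \<times> {r \<in> {1..c}. c dvd r\<^sup>2 - \<delta>}) {d \<in> {1..c * q}. c dvd d\<^sup>2 - \<delta>}"
  proof (rule bij_betw_byWitness[where f' = ?g])
    show "\<forall>a\<in>{0..<q} \<times> {r \<in> {1..c}. c dvd r\<^sup>2 - \<delta>}. ?g (?f a) = a"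
    proof
      fix a assume "a \<in> {0..<q} \<times> {r \<in> {1..c}. c dvd r\<^sup>2 - \<delta>}"
      then obtain k r where r: "r \<in> {1..c}" and a: "a = (k, r)" by auto
      then have "(k * c + r - 1) div c = k + (r - 1) div c" "(k * c + r - 1) mod c = (r - 1) mod c"
        using assms(1) by (simp_all add: add_diff_eq[symmetric])
      then show "?g (?f a) = a" using r assms(1) by (simp add: a)
    qed
    show "\<forall>a'\<in>{d \<in> {1..c * q}. c dvd d\<^sup>2 - \<delta>}. ?f (?g a') = a'"
    proof
      fix d
      have "(d - 1) div c * c + ((d - 1) mod c + 1) = d"
        using div_mult_mod_eq[of "d - 1" c] by linarith
      then show "?f (?g d) = d" by simp
    qed
    show "?f ` ({0..<q} \<times> {r \<in> {1..c}. c dvd r\<^sup>2 - \<delta>}) \<subseteq> {d \<in> {1..c * q}. c dvd d\<^sup>2 - \<delta>}"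
    proof
      fix y assume "y \<in> ?f ` ({0..<q} \<times> {r \<in> {1..c}. c dvd r\<^sup>2 - \<delta>})"
      then obtain k r where *: "k \<in> {0..<q}" "r \<in> {1..c}" "c dvd r\<^sup>2 - \<delta>" "y = k * c + r" by auto
      have "0 \<le> k * c" using * assms by simp
      moreover have "k * c \<le> (q - 1) * c" using * assms by (intro mult_right_mono) auto
      moreover have "(q - 1) * c + c = c * q" by (simp add: algebra_simps)
      ultimately have "1 \<le> k * c + r" "k * c + r \<le> c * q" using *(2) unfolding atLeastAtMost_iff by linarith+
      then have "k * c + r \<in> {1..c * q}" by simp
      then show "y \<in> {d \<in> {1..c * q}. c dvd d\<^sup>2 - \<delta>}" using per * by simp
    qed
    show "?g ` {d \<in> {1..c * q}. c dvd d\<^sup>2 - \<delta>} \<subseteq> {0..<q} \<times> {r \<in> {1..c}. c dvd r\<^sup>2 - \<delta>}"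
    proof
      fix y assume "y \<in> ?g ` {d \<in> {1..c * q}. c dvd d\<^sup>2 - \<delta>}"
      then obtain d where d: "1 \<le> d" "d \<le> c * q" "c dvd d\<^sup>2 - \<delta>" "y = ?g d" by auto
      have eq: "(d - 1) div c * c + ((d - 1) mod c + 1) = d"
        using div_mult_mod_eq[of "d - 1" c] by linarith
      have "c dvd ((d - 1) mod c + 1)\<^sup>2 - \<delta>" using per[of "(d - 1) div c" "(d - 1) mod c + 1"] d(3) unfolding eq by simp
      moreover have "0 \<le> (d - 1) div c" using d assms by (simp add: pos_imp_zdiv_nonneg_iff)
      moreover have "(d - 1) div c < q"
      proof (rule ccontr)
        assume "\<not> ?thesis"
        then have "q * c \<le> (d - 1) div c * c" using assms(1) by (intro mult_right_mono) auto
        moreover have "0 \<le> (d - 1) mod c" using assms(1) by simp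
        ultimately show False using eq d(2) unfolding mult.commute[of c q] by linarith
      qed
      moreover have "0 \<le> (d - 1) mod c" "(d - 1) mod c < c" using assms(1) by simp_all
      ultimately show "y \<in> {0..<q} \<times> {r \<in> {1..c}. c dvd r\<^sup>2 - \<delta>}" using d(4) by auto
    qed
  qed
  then have "card ({0..<q} \<times> {r \<in> {1..c}. c dvd r\<^sup>2 - \<delta>}) = count_roots \<delta> c (c * q)"
    unfolding count_roots_def by (rule bij_betw_same_card)
  then show ?thesis by (simp add: card_cartesian_product rho_def count_roots_def)
qed

text \<open>m lies between consecutive multiples of c, where the count is exact, and these counts
  differ by one period, which contains \<open>rho \<delta> c\<close> solutions.\<close>

lemma count_roots_approx:
  assumes "0 < c" "0 \<le> m"
  shows "\<bar>real (count_roots \<delta> c m) - rho \<delta> c * (m / c)\<bar> \<le> rho \<delta> c"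
proof -
  define q where "q = m div c"
  have q0: "0 \<le> q" using assms by (simp add: q_def pos_imp_zdiv_nonneg_iff)
  have le: "c * q \<le> m" "m < c * (q + 1)"
    using assms(1) pos_mod_bound[of c m] pos_mod_sign[of c m] mult_div_mod_eq[of c m, folded q_def]
    unfolding distrib_left by linarith+
  have "count_roots \<delta> c (c * q) \<le> count_roots \<delta> c m" "count_roots \<delta> c m \<le> count_roots \<delta> c (c * (q + 1))"
    using le by (auto intro: count_roots_mono)
  then have "nat q * rho \<delta> c \<le> count_roots \<delta> c m" "count_roots \<delta> c m \<le> nat (q + 1) * rho \<delta> c"
    using count_roots_multiple[OF assms(1)] q0 by auto
  then have 1: "real (nat q * rho \<delta> c) \<le> real (count_roots \<delta> c m)" "real (count_roots \<delta> c m) \<le> real (nat (q + 1) * rho \<delta> c)"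
    by (auto simp only: of_nat_le_iff)
  have "real_of_int (c * q) \<le> real_of_int m" "real_of_int m \<le> real_of_int (c * (q + 1))"
    using le by (auto simp only: of_int_le_iff)
  then have "real_of_int q \<le> m / c" "m / c \<le> real_of_int q + 1"
    using assms(1) by (simp_all add: field_simps)
  then have "rho \<delta> c * real_of_int q \<le> rho \<delta> c * (m / c)" "rho \<delta> c * (m / c) \<le> rho \<delta> c * (real_of_int q + 1)"
    by (simp_all only: mult_left_mono of_nat_0_le_iff)
  with 1 q0 show ?thesis by (simp add: abs_le_iff algebra_simps)
qed

definition rho_sum :: "int \<Rightarrow> int \<Rightarrow> real" where
  "rho_sum \<delta> W = (\<Sum>c\<in>{1..W}. real (rho \<delta> c))"

definition rho_quotient_sum :: "int \<Rightarrow> int \<Rightarrow> real" where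
  "rho_quotient_sum \<delta> W = (\<Sum>c\<in>{1..W}. real (rho \<delta> c) / c)"

lemma rho_sum_mono: "W \<le> V \<Longrightarrow> rho_sum \<delta> W \<le> rho_sum \<delta> V"
  unfolding rho_sum_def by (intro sum_mono2) auto

lemma abs_diff_chain: "\<bar>a - b\<bar> \<le> r \<Longrightarrow> \<bar>b - e\<bar> \<le> s \<Longrightarrow> \<bar>a - e\<bar> \<le> r + (s :: real)"
  by linarith

lemma card_short_pairs0_approx:
  assumes "0 \<le> W"
  shows "\<bar>real (card (short_pairs0 \<delta> W)) - W / 2 * rho_quotient_sum \<delta> (W div 2)\<bar> \<le> 4 * rho_sum \<delta> (W div 2)"
proof -
  define m where "m = W div 2"
  have m: "0 \<le> m" "\<bar>real_of_int m - W / 2\<bar> \<le> 1" using assms unfolding m_def by linarith+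
  have "short_pairs0 \<delta> W = (SIGMA c:{1..m}. {d \<in> {c + 1..m}. c dvd d\<^sup>2 - \<delta>})"
    by (auto simp: short_pairs0_def m_def)
  then have "card (short_pairs0 \<delta> W) = (\<Sum>c\<in>{1..m}. card {d \<in> {c + 1..m}. c dvd d\<^sup>2 - \<delta>})"
    by (simp only:) (intro card_SigmaI ballI finite_subset[OF Collect_restrict] finite_atLeastAtMost_int)
  \<comment> \<open>The condition c < d removes exactly one full period, at the cost of
    \<open>rho \<delta> c\<close>.\<close>
  moreover have "card {d \<in> {c + 1..m}. c dvd d\<^sup>2 - \<delta>} + rho \<delta> c = count_roots \<delta> c m" if "c \<in> {1..m}" for c
    unfolding rho_def count_roots_def using that
    by (subst card_Un_disjoint[symmetric]) (auto simp: finite_solutions intro!: arg_cong[of _ _ card])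
  then have "real (card {d \<in> {c + 1..m}. c dvd d\<^sup>2 - \<delta>}) = real (count_roots \<delta> c m) - rho \<delta> c" if "c \<in> {1..m}" for c
    using that by (simp add: eq_diff_eq flip: of_nat_add)
  ultimately have "real (card (short_pairs0 \<delta> W)) = (\<Sum>c\<in>{1..m}. real (count_roots \<delta> c m) - rho \<delta> c)" by simp
  then have "real (card (short_pairs0 \<delta> W)) - W / 2 * rho_quotient_sum \<delta> m = (\<Sum>c\<in>{1..m}. real (count_roots \<delta> c m) - rho \<delta> c - W / 2 * (rho \<delta> c / c))"
    by (simp add: rho_quotient_sum_def sum_distrib_left sum_subtractf)
  also have "\<bar>\<dots>\<bar> \<le> (\<Sum>c\<in>{1..m}. 4 * real (rho \<delta> c))"
  proof (rule order_trans[OF sum_abs sum_mono])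
    fix c assume c: "c \<in> {1..m}"
    have 1: "\<bar>real (count_roots \<delta> c m) - rho \<delta> c * (m / c)\<bar> \<le> rho \<delta> c" using count_roots_approx[of c m \<delta>] c by simp
    have "rho \<delta> c * (m / c) - W / 2 * (rho \<delta> c / c) = (m - W / 2) * (rho \<delta> c / c)"
      by (simp add: algebra_simps diff_divide_distrib)
    also have "\<bar>\<dots>\<bar> \<le> 1 * (rho \<delta> c / 1)"
      unfolding abs_mult using m(2) c
      by (intro mult_mono) (auto simp: pos_divide_le_eq mult_le_cancel_left1)
    finally have "\<bar>rho \<delta> c * (m / c) - W / 2 * (rho \<delta> c / c)\<bar> \<le> rho \<delta> c" by simp
    from abs_diff_chain[OF 1 this]
    show "\<bar>real (count_roots \<delta> c m) - rho \<delta> c - W / 2 * (rho \<delta> c / c)\<bar> \<le> 4 * real (rho \<delta> c)" by linarith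
  qed
  finally show ?thesis by (simp add: rho_sum_def sum_distrib_left m_def)
qed

lemma card_short_pairs1_approx:
  assumes "0 \<le> W"
  shows "\<bar>real (card (short_pairs1 \<delta> W)) - W / 2 * rho_quotient_sum \<delta> W\<bar> \<le> 2 * rho_sum \<delta> W"
proof -
  have "short_pairs1 \<delta> W = (SIGMA c:{1..W}. {d \<in> {1..(W - c) div 2}. c dvd d\<^sup>2 - \<delta>})"
    by (auto simp: short_pairs1_def)
  then have "card (short_pairs1 \<delta> W) = (\<Sum>c\<in>{1..W}. count_roots \<delta> c ((W - c) div 2))"
    by (simp only: count_roots_def) (intro card_SigmaI ballI finite_subset[OF Collect_restrict] finite_atLeastAtMost_int)
  then have "real (card (short_pairs1 \<delta> W)) - W / 2 * rho_quotient_sum \<delta> W = (\<Sum>c\<in>{1..W}. real (count_roots \<delta> c ((W - c) div 2)) - W / 2 * (rho \<delta> c / c))"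
    by (simp add: rho_quotient_sum_def sum_distrib_left sum_subtractf)
  also have "\<bar>\<dots>\<bar> \<le> (\<Sum>c\<in>{1..W}. 2 * real (rho \<delta> c))"
  proof (rule order_trans[OF sum_abs sum_mono])
    fix c assume c: "c \<in> {1..W}"
    define m where "m = (W - c) div 2"
    \<comment> \<open>Rounding costs at most 1 / 2 and the shift by c costs c / 2, together at most
      c.\<close>
    have m: "0 \<le> m" "\<bar>real_of_int m - W / 2\<bar> \<le> c" using c unfolding m_def by auto
    have 1: "\<bar>real (count_roots \<delta> c m) - rho \<delta> c * (m / c)\<bar> \<le> rho \<delta> c" using count_roots_approx[of c m \<delta>] c m by simp
    have "rho \<delta> c * (m / c) - W / 2 * (rho \<delta> c / c) = (m - W / 2) * (rho \<delta> c / c)"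
      by (simp add: algebra_simps diff_divide_distrib)
    also have "\<bar>\<dots>\<bar> \<le> c * (rho \<delta> c / c)"
      unfolding abs_mult using m(2) c by (intro mult_mono) auto
    finally have "\<bar>rho \<delta> c * (m / c) - W / 2 * (rho \<delta> c / c)\<bar> \<le> rho \<delta> c" using c by simp
    from abs_diff_chain[OF 1 this]
    show "\<bar>real (count_roots \<delta> c ((W - c) div 2)) - W / 2 * (rho \<delta> c / c)\<bar> \<le> 2 * real (rho \<delta> c)"
      unfolding m_def by simp
  qed
  finally show ?thesis by (simp add: rho_sum_def sum_distrib_left)
qed

text \<open>24 = 4 (4 + 2): the factor of \<open>card_mirror_forms_bounds\<close> times the error
  constants for n = 0 and n = 1.\<close>

lemma card_mirror_forms_approx:
  assumes \<delta>: "\<delta> \<in> {1, -1}" and "0 \<le> W"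
  shows "\<bar>real (card (mirror_forms \<delta> W)) - 2 * W * (rho_quotient_sum \<delta> (W div 2) + rho_quotient_sum \<delta> W)\<bar> \<le> 24 * rho_sum \<delta> W + 8"
proof -
  have "rho_sum \<delta> (W div 2) \<le> rho_sum \<delta> W" using assms by (intro rho_sum_mono) auto
  moreover have "2 * W * (rho_quotient_sum \<delta> (W div 2) + rho_quotient_sum \<delta> W) = 4 * (W / 2 * rho_quotient_sum \<delta> (W div 2)) + 4 * (W / 2 * rho_quotient_sum \<delta> W)"
    by (simp add: algebra_simps)
  moreover have "real (4 * (card (short_pairs0 \<delta> W) + card (short_pairs1 \<delta> W))) \<le> real (card (mirror_forms \<delta> W))"
    "real (card (mirror_forms \<delta> W)) \<le> real (4 * (card (short_pairs0 \<delta> W) + card (short_pairs1 \<delta> W)) + 8)"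
    using card_mirror_forms_bounds[OF \<delta>, of W] by (simp_all only: of_nat_le_iff)
  ultimately show ?thesis
    using card_short_pairs0_approx[OF assms(2), of \<delta>] card_short_pairs1_approx[OF assms(2), of \<delta>] by (simp add: abs_le_iff)
qed

section \<open>Quadratic congruences and primitive representations\<close>

text \<open>The homogenized fixed-point polynomial of M, as a binary quadratic form.\<close>

definition quad :: "mat2 \<Rightarrow> int \<Rightarrow> int \<Rightarrow> int" where
  "quad M p q = m21 M * p * p + (m22 M - m11 M) * p * q - m12 M * q * q"

lemma m21_conj_by_adj: "m21 (conj_by (adj g) M) = quad M (m11 g) (m21 g)"
  by (simp add: conj_by_def sel_times quad_def algebra_simps)

lemma trace_zero_eqI:
  assumes "tr R = 0" "tr R' = 0" "dt R = dt R'" "m21 R = m21 R'" "m21 R \<noteq> 0" "m22 R = m22 R'"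
  shows "R = R'"
proof -
  have a: "m11 R = m11 R'" using assms by (simp add: tr_def)
  then have "m12 R * m21 R = m12 R' * m21 R" using assms by (simp add: dt_def)
  then have "m12 R = m12 R'" using assms by simp
  then show ?thesis using a assms by (simp add: mat2_eq_iff)
qed

lemma conj_by_T: "m21 (conj_by (T k) R) = m21 R" "m22 (conj_by (T k) R) = m22 R - k * m21 R"
  by (simp_all add: conj_by_def sel_times algebra_simps)

lemma adj_T: "adj (T k) = T (- k)"
  by (simp add: mat2_eq_iff)

lemma first_column_T: "m11 (g * T k) = m11 g" "m21 (g * T k) = m21 g"
  by (simp_all add: sel_times)

lemma same_first_column:
  assumes "dt g = 1" "dt g' = 1" "m11 g = m11 g'" "m21 g = m21 g'"
  obtains k where "g' = g * T k"
proof -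
  let ?h = "adj g * g'"
  have h: "m11 ?h = 1" "m21 ?h = 0"
    using assms(1) unfolding sel_times assms(3,4)[symmetric] by (simp_all add: dt_def algebra_simps)
  moreover have "dt ?h = 1" using assms by simp
  ultimately have "m22 ?h = 1" unfolding dt_def[of ?h] by simp
  with h have "?h = T (m12 ?h)" by (simp only: mat2_eq_iff JST_simps simp_thms)
  then have "g * ?h = g * T (m12 ?h)" by (rule arg_cong)
  then have "g' = g * T (m12 ?h)" using assms(1) by (simp only: mult_adj_1)
  then show ?thesis by (rule that)
qed

lemma coprime_first_column: "dt g = 1 \<Longrightarrow> coprime (m11 g) (m21 g)"
  unfolding dt_def by (metis coprime_iff_gcd_eq_1 gcd_dvd1 gcd_dvd2 dvd_diff dvd_mult dvd_mult2 is_unit_gcd_iff)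

lemma exists_first_column:
  assumes "coprime p q"
  shows "\<exists>g. dt g = 1 \<and> m11 g = p \<and> m21 g = q"
proof -
  obtain s r where "s * p + r * q = 1" using assms bezout_int[of p q] by auto
  then show ?thesis
    by (intro exI[of _ "Mat2 p (- r) q s"]) (simp add: dt_def algebra_simps)
qed

text \<open>A solution d of d^2 = \<delta> modulo c is a matrix R of trace 0 and determinant
  -\<delta> with bottom row (c, d), up to conjugation by translations. If R = g^{-1} K g,
  translations multiply g on the right and keep its first column (p, q), and c is the value of the
  form of K at (p, q). The set N has to select exactly one n and one column for each R, which is
  what \<open>ex\<close> and \<open>un\<close> provide.\<close>

lemma sum_rho:
  fixes K :: "int \<Rightarrow> mat2" and f :: "int \<Rightarrow> real" and W :: int
  assumes K: "\<And>n. dt (K n) = - \<delta>" "\<And>n. tr (K n) = 0"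
    and ex: "\<And>R. dt R = - \<delta> \<Longrightarrow> tr R = 0 \<Longrightarrow> 0 < m21 R \<Longrightarrow>
      \<exists>n g. dt g = 1 \<and> conj_by g R = K n \<and> (n, m11 g, m21 g) \<in> N"
    and un: "\<And>g g' n n'. dt g = 1 \<Longrightarrow> dt g' = 1 \<Longrightarrow> (n, m11 g, m21 g) \<in> N \<Longrightarrow> (n', m11 g', m21 g') \<in> N \<Longrightarrow>
      conj_by (adj g) (K n) = conj_by (adj g') (K n') \<Longrightarrow> n = n' \<and> m11 g = m11 g' \<and> m21 g = m21 g'"
    and pos: "\<And>n p q. (n, p, q) \<in> N \<Longrightarrow> coprime p q \<and> 0 < quad (K n) p q"
  defines "Y \<equiv> {(n, p, q). (n, p, q) \<in> N \<and> quad (K n) p q \<le> W}"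
  shows "finite Y \<and> (\<Sum>c\<in>{1..W}. real (rho \<delta> c) * f c) = (\<Sum>(n, p, q)\<in>Y. f (quad (K n) p q))"
proof -
  define G where "G p q = (SOME g. dt g = 1 \<and> m11 g = p \<and> m21 g = q)" for p q
  have G: "dt (G p q) = 1" "m11 (G p q) = p" "m21 (G p q) = q" if "coprime p q" for p q
    using someI_ex[OF exists_first_column[OF that]] unfolding G_def by auto
  define R where "R = (\<lambda>(n, p, q). conj_by (adj (G p q)) (K n))"
  have R: "dt (R (n, p, q)) = - \<delta>" "tr (R (n, p, q)) = 0" "m21 (R (n, p, q)) = quad (K n) p q"
    if "(n, p, q) \<in> N" for n p q
    using G[of p q] pos[OF that] K by (simp_all add: R_def dt_conj_by tr_conj_by m21_conj_by_adj)
  \<comment> \<open>The shifts by 1 move residues modulo c into the range 1..c used by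
    \<open>rho\<close>.\<close>
  define h where "h y = (m21 (R y), (m22 (R y) - 1) mod m21 (R y) + 1)" for y
  define X where "X = (SIGMA c:{1..W}. {d \<in> {1..c}. c dvd d\<^sup>2 - \<delta>})"
  have finX: "finite X"
    unfolding X_def by (intro finite_SigmaI finite_subset[OF Collect_restrict] finite_atLeastAtMost_int)
  have "bij_betw h Y X"
    unfolding bij_betw_def
  proof
    show "inj_on h Y"
    proof (rule inj_onI)
      fix y y' assume y: "y \<in> Y" "y' \<in> Y" "h y = h y'"
      obtain n p q where npq: "y = (n, p, q)" "(n, p, q) \<in> N" using y(1) by (auto simp: Y_def)
      obtain n' p' q' where npq': "y' = (n', p', q')" "(n', p', q') \<in> N" using y(2) by (auto simp: Y_def)
      define c where "c = m21 (R y)"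
      have c: "m21 (R y) = c" "m21 (R y') = c" using y(3) by (auto simp: h_def c_def)
      have c0: "c \<noteq> 0" using pos[OF npq(2)] R(3)[OF npq(2)] npq(1) c by simp
      have "(m22 (R y) - 1) mod c = (m22 (R y') - 1) mod c" using y(3) c by (simp add: h_def)
      then have "c dvd (m22 (R y) - 1) - (m22 (R y') - 1)" by (simp only: mod_eq_dvd_iff)
      then obtain k where k: "m22 (R y) - m22 (R y') = c * k" by (auto elim: dvdE)
      \<comment> \<open>Equal c and congruent d mean that the matrices differ by conjugation with a
        translation.\<close>
      have "R y' = conj_by (T k) (R y)"
        by (rule trace_zero_eqI) (use R[OF npq(2)] R[OF npq'(2)] npq(1) npq'(1) c c0 k in
            \<open>simp_all add: conj_by_T dt_conj_by tr_conj_by algebra_simps\<close>)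
      also have "\<dots> = conj_by (adj (G p q * T (- k))) (K n)"
        by (simp add: npq(1) R_def conj_by_conj_by adj_mult adj_T)
      finally have "conj_by (adj (G p q * T (- k))) (K n) = conj_by (adj (G p' q')) (K n')"
        by (simp add: npq'(1) R_def)
      moreover have "dt (G p q * T (- k)) = 1" "m11 (G p q * T (- k)) = p" "m21 (G p q * T (- k)) = q"
        using G[of p q] pos[OF npq(2)] by (simp_all add: first_column_T)
      ultimately have "n = n' \<and> p = p' \<and> q = q'"
        using un[of "G p q * T (- k)" "G p' q'" n n'] G[of p' q'] pos[OF npq'(2)] npq(2) npq'(2) by simp
      then show "y = y'" using npq(1) npq'(1) by simp
    qed
    show "h ` Y = X"
    proof
      show "h ` Y \<subseteq> X"
      proof
        fix x assume "x \<in> h ` Y"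
        then obtain n p q where y: "(n, p, q) \<in> N" "quad (K n) p q \<le> W" "x = h (n, p, q)"
          by (auto simp: Y_def)
        define c d where "c = m21 (R (n, p, q))" "d = m22 (R (n, p, q))"
        have c: "c > 0" "c \<le> W" using R(3)[OF y(1)] pos[OF y(1)] y(2) by (simp_all add: c_d_def)
        have "m11 (R (n, p, q)) = - d" using R(2)[OF y(1)] by (simp add: tr_def c_d_def)
        then have "d\<^sup>2 - \<delta> = c * (- m12 (R (n, p, q)))"
          using R(1)[OF y(1)] by (simp add: dt_def c_d_def power2_eq_square algebra_simps)
        then have dv: "c dvd d\<^sup>2 - \<delta>" by simp
        define k where "k = (d - 1) div c"
        have r: "(d - 1) mod c + 1 = d - k * c"
          using div_mult_mod_eq[of "d - 1" c] unfolding k_def by linarith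
        have "(d - k * c)\<^sup>2 - \<delta> = (d\<^sup>2 - \<delta>) + c * (k * k * c - 2 * k * d)"
          by (simp add: power2_eq_square algebra_simps)
        moreover have "c dvd (d\<^sup>2 - \<delta>) + c * (k * k * c - 2 * k * d)" using dv by simp
        ultimately have "c dvd ((d - 1) mod c + 1)\<^sup>2 - \<delta>" unfolding r by (simp only:)
        moreover have "0 \<le> (d - 1) mod c" "(d - 1) mod c + 1 \<le> c"
          using pos_mod_bound[OF c(1), of "d - 1"] pos_mod_sign[OF c(1), of "d - 1"] by linarith+
        ultimately show "x \<in> X" using c by (simp add: y(3) h_def X_def flip: c_d_def)
      qed
      show "X \<subseteq> h ` Y"
      proof
        fix x assume "x \<in> X"
        then obtain c d where x: "x = (c, d)" "1 \<le> c" "c \<le> W" "1 \<le> d" "d \<le> c" "c dvd d\<^sup>2 - \<delta>"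
          by (auto simp: X_def)
        define Q where "Q = Mat2 (- d) (- ((d\<^sup>2 - \<delta>) div c)) c d"
        have "(d\<^sup>2 - \<delta>) div c * c = d\<^sup>2 - \<delta>" using x(6) by simp
        then have "dt Q = - \<delta>" by (simp add: Q_def dt_def power2_eq_square)
        moreover have "tr Q = 0" "0 < m21 Q" using x by (simp_all add: Q_def tr_def)
        ultimately obtain n g where g: "dt g = 1" "conj_by g Q = K n" "(n, m11 g, m21 g) \<in> N"
          using ex by blast
        define p q where "p = m11 g" "q = m21 g"
        have pq: "(n, p, q) \<in> N" using g(3) by (simp add: p_q_def)
        obtain k where k: "G p q = g * T k"
          using same_first_column[of g "G p q"] g(1) G[of p q] pos[OF pq] by (metis p_q_def(1,2))
        have "R (n, p, q) = conj_by (T (- k)) (conj_by (adj g) (K n))"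
          by (simp add: R_def k adj_mult adj_T conj_by_conj_by)
        also have "conj_by (adj g) (K n) = Q" using g(1,2) conj_by_inverse(1) by metis
        finally have "m21 (R (n, p, q)) = c" "m22 (R (n, p, q)) = d + k * c"
          by (simp_all add: conj_by_T Q_def)
        moreover have "(d + k * c - 1) mod c + 1 = d"
        proof -
          have "(d - 1 + k * c) mod c = (d - 1) mod c" by simp
          then show ?thesis using x by (simp add: algebra_simps)
        qed
        ultimately have "h (n, p, q) = x" by (simp add: h_def x)
        moreover have "quad (K n) p q = c" using R(3)[OF pq] \<open>m21 (R (n, p, q)) = c\<close> by simp
        then have "(n, p, q) \<in> Y" using pq x by (simp add: Y_def)
        ultimately show "x \<in> h ` Y" by (metis imageI)
      qed
    qed
  qed
  then have bij: "bij_betw h Y X" .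
  have "(\<Sum>c\<in>{1..W}. real (rho \<delta> c) * f c) = (\<Sum>c\<in>{1..W}. \<Sum>d\<in>{d \<in> {1..c}. c dvd d\<^sup>2 - \<delta>}. f c)"
    by (simp add: rho_def count_roots_def)
  also have "\<dots> = (\<Sum>(c, d)\<in>X. f c)"
    unfolding X_def by (intro sum.Sigma ballI finite_subset[OF Collect_restrict] finite_atLeastAtMost_int)
  also have "\<dots> = (\<Sum>y\<in>Y. case h y of (c, d) \<Rightarrow> f c)"
    by (rule sum.reindex_bij_betw[OF bij, symmetric])
  also have "\<dots> = (\<Sum>(n, p, q)\<in>Y. f (quad (K n) p q))"
    by (intro sum.cong) (auto simp: Y_def h_def R(3))
  finally show ?thesis using finX bij_betw_finite[OF bij] by blast
qed

text \<open>Fundamental domains for the choice of g. For \<delta> = 1 it is determined up to sign,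
  which q > 0 fixes, and positivity of the form adds 2 p - n q > 0. For \<delta> = -1 it may be
  multiplied by powers of the quarter turn \<open>S\<close>, which leaves one quadrant with one of
  its boundary rays; the index n is then the constant 0.\<close>

definition cone :: "int \<Rightarrow> (int \<times> int \<times> int) set" where
  "cone \<delta> = (if \<delta> = 1 then {(n, p, q). n \<in> {0, 1} \<and> 0 < q \<and> 0 < 2 * p - n * q}
             else {(n, p, q). n = 0 \<and> 0 < p \<and> 0 \<le> q})"

definition form :: "int \<Rightarrow> int \<times> int \<times> int \<Rightarrow> int" where
  "form \<delta> = (\<lambda>(n, p, q). if \<delta> = 1 then q * (2 * p - n * q) else p * p + q * q)"

definition prim_reps :: "int \<Rightarrow> int \<Rightarrow> (int \<times> int \<times> int) set" where
  "prim_reps \<delta> W = {(n, p, q). (n, p, q) \<in> cone \<delta> \<and> coprime p q \<and> form \<delta> (n, p, q) \<le> W}"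

definition reps :: "int \<Rightarrow> int \<Rightarrow> (int \<times> int \<times> int) set" where
  "reps \<delta> W = {(n, p, q). (n, p, q) \<in> cone \<delta> \<and> form \<delta> (n, p, q) \<le> W}"

lemma form_pos: "(n, p, q) \<in> cone \<delta> \<Longrightarrow> 0 < form \<delta> (n, p, q)"
  by (auto simp: cone_def form_def sum_squares_gt_zero_iff split: if_splits)

lemma quad_J: "quad (J n) p q = q * (2 * p - n * q)"
  by (simp add: quad_def algebra_simps)

lemma quad_S: "quad S p q = p * p + q * q"
  by (simp add: quad_def)

lemma sum_rho_plus:
  "finite (prim_reps 1 W)" "(\<Sum>c\<in>{1..W}. real (rho 1 c) * f c) = (\<Sum>x\<in>prim_reps 1 W. f (form 1 x))"
proof -
  let ?N = "{(n, p, q). (n, p, q) \<in> cone 1 \<and> coprime p q}"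
  have Y: "{(n, p, q). (n, p, q) \<in> ?N \<and> quad (J n) p q \<le> W} = prim_reps 1 W"
    by (auto simp: prim_reps_def form_def quad_J)
  have "finite {(n, p, q). (n, p, q) \<in> ?N \<and> quad (J n) p q \<le> W} \<and>
    (\<Sum>c\<in>{1..W}. real (rho 1 c) * f c) = (\<Sum>(n, p, q)\<in>{(n, p, q). (n, p, q) \<in> ?N \<and> quad (J n) p q \<le> W}. f (quad (J n) p q))"
  proof (rule sum_rho)
    fix R assume R: "dt R = - 1" "tr R = 0" "0 < m21 R"
    obtain g n where g: "n \<in> {0, 1}" "dt g = 1" "conj_by g R = J n" using reflection_conj_J[OF R(1,2)] .
    have main: "\<exists>n g. dt g = 1 \<and> conj_by g R = J n \<and> (n, m11 g, m21 g) \<in> ?N"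
      if g: "dt g = 1" "conj_by g R = J n" "0 < m21 g" for g
    proof -
      have "R = conj_by (adj g) (J n)" using g conj_by_inverse(1) by metis
      then have "0 < m21 g * (2 * m11 g - n * m21 g)" using R(3) by (simp add: m21_conj_by_adj quad_J)
      then have "0 < 2 * m11 g - n * m21 g" using g(3) by (simp add: zero_less_mult_iff)
      then show ?thesis
        using g \<open>n \<in> {0, 1}\<close> coprime_first_column by (intro exI[of _ n] exI[of _ g]) (simp add: cone_def)
    qed
    have "R = conj_by (adj g) (J n)" using g conj_by_inverse(1) by metis
    \<comment> \<open>For q = 0 the form would vanish, so a sign of g with q > 0 can be
      chosen.\<close>
    then have "m21 g \<noteq> 0" using R(3) by (auto simp: m21_conj_by_adj quad_J)
    then consider "0 < m21 g" | "0 < m21 (- g)" by fastforce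
    then show "\<exists>n g. dt g = 1 \<and> conj_by g R = J n \<and> (n, m11 g, m21 g) \<in> ?N"
      using main[of g] main[of "- g"] g by cases auto
  next
    fix g g' n n' assume *: "dt g = 1" "dt g' = 1" "(n, m11 g, m21 g) \<in> ?N" "(n', m11 g', m21 g') \<in> ?N"
      "conj_by (adj g) (J n) = conj_by (adj g') (J n')"
    have "conj_by g' (conj_by (adj g) (J n)) = J n'" using *(2,5) by (simp add: conj_by_inverse)
    then have "conj_by (g' * adj g) (J n) = J n'" by (simp add: conj_by_conj_by)
    moreover have "dt (g' * adj g) = 1" using * by simp
    moreover have "n \<in> {0, 1}" "n' \<in> {0, 1}" using * by (auto simp: cone_def)
    ultimately have n: "n = n'" and "g' * adj g = 1 \<or> g' * adj g = -1"
      using J_conj_J[of "g' * adj g" n n'] by blast+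
    then have "g' * adj g * g = 1 * g \<or> g' * adj g * g = -1 * g" by auto
    then have "g' = g \<or> g' = - g" using *(1) by (simp add: mult_adj_1)
    moreover have "0 < m21 g" "0 < m21 g'" using * by (auto simp: cone_def)
    ultimately have "g' = g" by auto
    then show "n = n' \<and> m11 g = m11 g' \<and> m21 g = m21 g'" using n by simp
  next
    fix n p q assume "(n, p, q) \<in> ?N"
    then show "coprime p q \<and> 0 < quad (J n) p q" using form_pos[of n p q 1] by (simp add: form_def quad_J)
  qed simp_all
  moreover have "(\<Sum>(n, p, q)\<in>prim_reps 1 W. f (quad (J n) p q)) = (\<Sum>x\<in>prim_reps 1 W. f (form 1 x))"
    by (intro sum.cong) (auto simp: form_def quad_J)
  ultimately show "finite (prim_reps 1 W)" "(\<Sum>c\<in>{1..W}. real (rho 1 c) * f c) = (\<Sum>x\<in>prim_reps 1 W. f (form 1 x))"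
    unfolding Y by simp_all
qed

lemma sum_rho_minus:
  "finite (prim_reps (-1) W)" "(\<Sum>c\<in>{1..W}. real (rho (-1) c) * f c) = (\<Sum>x\<in>prim_reps (-1) W. f (form (-1) x))"
proof -
  let ?N = "{(n, p, q). (n, p, q) \<in> cone (-1) \<and> coprime p q}"
  have Y: "{(n, p, q). (n, p, q) \<in> ?N \<and> quad S p q \<le> W} = prim_reps (-1) W"
    by (auto simp: prim_reps_def form_def quad_S)
  have "finite {(n, p, q). (n, p, q) \<in> ?N \<and> quad ((\<lambda>_. S) n) p q \<le> W} \<and>
    (\<Sum>c\<in>{1..W}. real (rho (-1) c) * f c) = (\<Sum>(n, p, q)\<in>{(n, p, q). (n, p, q) \<in> ?N \<and> quad ((\<lambda>_. S) n) p q \<le> W}. f (quad ((\<lambda>_. S) n) p q))"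
  proof (rule sum_rho)
    fix R assume "dt R = - (- 1)" "tr R = 0" "0 < m21 R"
    then have R: "dt R = 1" "tr R = 0" "0 < m21 R" by simp_all
    obtain g where g: "dt g = 1" "conj_by g R = S \<or> conj_by g R = - S" using elliptic_conj_S[OF R(1,2)] .
    have Rg: "R = conj_by (adj g) (conj_by g R)" using g by (simp add: conj_by_inverse)
    \<comment> \<open>The form of \<open>- S\<close> is negative definite, whereas the lower left
      entry of R is positive.\<close>
    have "conj_by g R \<noteq> - S"
    proof
      assume "conj_by g R = - S"
      then have "m21 R = - quad S (m11 g) (m21 g)" using Rg m21_conj_by_adj[of g S] by simp
      then show False using R(3) sum_squares_ge_zero[of "m11 g" "m21 g"] by (simp add: quad_S)
    qed
    then have gS: "conj_by g R = S" using g by blast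
    have main: "\<exists>n g. dt g = 1 \<and> conj_by g R = S \<and> (n, m11 g, m21 g) \<in> ?N"
      if "dt h = 1" "conj_by h S = S" "0 < m11 (h * g)" "0 \<le> m21 (h * g)" for h
    proof -
      have "conj_by (h * g) R = S" "dt (h * g) = 1" using that gS g(1) by (simp_all flip: conj_by_conj_by)
      then show ?thesis using that coprime_first_column[of "h * g"]
        by (intro exI[of _ 0] exI[of _ "h * g"]) (simp add: cone_def)
    qed
    have SS: "conj_by S S = S" by (simp add: conj_by_def mat2_eq_iff sel_times)
    have "m11 g \<noteq> 0 \<or> m21 g \<noteq> 0" using g(1) by (auto simp: dt_def)
    \<comment> \<open>The four quadrants are rotated into the chosen one by 1, \<open>- S\<close>,
      -1 and \<open>S\<close>.\<close>
    then consider "0 < m11 g" "0 \<le> m21 g" | "0 < m21 g" "m11 g \<le> 0" | "m11 g < 0" "m21 g \<le> 0"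
      | "m21 g < 0" "0 \<le> m11 g" by linarith
    then show "\<exists>n g. dt g = 1 \<and> conj_by g R = S \<and> (n, m11 g, m21 g) \<in> ?N"
    proof cases
      case 1 show ?thesis by (rule main[of 1]) (use 1 in simp_all)
    next
      case 2 show ?thesis by (rule main[of "- S"]) (use 2 SS in \<open>simp_all add: sel_times\<close>)
    next
      case 3 show ?thesis by (rule main[of "- 1"]) (use 3 in simp_all)
    next
      case 4 show ?thesis by (rule main[of S]) (use 4 SS in \<open>simp_all add: sel_times\<close>)
    qed
  next
    fix g g' n n' assume *: "dt g = 1" "dt g' = 1" "(n, m11 g, m21 g) \<in> ?N" "(n', m11 g', m21 g') \<in> ?N"
      "conj_by (adj g) S = conj_by (adj g') S"
    have "conj_by g' (conj_by (adj g) S) = S" using *(2,5) by (simp add: conj_by_inverse)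
    then have "conj_by (g' * adj g) S = S" by (simp add: conj_by_conj_by)
    moreover have "dt (g' * adj g) = 1" using * by simp
    ultimately have "g' * adj g \<in> {1, -1, S, - S}" by (intro S_commute)
    then have "g' * adj g * g \<in> {1 * g, -1 * g, S * g, - S * g}" by auto
    then have "g' \<in> {g, - g, S * g, - (S * g)}" using *(1) by (simp add: mult_adj_1)
    moreover have "0 < m11 g" "0 \<le> m21 g" "0 < m11 g'" "0 \<le> m21 g'" using * by (auto simp: cone_def)
    ultimately have "g' = g" by (auto simp: sel_times)
    then show "n = n' \<and> m11 g = m11 g' \<and> m21 g = m21 g'" using * by (simp add: cone_def)
  next
    fix n p q assume "(n, p, q) \<in> ?N"
    then show "coprime p q \<and> 0 < quad S p q" using form_pos[of n p q "-1"] by (simp add: form_def quad_S)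
  qed simp_all
  moreover have "(\<Sum>(n, p, q)\<in>prim_reps (-1) W. f (quad S p q)) = (\<Sum>x\<in>prim_reps (-1) W. f (form (-1) x))"
    by (intro sum.cong) (auto simp: form_def quad_S)
  ultimately show "finite (prim_reps (-1) W)" "(\<Sum>c\<in>{1..W}. real (rho (-1) c) * f c) = (\<Sum>x\<in>prim_reps (-1) W. f (form (-1) x))"
    unfolding Y by simp_all
qed

section \<open>Removing the coprimality condition\<close>

lemma cone_scale: "0 < k \<Longrightarrow> (n, k * p, k * q) \<in> cone \<delta> \<longleftrightarrow> (n, p, q) \<in> cone \<delta>"
proof -
  assume k: "0 < k"
  have "2 * (k * p) - n * (k * q) = k * (2 * p - n * q)" by (simp add: algebra_simps)
  then show ?thesis using k by (auto simp: cone_def zero_less_mult_iff zero_le_mult_iff)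
qed

lemma form_scale: "form \<delta> (n, k * p, k * q) = k\<^sup>2 * form \<delta> (n, p, q)"
  by (simp add: form_def power2_eq_square algebra_simps)

text \<open>Taking the factor k = gcd p q out of p and q divides the form by k^2. The form is
  positive, so only k with k^2 <= W contribute, and these lie in 1..W.\<close>

lemma reps_bij:
  "bij_betw (\<lambda>(k, n, p, q). (n, k * p, k * q)) (SIGMA k:{1..W}. prim_reps \<delta> (W div k\<^sup>2)) (reps \<delta> W)"
proof (rule bij_betw_byWitness[where f' = "\<lambda>(n, p, q). (gcd p q, n, p div gcd p q, q div gcd p q)"])
  show "\<forall>a\<in>SIGMA k:{1..W}. prim_reps \<delta> (W div k\<^sup>2). (\<lambda>(n, p, q). (gcd p q, n, p div gcd p q, q div gcd p q))
      ((\<lambda>(k, n, p, q). (n, k * p, k * q)) a) = a"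
  proof
    fix a assume "a \<in> (SIGMA k:{1..W}. prim_reps \<delta> (W div k\<^sup>2))"
    then obtain k n p q where a: "a = (k, n, p, q)" "1 \<le> k" "coprime p q" by (auto simp: prim_reps_def)
    have "gcd (k * p) (k * q) = k" using a by (simp add: gcd_mult_left)
    then show "(\<lambda>(n, p, q). (gcd p q, n, p div gcd p q, q div gcd p q)) ((\<lambda>(k, n, p, q). (n, k * p, k * q)) a) = a"
      using a by simp
  qed
  show "\<forall>a'\<in>reps \<delta> W. (\<lambda>(k, n, p, q). (n, k * p, k * q)) ((\<lambda>(n, p, q). (gcd p q, n, p div gcd p q, q div gcd p q)) a') = a'"
    by auto
  have le: "k\<^sup>2 * Q \<le> W \<longleftrightarrow> Q \<le> W div k\<^sup>2" if "0 < k" for k Q :: int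
  proof
    have k2: "0 < k\<^sup>2" using that by simp
    show "Q \<le> W div k\<^sup>2" if "k\<^sup>2 * Q \<le> W"
      using zdiv_mono1[OF that k2] k2 by simp
    assume "Q \<le> W div k\<^sup>2"
    then have "k\<^sup>2 * Q \<le> k\<^sup>2 * (W div k\<^sup>2)" by (intro mult_left_mono) auto
    also have "\<dots> \<le> W"
      using mult_div_mod_eq[of "k\<^sup>2" W] pos_mod_sign[OF k2, of W] by linarith
    finally show "k\<^sup>2 * Q \<le> W" .
  qed
  show "(\<lambda>(k, n, p, q). (n, k * p, k * q)) ` (SIGMA k:{1..W}. prim_reps \<delta> (W div k\<^sup>2)) \<subseteq> reps \<delta> W"
    by (auto simp: prim_reps_def reps_def cone_scale form_scale le)
  show "(\<lambda>(n, p, q). (gcd p q, n, p div gcd p q, q div gcd p q)) ` reps \<delta> W \<subseteq> (SIGMA k:{1..W}. prim_reps \<delta> (W div k\<^sup>2))"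
  proof
    fix y assume "y \<in> (\<lambda>(n, p, q). (gcd p q, n, p div gcd p q, q div gcd p q)) ` reps \<delta> W"
    then obtain n p q where x: "(n, p, q) \<in> cone \<delta>" "form \<delta> (n, p, q) \<le> W"
      and y: "y = (gcd p q, n, p div gcd p q, q div gcd p q)" by (auto simp: reps_def)
    define k where "k = gcd p q"
    have pq: "p \<noteq> 0 \<or> q \<noteq> 0" using x(1) by (auto simp: cone_def split: if_splits)
    then have k: "0 < k" by (simp add: k_def)
    define a b where "a = p div k" "b = q div k"
    have ab: "p = k * a" "q = k * b" "coprime a b"
      using pq by (simp_all add: a_b_def k_def div_gcd_coprime)
    have cab: "(n, a, b) \<in> cone \<delta>" using x(1) cone_scale[OF k] ab by simp
    have le1: "k\<^sup>2 * form \<delta> (n, a, b) \<le> W" using x(2) ab form_scale by simp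
    have "k * 1 \<le> k * (k * form \<delta> (n, a, b))"
      using k form_pos[OF cab] by (intro mult_left_mono) (auto simp: int_one_le_iff_zero_less)
    also have "\<dots> \<le> W" using le1 by (simp add: power2_eq_square mult.assoc)
    finally have "k \<le> W" by simp
    then show "y \<in> (SIGMA k:{1..W}. prim_reps \<delta> (W div k\<^sup>2))"
      using cab ab(3) le[OF k] le1 k y by (simp add: prim_reps_def a_b_def flip: k_def)
  qed
qed

definition Fsum :: "int \<Rightarrow> int \<Rightarrow> real" where
  "Fsum \<delta> W = (\<Sum>x\<in>reps \<delta> W. 1 / form \<delta> x)"

definition Psum :: "int \<Rightarrow> int \<Rightarrow> real" where
  "Psum \<delta> W = (\<Sum>x\<in>prim_reps \<delta> W. 1 / form \<delta> x)"

lemma finite_prim_reps: "\<delta> \<in> {1, -1} \<Longrightarrow> finite (prim_reps \<delta> W)"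
  using sum_rho_plus(1) sum_rho_minus(1) by auto

lemma finite_reps: "\<delta> \<in> {1, -1} \<Longrightarrow> finite (reps \<delta> W)"
  using bij_betw_finite[OF reps_bij[of W \<delta>]] by (simp add: finite_prim_reps)

lemma Fsum_eq:
  assumes "\<delta> \<in> {1, -1}"
  shows "Fsum \<delta> W = (\<Sum>k\<in>{1..W}. Psum \<delta> (W div k\<^sup>2) / (real_of_int k)\<^sup>2)"
proof -
  have "Fsum \<delta> W = (\<Sum>a\<in>(SIGMA k:{1..W}. prim_reps \<delta> (W div k\<^sup>2)). 1 / form \<delta> (case a of (k, n, p, q) \<Rightarrow> (n, k * p, k * q)))"
    unfolding Fsum_def by (rule sum.reindex_bij_betw[OF reps_bij, symmetric])
  also have "\<dots> = (\<Sum>(k, x)\<in>(SIGMA k:{1..W}. prim_reps \<delta> (W div k\<^sup>2)). (1 / form \<delta> x) / (real_of_int k)\<^sup>2)"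
    by (intro sum.cong) (auto simp: form_scale)
  also have "\<dots> = (\<Sum>k\<in>{1..W}. \<Sum>x\<in>prim_reps \<delta> (W div k\<^sup>2). (1 / form \<delta> x) / (real_of_int k)\<^sup>2)"
    by (rule sum.Sigma[symmetric]) (use finite_prim_reps[OF assms] in auto)
  finally show ?thesis by (simp add: Psum_def sum_divide_distrib)
qed

lemma rho_quotient_sum_eq_Psum: "\<delta> \<in> {1, -1} \<Longrightarrow> rho_quotient_sum \<delta> W = Psum \<delta> W"
  using sum_rho_plus(2)[where W = W and f = "\<lambda>c. 1 / c"] sum_rho_minus(2)[where W = W and f = "\<lambda>c. 1 / c"] by (auto simp: rho_quotient_sum_def Psum_def)

lemma rho_sum_eq_card: "\<delta> \<in> {1, -1} \<Longrightarrow> rho_sum \<delta> W = card (prim_reps \<delta> W)"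
  using sum_rho_plus(2)[where W = W and f = "\<lambda>c. 1"] sum_rho_minus(2)[where W = W and f = "\<lambda>c. 1"] by (auto simp: rho_sum_def)

section \<open>Elementary summation and inversion with logarithmic main terms\<close>

section \<open>Harmonic sums\<close>

definition harm_sum :: "int \<Rightarrow> real" where
  "harm_sum y = (\<Sum>k\<in>{1..y}. 1 / real_of_int k)"

lemma sum_int_Suc: "0 \<le> W \<Longrightarrow> (\<Sum>k\<in>{1..W + 1}. f k) = (\<Sum>k\<in>{1..W::int}. f k) + (f (W + 1) :: real)"
proof -
  assume "0 \<le> W"
  then have "{1..W + 1} = insert (W + 1) {1..W}" by auto
  then show ?thesis by simp
qed

lemma ln_diff_bounds:
  assumes "0 < (a::real)" "a \<le> b"
  shows "(b - a) / b \<le> ln b - ln a" "ln b - ln a \<le> (b - a) / a"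
proof -
  have b: "b > 0" using assms by simp
  have "ln (b / a) \<le> b / a - 1" using assms b by (intro ln_le_minus_one) simp
  then show "ln b - ln a \<le> (b - a) / a" using assms b by (simp add: ln_div diff_divide_distrib)
  have "ln (a / b) \<le> a / b - 1" using assms b by (intro ln_le_minus_one) simp
  then show "(b - a) / b \<le> ln b - ln a" using assms b by (simp add: ln_div diff_divide_distrib)
qed

lemma harm_sum_lower: "0 \<le> y \<Longrightarrow> ln (real_of_int y + 1) \<le> harm_sum y"
proof (induction y rule: int_ge_induct)
  case (step y)
  have "ln (real_of_int y + 1 + 1) - ln (real_of_int y + 1) \<le> (real_of_int y + 1 + 1 - (real_of_int y + 1)) / (real_of_int y + 1)"
    using step.hyps by (intro ln_diff_bounds(2)) auto
  then show ?case using step by (simp add: harm_sum_def sum_int_Suc)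
qed (simp add: harm_sum_def)

lemma harm_sum_upper: "1 \<le> y \<Longrightarrow> harm_sum y \<le> 1 + ln (real_of_int y)"
proof (induction y rule: int_ge_induct)
  case (step y)
  have "(real_of_int y + 1 - real_of_int y) / (real_of_int y + 1) \<le> ln (real_of_int y + 1) - ln (real_of_int y)"
    using step.hyps by (intro ln_diff_bounds(1)) auto
  then show ?case using step by (simp add: harm_sum_def sum_int_Suc)
qed (simp add: harm_sum_def)

lemma harm_sum_approx:
  assumes "1 \<le> y"
  shows "\<bar>harm_sum y - ln y\<bar> \<le> 1"
proof -
  have "ln (real_of_int y) \<le> ln (real_of_int y + 1)" using assms by simp
  then show ?thesis using harm_sum_lower[of y] harm_sum_upper[OF assms] assms by linarith
qed

lemma ln2_le_1: "ln (2::real) \<le> 1"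
  using ln_le_minus_one[of "2::real"] by simp

text \<open>As m <= W, the integer quotient is at least 1 and hence more than half of W / m; and ln
  2 <= 1.\<close>

lemma ln_div_approx:
  assumes "1 \<le> m" "m \<le> (W::int)"
  shows "\<bar>ln (real_of_int (W div m)) - ln (real_of_int W / m)\<bar> \<le> 1"
proof -
  define v where "v = W div m"
  have eq: "m * v + W mod m = W" "0 \<le> W mod m" "W mod m < m"
    using assms by (simp_all add: v_def)
  have v: "1 \<le> v" unfolding v_def using assms zdiv_mono1[of m W m] by simp
  have "m * v \<le> W" "W < m * (v + 1)" using eq by (simp_all add: distrib_left)
  then have "real_of_int (m * v) \<le> W" "real_of_int W < real_of_int (m * (v + 1))" by (simp_all only: of_int_le_iff of_int_less_iff)
  then have le: "real_of_int v \<le> W / m" "real_of_int W / m < v + 1"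
    using assms by (simp_all add: field_simps)
  have "ln (real_of_int v) \<le> ln (W / m)" using le v by simp
  moreover have "ln (real_of_int W / m) \<le> ln (2 * real_of_int v)" using le v assms by simp
  moreover have "ln (2 * real_of_int v) = ln 2 + ln v" using v by (simp add: ln_mult)
  ultimately show ?thesis using ln2_le_1 unfolding v_def by linarith
qed

definition par_sum :: "int \<Rightarrow> int \<Rightarrow> real" where
  "par_sum Y r = (\<Sum>w\<in>{w \<in> {1..Y}. even (w - r)}. 1 / w)"

text \<open>The even terms give half the harmonic sum up to \<open>Y div 2\<close> and the odd terms
  give the rest, so either parity carries half of the logarithm.\<close>

lemma par_sum_approx:
  assumes "1 \<le> Y"
  shows "\<bar>par_sum Y r - ln Y / 2\<bar> \<le> 2"
proof -
  let ?E = "{w \<in> {1..Y}. even w}" and ?O = "{w \<in> {1..Y}. odd w}"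
  define e where "e = (\<Sum>w\<in>?E. 1 / real_of_int w)"
  have "e = (\<Sum>j\<in>{1..Y div 2}. 1 / real_of_int (2 * j))"
    unfolding e_def by (rule sum.reindex_bij_witness[where i = "\<lambda>j. 2 * j" and j = "\<lambda>w. w div 2"]) auto
  then have e: "e = harm_sum (Y div 2) / 2"
    by (simp add: harm_sum_def sum_divide_distrib mult.commute)
  have "harm_sum Y = e + (\<Sum>w\<in>?O. 1 / real_of_int w)"
    unfolding harm_sum_def e_def by (subst sum.union_disjoint[symmetric]) (auto intro!: sum.cong simp: finite_solutions)
  then have o: "(\<Sum>w\<in>?O. 1 / real_of_int w) = harm_sum Y - e" by simp
  have half: "\<bar>harm_sum (Y div 2) - ln Y\<bar> \<le> 1"
  proof -
    have "real_of_int Y / 2 \<le> real_of_int (Y div 2) + 1" using assms by linarith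
    then have "ln (real_of_int Y / 2) \<le> ln (real_of_int (Y div 2) + 1)" using assms by simp
    also have "\<dots> \<le> harm_sum (Y div 2)" using assms by (intro harm_sum_lower) simp
    finally have "ln Y - ln 2 \<le> harm_sum (Y div 2)" using assms by (simp add: ln_div)
    moreover have "harm_sum (Y div 2) \<le> harm_sum Y"
      unfolding harm_sum_def using assms by (intro sum_mono2) auto
    ultimately show ?thesis using harm_sum_upper[OF assms] ln2_le_1 by linarith
  qed
  have "par_sum Y r = e \<or> par_sum Y r = harm_sum Y - e"
  proof (cases "even r")
    case True
    then have "{w \<in> {1..Y}. even (w - r)} = ?E" by auto
    then show ?thesis by (simp only: par_sum_def e_def simp_thms)
  next
    case False
    then have "{w \<in> {1..Y}. even (w - r)} = ?O" by auto
    then show ?thesis by (simp only: par_sum_def o simp_thms)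
  qed
  then show ?thesis using half harm_sum_approx[OF assms] e by (auto simp: abs_le_iff)
qed

text \<open>Comparison with the antiderivative (ln q)^2 / 2: each increment of the difference is at
  most 2 / q.\<close>

lemma ln_over_sum:
  "1 \<le> W \<Longrightarrow> \<bar>(\<Sum>q\<in>{1..W}. ln (real_of_int q) / real_of_int q) - (ln (real_of_int W))\<^sup>2 / 2\<bar> \<le> 2 * harm_sum W"
proof (induction W rule: int_ge_induct)
  case (step W)
  define q where "q = real_of_int W + 1"
  have q: "2 \<le> q" using step.hyps by (simp add: q_def)
  define h where "h = ln q - ln (q - 1)"
  have h: "1 / q \<le> h" "h \<le> 1 / (q - 1)"
    using ln_diff_bounds[of "q - 1" q] q by (simp_all add: h_def)
  have h0: "0 \<le> h" by (rule order_trans[OF _ h(1)]) (use q in simp)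
  have lq: "0 \<le> ln q" "ln q \<le> q - 1" using q ln_le_minus_one[of q] by auto
  \<comment> \<open>Inserting ln (q - 1) = ln q - h splits off the second-order term h^2 / 2; both
    parts on the right are O(1 / q).\<close>
  have "ln q / q - ((ln q)\<^sup>2 / 2 - (ln (q - 1))\<^sup>2 / 2) = h\<^sup>2 / 2 - ln q * (h - 1 / q)"
    unfolding h_def by (simp add: power2_eq_square field_simps)
  moreover have "h\<^sup>2 / 2 \<le> 2 / q"
  proof -
    have "q \<le> 4 * (q - 1)\<^sup>2"
    proof -
      have "q * 1 \<le> (4 * (q - 1)) * (q - 1)" using q by (intro mult_mono) auto
      then show ?thesis by (simp only: power2_eq_square mult.assoc mult_1_right)
    qed
    have "h\<^sup>2 \<le> (1 / (q - 1))\<^sup>2" using h h0 by (intro power_mono)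
    also have "\<dots> \<le> 4 / q" using q \<open>q \<le> 4 * (q - 1)\<^sup>2\<close> by (simp add: power_divide divide_simps)
    finally show ?thesis by simp
  qed
  moreover have "0 \<le> ln q * (h - 1 / q)" using lq h by simp
  moreover have "ln q * (h - 1 / q) \<le> (q - 1) * (1 / (q - 1) - 1 / q)"
    using lq h q by (intro mult_mono) auto
  moreover have "(q - 1) * (1 / (q - 1) - 1 / q) = 1 / q" using q by (simp add: field_simps)
  moreover have "0 \<le> h\<^sup>2 / 2" "0 < 1 / q" using q by auto
  ultimately have "\<bar>ln q / q - ((ln q)\<^sup>2 / 2 - (ln (q - 1))\<^sup>2 / 2)\<bar> \<le> 2 * (1 / q)"
    unfolding abs_le_iff by linarith
  then show ?case
    using step by (simp add: harm_sum_def sum_int_Suc q_def)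
qed (simp add: harm_sum_def)

text \<open>With L = ln W the sum is L times the harmonic sum minus the sum of
  \<open>ln_over_sum\<close>, to leading order L^2 - L^2 / 2.\<close>

lemma sum_ln_quotient:
  assumes "1 \<le> (W::int)"
  shows "\<bar>(\<Sum>q\<in>{1..W}. ln (real_of_int W / real_of_int q) / real_of_int q) - (ln W)\<^sup>2 / 2\<bar> \<le> 3 * (1 + ln W)"
proof -
  have L: "0 \<le> ln (real_of_int W)" using assms by simp
  have "(\<Sum>q\<in>{1..W}. ln (real_of_int W / real_of_int q) / real_of_int q) = (\<Sum>q\<in>{1..W}. ln W * (1 / real_of_int q) - ln (real_of_int q) / real_of_int q)"
    using assms by (intro sum.cong) (auto simp: ln_div field_simps)
  also have "\<dots> = ln W * harm_sum W - (\<Sum>q\<in>{1..W}. ln (real_of_int q) / real_of_int q)"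
    by (simp add: sum_subtractf harm_sum_def sum_distrib_left)
  finally have eq: "(\<Sum>q\<in>{1..W}. ln (real_of_int W / real_of_int q) / real_of_int q) = ln W * harm_sum W - (\<Sum>q\<in>{1..W}. ln (real_of_int q) / real_of_int q)" .
  have "ln W * harm_sum W - (ln W)\<^sup>2 = ln W * (harm_sum W - ln W)"
    by (simp add: power2_eq_square algebra_simps)
  also have "\<bar>\<dots>\<bar> \<le> ln W * 1"
    unfolding abs_mult using L harm_sum_approx[OF assms] by (intro mult_mono) auto
  finally have "\<bar>ln W * harm_sum W - (ln W)\<^sup>2\<bar> \<le> ln W" by simp
  moreover have "2 * harm_sum W \<le> 2 * (1 + ln W)" using harm_sum_upper[OF assms] by simp
  ultimately show ?thesis using ln_over_sum[OF assms] eq by (simp add: abs_le_iff)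
qed

section \<open>Sums over all representations\<close>

text \<open>In the variables q and w = 2 p - n q the form is the product q w; the price is the
  parity condition on w - n q.\<close>

lemma Fsum_plus_eq:
  "Fsum 1 W = (\<Sum>n\<in>{0, 1}. \<Sum>q\<in>{1..W}. par_sum (W div q) (n * q) / q)"
  "card (reps 1 W) = (\<Sum>n\<in>{0, 1::int}. \<Sum>q\<in>{1..W}. card {w \<in> {1..W div q}. even (w - n * q)})"
proof -
  let ?B = "SIGMA n:{0, 1::int}. SIGMA q:{1..W}. {w \<in> {1..W div q}. even (w - n * q)}"
  have le: "q * w \<le> W \<longleftrightarrow> w \<le> W div q" if "0 < q" for q w :: int
  proof
    show "w \<le> W div q" if "q * w \<le> W" using zdiv_mono1[OF that \<open>0 < q\<close>] \<open>0 < q\<close> by simp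
    assume "w \<le> W div q"
    then have "q * w \<le> q * (W div q)" using that by (intro mult_left_mono) auto
    also have "\<dots> \<le> W" using mult_div_mod_eq[of q W] pos_mod_sign[OF that, of W] by linarith
    finally show "q * w \<le> W" .
  qed
  have bij: "bij_betw (\<lambda>(n, q, w). (n, (w + n * q) div 2, q)) ?B (reps 1 W)"
  proof (rule bij_betw_byWitness[where f' = "\<lambda>(n, p, q). (n, q, 2 * p - n * q)"])
    show "(\<lambda>(n, q, w). (n, (w + n * q) div 2, q)) ` ?B \<subseteq> reps 1 W"
    proof
      fix y assume "y \<in> (\<lambda>(n, q, w). (n, (w + n * q) div 2, q)) ` ?B"
      then obtain a where a: "a \<in> ?B" "y = (\<lambda>(n, q, w). (n, (w + n * q) div 2, q)) a" by blast
      obtain n q w where nqw: "a = (n, q, w)" by (cases a) auto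
      have x: "n \<in> {0, 1}" "1 \<le> q" "1 \<le> w" "w \<le> W div q" "even (w - n * q)"
        and y: "y = (n, (w + n * q) div 2, q)" using a unfolding nqw by simp_all
      have "2 * ((w + n * q) div 2) - n * q = w" using x(5) by auto
      then show "y \<in> reps 1 W" using x le[of q w] unfolding y by (auto simp: reps_def cone_def form_def)
    qed
    show "(\<lambda>(n, p, q). (n, q, 2 * p - n * q)) ` reps 1 W \<subseteq> ?B"
    proof
      fix y assume "y \<in> (\<lambda>(n, p, q). (n, q, 2 * p - n * q)) ` reps 1 W"
      then obtain n p q where x: "n \<in> {0, 1}" "0 < q" "0 < 2 * p - n * q" "q * (2 * p - n * q) \<le> W"
        and y: "y = (n, q, 2 * p - n * q)" by (auto simp: reps_def cone_def form_def)
      have "q * 1 \<le> q * (2 * p - n * q)" using x by (intro mult_left_mono) auto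
      then have "q \<le> W" using x by linarith
      then show "y \<in> ?B" using x le[of q "2 * p - n * q"] unfolding y by auto
    qed
  qed auto
  have fin: "finite {w \<in> {1..W div q}. even (w - n * q)}" for n q
    by (intro finite_subset[OF Collect_restrict] finite_atLeastAtMost_int)
  have "Fsum 1 W = (\<Sum>a\<in>?B. 1 / form 1 (case a of (n, q, w) \<Rightarrow> (n, (w + n * q) div 2, q)))"
    unfolding Fsum_def by (rule sum.reindex_bij_betw[OF bij, symmetric])
  also have "\<dots> = (\<Sum>(n, q, w)\<in>?B. 1 / real_of_int w / q)"
  proof (rule sum.cong[OF refl])
    fix a assume "a \<in> ?B"
    then obtain n q w where a: "a = (n, q, w)" "even (w - n * q)" by auto
    then have "2 * ((w + n * q) div 2) - n * q = w" by auto
    then show "1 / real_of_int (form 1 (case a of (n, q, w) \<Rightarrow> (n, (w + n * q) div 2, q))) =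
        (case a of (n, q, w) \<Rightarrow> 1 / real_of_int w / q)" by (simp add: a(1) form_def mult.commute)
  qed
  also have "\<dots> = (\<Sum>n\<in>{0, 1}. \<Sum>(q, w)\<in>(SIGMA q:{1..W}. {w \<in> {1..W div q}. even (w - n * q)}). 1 / real_of_int w / q)"
    by (rule sum.Sigma[symmetric]) (use fin in auto)
  also have "\<dots> = (\<Sum>n\<in>{0, 1}. \<Sum>q\<in>{1..W}. \<Sum>w\<in>{w \<in> {1..W div q}. even (w - n * q)}. 1 / real_of_int w / q)"
    by (intro sum.cong[OF refl] sum.Sigma[symmetric] ballI fin finite_atLeastAtMost_int)
  finally show "Fsum 1 W = (\<Sum>n\<in>{0, 1}. \<Sum>q\<in>{1..W}. par_sum (W div q) (n * q) / q)"
    by (simp only: par_sum_def sum_divide_distrib)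
  have "card (reps 1 W) = card ?B" using bij_betw_same_card[OF bij] by simp
  also have "\<dots> = (\<Sum>n\<in>{0, 1::int}. card (SIGMA q:{1..W}. {w \<in> {1..W div q}. even (w - n * q)}))"
    by (rule card_SigmaI) (use fin in auto)
  also have "\<dots> = (\<Sum>n\<in>{0, 1::int}. \<Sum>q\<in>{1..W}. card {w \<in> {1..W div q}. even (w - n * q)})"
    by (intro sum.cong[OF refl] card_SigmaI ballI fin finite_atLeastAtMost_int)
  finally show "card (reps 1 W) = (\<Sum>n\<in>{0, 1::int}. \<Sum>q\<in>{1..W}. card {w \<in> {1..W div q}. even (w - n * q)})" .
qed

lemma card_reps_plus_le:
  assumes "1 \<le> W"
  shows "real (card (reps 1 W)) \<le> 2 * W * (1 + ln W)"
proof -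
  have "real (card {w \<in> {1..W div q}. even (w - n * q)}) \<le> W * (1 / real_of_int q)" if q: "q \<in> {1..W}" for n q
  proof -
    have "card {w \<in> {1..W div q}. even (w - n * q)} \<le> card {1..W div q}"
      by (rule card_mono) auto
    also have "\<dots> = nat (W div q)" by simp
    finally have "real (card {w \<in> {1..W div q}. even (w - n * q)}) \<le> real (nat (W div q))" by simp
    also have "\<dots> = real_of_int (W div q)" using q by (simp add: pos_imp_zdiv_nonneg_iff)
    also have "\<dots> \<le> W / q" by (rule real_of_int_div4)
    finally show ?thesis by simp
  qed
  then have "real (card (reps 1 W)) \<le> (\<Sum>n\<in>{0, 1::int}. \<Sum>q\<in>{1..W}. W * (1 / real_of_int q))"
    unfolding Fsum_plus_eq(2) of_nat_sum by (intro sum_mono) auto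
  also have "\<dots> = 2 * (W * harm_sum W)" by (simp add: harm_sum_def sum_distrib_left)
  also have "\<dots> \<le> 2 * (W * (1 + ln W))" using harm_sum_upper[OF assms] assms by simp
  finally show ?thesis by simp
qed

text \<open>For each n one parity of w is allowed, which yields half of the sum in
  \<open>sum_ln_quotient\<close>; the two halves add up to L^2 / 2. The exponents
  \<open>Suc 1\<close> and \<open>1\<close> fit the shape of \<open>contraction\<close> with m =
  1.\<close>

lemma Fsum_plus:
  assumes "1 \<le> W"
  shows "\<bar>Fsum 1 W - 1 / 2 * ln (real_of_int W) ^ Suc 1\<bar> \<le> 10 * (1 + ln (real_of_int W)) ^ 1"
proof -
  have one: "\<bar>(\<Sum>q\<in>{1..W}. par_sum (W div q) (n * q) / q) - (\<Sum>q\<in>{1..W}. ln (real_of_int W / real_of_int q) / real_of_int q) / 2\<bar> \<le> 3 * harm_sum W" for n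
  proof -
    have "(\<Sum>q\<in>{1..W}. par_sum (W div q) (n * q) / q) - (\<Sum>q\<in>{1..W}. ln (real_of_int W / real_of_int q) / real_of_int q) / 2 =
        (\<Sum>q\<in>{1..W}. (par_sum (W div q) (n * q) - ln (real_of_int W / q) / 2) / q)"
      by (simp add: sum_divide_distrib diff_divide_distrib mult.commute flip: sum_subtractf)
    also have "\<bar>\<dots>\<bar> \<le> (\<Sum>q\<in>{1..W}. 3 / real_of_int q)"
    proof (rule order_trans[OF sum_abs sum_mono])
      fix q assume q: "q \<in> {1..W}"
      then have Y: "1 \<le> W div q" using zdiv_mono1[of q W q] by simp
      have "\<bar>ln (real_of_int (W div q)) - ln (real_of_int W / q)\<bar> \<le> 1" using ln_div_approx[of q W] q by auto
      then have "\<bar>par_sum (W div q) (n * q) - ln (real_of_int W / q) / 2\<bar> \<le> 3"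
        using par_sum_approx[OF Y, of "n * q"] unfolding abs_le_iff by linarith
      then show "\<bar>(par_sum (W div q) (n * q) - ln (real_of_int W / q) / 2) / q\<bar> \<le> 3 / q"
        using q by (simp add: divide_right_mono)
    qed
    also have "\<dots> = 3 * harm_sum W" by (simp add: harm_sum_def sum_distrib_left)
    finally show ?thesis .
  qed
  define A where "A n = (\<Sum>q\<in>{1..W}. par_sum (W div q) (n * q) / q)" for n
  define B where "B = (\<Sum>q\<in>{1..W}. ln (real_of_int W / real_of_int q) / real_of_int q)"
  have F: "Fsum 1 W = A 0 + A 1" unfolding Fsum_plus_eq A_def by simp
  have "\<bar>A 0 + A 1 - B\<bar> \<le> 6 * harm_sum W"
    using one[of 0, folded A_def B_def] one[of 1, folded A_def B_def] by linarith
  from abs_diff_chain[OF this sum_ln_quotient[OF assms, folded B_def]]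
  have "\<bar>Fsum 1 W - (ln W)\<^sup>2 / 2\<bar> \<le> 6 * harm_sum W + 3 * (1 + ln W)"
    unfolding F .
  also have "\<dots> \<le> 9 * (1 + ln W)"
    using harm_sum_upper[OF assms] by simp
  also have "\<dots> \<le> 10 * (1 + ln W) ^ 1" using assms by simp
  finally show ?thesis by (simp add: power2_eq_square)
qed

lemma arctan_diff_bounds:
  assumes "0 \<le> a" "a \<le> b"
  shows "(b - a) / (1 + b\<^sup>2) \<le> arctan b - arctan a" "arctan b - arctan a \<le> (b - a) / (1 + a\<^sup>2)"
proof -
  have "(b - a) / (1 + b\<^sup>2) \<le> arctan b - arctan a \<and> arctan b - arctan a \<le> (b - a) / (1 + a\<^sup>2)"
  proof (cases "a = b")
    case False
    then have "a < b" using assms by simp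
    then obtain z where z: "a < z" "z < b" "arctan b - arctan a = (b - a) * inverse (1 + z\<^sup>2)"
      using MVT2[of a b arctan "\<lambda>x. inverse (1 + x\<^sup>2)"] DERIV_arctan by blast
    have "a\<^sup>2 \<le> z\<^sup>2" "z\<^sup>2 \<le> b\<^sup>2" using z assms by (auto intro: power_mono)
    then have "inverse (1 + z\<^sup>2) \<le> inverse (1 + a\<^sup>2)" "inverse (1 + b\<^sup>2) \<le> inverse (1 + z\<^sup>2)"
      by (auto intro!: le_imp_inverse_le add_pos_nonneg)
    then show ?thesis using \<open>a < b\<close> unfolding z(3) divide_inverse by (auto intro: mult_left_mono)
  qed simp
  then show "(b - a) / (1 + b\<^sup>2) \<le> arctan b - arctan a" "arctan b - arctan a \<le> (b - a) / (1 + a\<^sup>2)"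
    by auto
qed

text \<open>Comparison with the integral of 1 / (p^2 + x^2), whose antiderivative arctan (x / p) / p
  telescopes; the summand 1 / p^2 is the term q = 0.\<close>

lemma sum_inverse_squares_bounds:
  fixes p :: real
  assumes "0 < p" "0 \<le> (m::int)"
  shows "(\<Sum>q\<in>{0..m}. 1 / (p\<^sup>2 + (real_of_int q)\<^sup>2)) \<le> 1 / p\<^sup>2 + arctan (m / p) / p"
    "arctan ((real_of_int m + 1) / p) / p \<le> (\<Sum>q\<in>{0..m}. 1 / (p\<^sup>2 + (real_of_int q)\<^sup>2))"
proof -
  have term_eq: "(b / p - a / p) / (1 + (x / p)\<^sup>2) / p = (b - a) / (p\<^sup>2 + x\<^sup>2)" for a b x
  proof -
    define D where "D = p\<^sup>2 + x\<^sup>2"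
    have "1 + (x / p)\<^sup>2 = D / (p * p)" using assms by (simp add: D_def power_divide field_simps power2_eq_square)
    moreover have "D \<noteq> 0" using assms by (simp add: D_def add_pos_nonneg less_imp_neq[symmetric])
    ultimately show ?thesis unfolding D_def[symmetric] using assms(1) by (simp add: field_simps)
  qed
  have bnd: "(arctan ((real_of_int q + 1) / p) - arctan (q / p)) / p \<le> 1 / (p\<^sup>2 + (real_of_int q)\<^sup>2)"
    "1 / (p\<^sup>2 + (real_of_int q + 1)\<^sup>2) \<le> (arctan ((real_of_int q + 1) / p) - arctan (q / p)) / p" if "0 \<le> q" for q
    using divide_right_mono[OF arctan_diff_bounds(1)[of "q / p" "(real_of_int q + 1) / p"], of p]
      divide_right_mono[OF arctan_diff_bounds(2)[of "q / p" "(real_of_int q + 1) / p"], of p] that assms(1)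
    unfolding term_eq by (simp_all add: divide_right_mono)
  have ins: "{0..q + 1} = insert (q + 1) {0..q}" if "0 \<le> q" for q :: int using that by auto
  show "(\<Sum>q\<in>{0..m}. 1 / (p\<^sup>2 + (real_of_int q)\<^sup>2)) \<le> 1 / p\<^sup>2 + arctan (m / p) / p"
    using assms(2)
  proof (induction m rule: int_ge_induct)
    case (step m)
    then show ?case using bnd(2)[of m]
      by (simp add: ins diff_divide_distrib)
  qed simp
  show "arctan ((real_of_int m + 1) / p) / p \<le> (\<Sum>q\<in>{0..m}. 1 / (p\<^sup>2 + (real_of_int q)\<^sup>2))"
    using assms(2)
  proof (induction m rule: int_ge_induct)
    case base
    then show ?case using bnd(1)[of 0] by simp
  next
    case (step m)
    then show ?case using bnd(1)[of "m + 1"]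
      by (simp add: ins diff_divide_distrib add.assoc)
  qed
qed

lemma arctan_ge:
  assumes "0 < (y::real)"
  shows "pi / 2 - 1 / y \<le> arctan y"
proof -
  have "arctan (1 / y) \<le> 1 / y" using arctan_diff_bounds(2)[of 0 "1 / y"] assms by simp
  moreover have "arctan (1 / y) = pi / 2 - arctan y" using arctan_inverse[of y] assms by (simp add: inverse_eq_divide)
  ultimately show ?thesis by simp
qed

lemma sum_inverse_square_le: "(\<Sum>p\<in>{1..s}. 1 / (real_of_int p)\<^sup>2) \<le> 2"
proof -
  have *: "(\<Sum>p\<in>{1..s}. 1 / (real_of_int p)\<^sup>2) \<le> 2 - 1 / s" if "1 \<le> s" for s
    using that
  proof (induction s rule: int_ge_induct)
    case (step s)
    have "1 / (real_of_int s + 1)\<^sup>2 \<le> 1 / s - 1 / (real_of_int s + 1)"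
    proof -
      have "1 / (real_of_int s + 1)\<^sup>2 \<le> 1 / (s * (real_of_int s + 1))"
        using step.hyps by (intro divide_left_mono) (auto simp: power2_eq_square)
      also have "\<dots> = 1 / s - 1 / (real_of_int s + 1)" using step.hyps by (simp add: field_simps)
      finally show ?thesis .
    qed
    then show ?case using step by (simp add: sum_int_Suc)
  qed simp
  show ?thesis
  proof (cases "1 \<le> s")
    case True
    then have "0 \<le> 1 / real_of_int s" by simp
    then show ?thesis using *[OF True] by linarith
  qed simp
qed

lemma floor_sqrt_iff: "0 \<le> x \<Longrightarrow> 0 \<le> q \<Longrightarrow> q * q \<le> x \<longleftrightarrow> q \<le> \<lfloor>sqrt (real_of_int x)\<rfloor>"
proof -
  assume "0 \<le> x" "0 \<le> q"
  have "q \<le> \<lfloor>sqrt (real_of_int x)\<rfloor> \<longleftrightarrow> sqrt ((real_of_int q)\<^sup>2) \<le> sqrt x"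
    using \<open>0 \<le> q\<close> by (simp add: le_floor_iff)
  also have "\<dots> \<longleftrightarrow> real_of_int (q * q) \<le> real_of_int x" by (simp only: real_sqrt_le_iff power2_eq_square of_int_mult)
  finally show ?thesis by (simp only: of_int_le_iff)
qed

lemma reps_minus_eq:
  assumes "1 \<le> W"
  shows "bij_betw (\<lambda>(p, q). (0, p, q)) (SIGMA p:{1..\<lfloor>sqrt (real_of_int W)\<rfloor>}. {0..\<lfloor>sqrt (real_of_int (W - p * p))\<rfloor>}) (reps (-1) W)"
proof (rule bij_betw_byWitness[where f' = snd])
  show "(\<lambda>(p, q). (0, p, q)) ` (SIGMA p:{1..\<lfloor>sqrt (real_of_int W)\<rfloor>}. {0..\<lfloor>sqrt (real_of_int (W - p * p))\<rfloor>}) \<subseteq> reps (-1) W"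
  proof
    fix y :: "int \<times> int \<times> int"
    assume "y \<in> (\<lambda>(p, q). (0, p, q)) ` (SIGMA p:{1..\<lfloor>sqrt (real_of_int W)\<rfloor>}. {0..\<lfloor>sqrt (real_of_int (W - p * p))\<rfloor>})"
    then obtain p q where y: "y = (0, p, q)" and p: "1 \<le> p" "p \<le> \<lfloor>sqrt (real_of_int W)\<rfloor>"
      and q: "0 \<le> q" "q \<le> \<lfloor>sqrt (real_of_int (W - p * p))\<rfloor>" by auto
    have "p * p \<le> W" using floor_sqrt_iff[of W p] p assms by simp
    then have "q * q \<le> W - p * p" using floor_sqrt_iff[of "W - p * p" q] q by simp
    then show "y \<in> reps (-1) W" using p q by (simp add: y reps_def cone_def form_def)
  qed
  show "snd ` reps (-1) W \<subseteq> (SIGMA p:{1..\<lfloor>sqrt (real_of_int W)\<rfloor>}. {0..\<lfloor>sqrt (real_of_int (W - p * p))\<rfloor>})"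
  proof
    fix y assume "y \<in> snd ` reps (-1) W"
    then obtain p q where y: "y = (p, q)" "0 < p" "0 \<le> q" "p * p + q * q \<le> W"
      by (auto simp: reps_def cone_def form_def)
    have "p * p \<le> W" "q * q \<le> W - p * p" using y(4) zero_le_square[of q] by linarith+
    then have "p \<le> \<lfloor>sqrt (real_of_int W)\<rfloor>" "q \<le> \<lfloor>sqrt (real_of_int (W - p * p))\<rfloor>"
      using floor_sqrt_iff[of W p] floor_sqrt_iff[of "W - p * p" q] y assms by simp_all
    then show "y \<in> (SIGMA p:{1..\<lfloor>sqrt (real_of_int W)\<rfloor>}. {0..\<lfloor>sqrt (real_of_int (W - p * p))\<rfloor>})" using y by auto
  qed
qed (auto simp: reps_def cone_def)

text \<open>A linear bound without logarithm: the error term for \<delta> = -1 has no room for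
  one.\<close>

lemma card_reps_minus_le:
  assumes "1 \<le> W"
  shows "real (card (reps (-1) W)) \<le> 2 * W"
proof -
  define s where "s = \<lfloor>sqrt (real_of_int W)\<rfloor>"
  have s: "1 \<le> s" "s * s \<le> W"
    using floor_sqrt_iff[of W 1] floor_sqrt_iff[of W s] assms unfolding s_def by auto
  have "reps (-1) W \<subseteq> {0} \<times> {1..s} \<times> {0..s}"
  proof
    fix y assume "y \<in> reps (-1) W"
    then obtain p q where y: "y = (0, p, q)" "0 < p" "0 \<le> q" "p * p + q * q \<le> W"
      by (auto simp: reps_def cone_def form_def)
    have "p * p \<le> W" "q * q \<le> W" using y(4) zero_le_square[of q] zero_le_square[of p] by linarith+
    then show "y \<in> {0} \<times> {1..s} \<times> {0..s}"
      using floor_sqrt_iff[of W p] floor_sqrt_iff[of W q] y assms unfolding s_def by auto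
  qed
  then have "card (reps (-1) W) \<le> card ({0::int} \<times> {1..s} \<times> {0..s})" by (intro card_mono) auto
  also have "\<dots> = nat s * nat (s + 1)" by (simp add: card_cartesian_product)
  finally have "real (card (reps (-1) W)) \<le> real (nat s * nat (s + 1))" by (simp only: of_nat_le_iff)
  also have "\<dots> = real_of_int (s * (s + 1))" using s by simp
  also have "\<dots> \<le> real_of_int (2 * (s * s))" using s by (simp only: of_int_le_iff) (simp add: algebra_simps mult_le_cancel_left1)
  also have "\<dots> \<le> real_of_int (2 * W)" using s by (simp only: of_int_le_iff)
  finally show ?thesis by simp
qed

text \<open>For fixed p the sum over q is close to pi / (2 p), and p runs up to sqrt W; this gives
  pi / 2 times (ln W) / 2.\<close>

lemma Fsum_minus:
  assumes "1 \<le> W"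
  shows "\<bar>Fsum (-1) W - pi / 4 * ln (real_of_int W) ^ Suc 0\<bar> \<le> 6 * (1 + ln (real_of_int W)) ^ 0"
proof -
  define s where "s = \<lfloor>sqrt (real_of_int W)\<rfloor>"
  define m where "m p = \<lfloor>sqrt (real_of_int (W - p * p))\<rfloor>" for p
  define g where "g p = (\<Sum>q\<in>{0..m p}. 1 / ((real_of_int p)\<^sup>2 + (real_of_int q)\<^sup>2))" for p
  have s: "1 \<le> s" using floor_sqrt_iff[of W 1] assms unfolding s_def by simp
  have "Fsum (-1) W = (\<Sum>a\<in>(SIGMA p:{1..s}. {0..m p}). 1 / form (-1) (case a of (p, q) \<Rightarrow> (0, p, q)))"
    unfolding Fsum_def s_def m_def by (rule sum.reindex_bij_betw[OF reps_minus_eq[OF assms], symmetric])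
  also have "\<dots> = (\<Sum>(p, q)\<in>(SIGMA p:{1..s}. {0..m p}). 1 / ((real_of_int p)\<^sup>2 + (real_of_int q)\<^sup>2))"
    by (intro sum.cong) (auto simp: form_def power2_eq_square)
  also have "\<dots> = (\<Sum>p\<in>{1..s}. g p)"
    unfolding g_def by (rule sum.Sigma[symmetric]) auto
  finally have F: "Fsum (-1) W = (\<Sum>p\<in>{1..s}. g p)" .
  have m0: "0 \<le> m p" if "p \<in> {1..s}" for p
  proof -
    have "p * p \<le> W" using floor_sqrt_iff[of W p] that assms by (simp add: s_def)
    then have "0 \<le> W - p * p" by simp
    then have "0 \<le> sqrt (real_of_int (W - p * p))" by (simp only: real_sqrt_ge_0_iff of_int_0_le_iff)
    then show ?thesis unfolding m_def by (simp only: zero_le_floor)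
  qed
  have pi1: "pi / 2 \<le> 2" using pi_less_4 by simp
  have L0: "0 \<le> ln (real_of_int W)" using assms by simp
  have upper: "Fsum (-1) W \<le> pi / 4 * ln W + 4"
  proof -
    have "Fsum (-1) W \<le> (\<Sum>p\<in>{1..s}. 1 / (real_of_int p)\<^sup>2 + pi / 2 * (1 / p))"
      unfolding F
    proof (rule sum_mono)
      fix p assume p: "p \<in> {1..s}"
      have "g p \<le> 1 / (real_of_int p)\<^sup>2 + arctan (m p / p) / p"
        unfolding g_def using sum_inverse_squares_bounds(1)[of p "m p"] m0[OF p] p by simp
      also have "arctan (m p / p) / p \<le> (pi / 2) / p"
        using arctan_ubound[of "m p / p"] p by (intro divide_right_mono) auto
      finally show "g p \<le> 1 / (real_of_int p)\<^sup>2 + pi / 2 * (1 / p)" by simp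
    qed
    also have "\<dots> = (\<Sum>p\<in>{1..s}. 1 / (real_of_int p)\<^sup>2) + pi / 2 * harm_sum s"
      by (simp add: sum.distrib harm_sum_def sum_distrib_left)
    also have "\<dots> \<le> 2 + pi / 2 * (1 + ln s)"
      using sum_inverse_square_le[of s] harm_sum_upper[OF s] by (intro add_mono mult_left_mono) auto
    also have "ln (real_of_int s) \<le> ln (sqrt W)" using s by (simp add: s_def)
    also have "ln (sqrt (real_of_int W)) = ln W / 2" using assms by (simp add: ln_sqrt)
    finally have "Fsum (-1) W \<le> 2 + pi / 2 * (1 + ln W / 2)" by simp
    then show ?thesis using pi1 by (simp add: algebra_simps)
  qed
  have lower: "pi / 4 * ln W - 3 \<le> Fsum (-1) W"
  proof -
    \<comment> \<open>For p <= t the upper end \<open>m p + 1\<close> is at least t, so the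
      arctangent is within p / t of pi / 2, and the total loss is at most 1.\<close>
    define t where "t = sqrt (real_of_int W / 2)"
    define s' where "s' = \<lfloor>t\<rfloor>"
    have t: "0 < t" using assms by (simp add: t_def)
    have t2: "t\<^sup>2 = W / 2" using assms by (simp add: t_def)
    have s': "0 \<le> s'" "real_of_int s' \<le> t" "t < s' + 1" using t by (auto simp: s'_def)
    have "t \<le> sqrt W" using assms by (simp add: t_def)
    then have ss: "s' \<le> s" unfolding s_def s'_def by (rule floor_mono)
    have "(\<Sum>p\<in>{1..s'}. pi / 2 * (1 / p) - 1 / t) \<le> (\<Sum>p\<in>{1..s'}. g p)"
    proof (rule sum_mono)
      fix p assume p: "p \<in> {1..s'}"
      have p1: "p \<in> {1..s}" using p ss by auto
      have pt: "real_of_int p \<le> t" using p s'(2) by auto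
      then have "(real_of_int p)\<^sup>2 \<le> t\<^sup>2" using p by (intro power_mono) auto
      then have "(real_of_int p)\<^sup>2 \<le> W / 2" unfolding t2 .
      then have "W / 2 \<le> real_of_int (W - p * p)" by (simp add: power2_eq_square)
      then have "t \<le> sqrt (real_of_int (W - p * p))" unfolding t_def by (rule real_sqrt_le_mono)
      then have tm: "t \<le> real_of_int (m p) + 1" unfolding m_def by linarith
      have "pi / 2 - 1 / (t / p) \<le> arctan (t / p)" using t p by (intro arctan_ge) auto
      also have "\<dots> \<le> arctan ((real_of_int (m p) + 1) / p)"
        using tm p by (simp add: arctan_le_iff divide_right_mono)
      finally have "(pi / 2 - p / t) / p \<le> arctan ((real_of_int (m p) + 1) / p) / p"
        using p by (intro divide_right_mono) auto
      also have "\<dots> \<le> g p"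
        unfolding g_def using sum_inverse_squares_bounds(2)[of p "m p"] m0[OF p1] p by simp
      finally show "pi / 2 * (1 / p) - 1 / t \<le> g p" using p by (simp add: diff_divide_distrib)
    qed
    also have "\<dots> \<le> (\<Sum>p\<in>{1..s}. g p)"
      using ss by (intro sum_mono2) (auto simp: g_def intro!: sum_nonneg)
    finally have "pi / 2 * harm_sum s' - s' * (1 / t) \<le> Fsum (-1) W"
      using s'(1) by (simp add: F sum_subtractf harm_sum_def sum_distrib_left)
    moreover have "s' * (1 / t) \<le> 1" using s' t by simp
    moreover have "ln t \<le> ln (real_of_int s' + 1)" using s'(3) t by simp
    then have "ln t \<le> harm_sum s'" using harm_sum_lower[OF s'(1)] by linarith
    then have "pi / 2 * ln t \<le> pi / 2 * harm_sum s'" by (intro mult_left_mono) auto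
    moreover have "ln t = (ln W - ln 2) / 2" using assms by (simp add: t_def ln_sqrt ln_div)
    moreover have "pi / 2 * (ln 2 / 2) \<le> 2 * (1 / 2)" using pi1 ln2_le_1 by (intro mult_mono) auto
    ultimately show ?thesis by (simp add: algebra_simps diff_divide_distrib)
  qed
  show ?thesis using upper lower by (simp add: abs_le_iff)
qed

section \<open>Inverting the sum over common divisors\<close>

lemma power_diff_le:
  fixes a b :: real
  assumes "0 \<le> b" "b \<le> a"
  shows "a ^ Suc m - b ^ Suc m \<le> real (Suc m) * a ^ m * (a - b)"
proof (induction m)
  case (Suc m)
  have "a ^ Suc (Suc m) - b ^ Suc (Suc m) = a * (a ^ Suc m - b ^ Suc m) + b ^ Suc m * (a - b)"
    by (simp add: algebra_simps)
  also have "\<dots> \<le> a * (real (Suc m) * a ^ m * (a - b)) + a ^ Suc m * (a - b)"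
    using assms Suc by (intro add_mono mult_left_mono mult_right_mono power_mono) auto
  also have "\<dots> = real (Suc (Suc m)) * a ^ Suc m * (a - b)"
    by (simp add: algebra_simps)
  finally show ?case .
qed simp

lemma abs_power_diff_le:
  fixes a b M :: real
  assumes "0 \<le> b" "0 \<le> a" "a \<le> M" "b \<le> M" "\<bar>a - b\<bar> \<le> e"
  shows "\<bar>a ^ Suc m - b ^ Suc m\<bar> \<le> real (Suc m) * M ^ m * e"
proof -
  have *: "u ^ Suc m - v ^ Suc m \<le> real (Suc m) * M ^ m * e" if "0 \<le> v" "v \<le> u" "u \<le> M" "u - v \<le> e" for u v
  proof -
    have "u ^ Suc m - v ^ Suc m \<le> real (Suc m) * u ^ m * (u - v)" using that by (intro power_diff_le)
    also have "\<dots> \<le> real (Suc m) * M ^ m * e"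
      using that by (intro mult_mono power_mono mult_nonneg_nonneg zero_le_power) auto
    finally show ?thesis .
  qed
  show ?thesis
  proof (cases "b \<le> a")
    case True
    then have "b ^ Suc m \<le> a ^ Suc m" using assms by (intro power_mono)
    then show ?thesis using *[of b a] assms True by linarith
  next
    case False
    then have "a ^ Suc m \<le> b ^ Suc m" using assms by (intro power_mono) auto
    then show ?thesis using *[of a b] assms False by linarith
  qed
qed

text \<open>This also covers \<open>W < M\<close>, where \<open>W div M = 0\<close> and \<open>ln 0 = 0\<close>.\<close>

lemma ln_div_power_diff:
  assumes "1 \<le> (W::int)" "1 \<le> M"
  shows "\<bar>ln (real_of_int (W div M)) ^ Suc m - ln (real_of_int W) ^ Suc m\<bar>
    \<le> real (Suc m) * ln (real_of_int W) ^ m * (ln (real_of_int M) + 1)"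
    "0 \<le> ln (real_of_int (W div M))" "ln (real_of_int (W div M)) \<le> ln (real_of_int W)"
proof -
  let ?a = "ln (real_of_int W)" and ?b = "ln (real_of_int (W div M))"
  have a: "0 \<le> ?a" using assms by simp
  have *: "0 \<le> ?b \<and> ?b \<le> ?a \<and> ?a - ?b \<le> ln (real_of_int M) + 1"
  proof (cases "M \<le> W")
    case True
    have v: "1 \<le> W div M" using zdiv_mono1[OF True, of M] assms by simp
    have "W div M \<le> W" using zdiv_mono2[of W 1 M] assms by simp
    then have "?b \<le> ?a" using v by simp
    moreover have "ln (real_of_int W / M) = ?a - ln M" using assms by (simp add: ln_div)
    ultimately show ?thesis using ln_div_approx[OF assms(2) True] v by auto
  next
    case False
    then have "W div M = 0" using assms by simp
    moreover have "?a \<le> ln M" using False assms by simp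
    ultimately show ?thesis using a by simp
  qed
  then show "0 \<le> ?b" "?b \<le> ?a" by auto
  with * a show "\<bar>?b ^ Suc m - ?a ^ Suc m\<bar> \<le> real (Suc m) * ?a ^ m * (ln (real_of_int M) + 1)"
    by (intro abs_power_diff_le) auto
qed

lemma sum_int_eq_nat: "0 \<le> W \<Longrightarrow> (\<Sum>k\<in>{1..W}. f k) = (\<Sum>k\<in>{1..nat W}. f (int k) :: real)"
proof -
  assume "0 \<le> W"
  then have "{1..W} = int ` {1..nat W}" by (simp add: image_int_atLeastAtMost)
  then show ?thesis by (simp add: sum.reindex)
qed

lemma ln_le_sqrt: "0 < x \<Longrightarrow> ln x \<le> 2 * (sqrt x - 1)"
  using ln_le_minus_one[of "sqrt x"] by (simp add: ln_sqrt)

text \<open>The numerator is ln (k^2) + 1, the loss in \<open>ln_div_power_diff\<close> for M = k^2.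
  It is at most 5 sqrt k, which leaves a convergent series of exponent -3/2.\<close>

lemma sum_ln_over_square_bounded:
  obtains D where "0 \<le> D" "\<And>W. 0 \<le> W \<Longrightarrow> (\<Sum>k\<in>{1..W}. (2 * ln (real_of_int k) + 1) / (real_of_int k)\<^sup>2) \<le> D"
proof -
  define h where "h n = 5 * (real n powr (-3/2))" for n :: nat
  have sm: "summable h" unfolding h_def by (intro summable_mult) (simp add: summable_real_powr_iff)
  have h0: "0 \<le> h n" for n by (simp add: h_def)
  show ?thesis
  proof
    show "0 \<le> suminf h" using sm h0 by (rule suminf_nonneg)
    fix W :: int assume W: "0 \<le> W"
    have "(\<Sum>k\<in>{1..W}. (2 * ln (real_of_int k) + 1) / (real_of_int k)\<^sup>2)
        = (\<Sum>k\<in>{1..nat W}. (2 * ln (real k) + 1) / (real k)\<^sup>2)"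
      using sum_int_eq_nat[OF W] by simp
    also have "\<dots> \<le> (\<Sum>k\<in>{1..nat W}. h k)"
    proof (rule sum_mono)
      fix k assume "k \<in> {1..nat W}"
      then have k: "1 \<le> real k" by simp
      have "2 * ln (real k) + 1 \<le> 5 * sqrt k"
      proof -
        define r where "r = sqrt (real k)"
        have "0 \<le> r" "ln (real k) \<le> 2 * (r - 1)" using k ln_le_sqrt[of "real k"] by (auto simp: r_def)
        then show ?thesis unfolding r_def[symmetric] by argo
      qed
      then have "(2 * ln (real k) + 1) / (real k)\<^sup>2 \<le> 5 * sqrt k / (real k)\<^sup>2"
        by (intro divide_right_mono) auto
      also have "\<dots> = h k"
      proof -
        have "sqrt k / (real k)\<^sup>2 = real k powr (1/2) / real k powr 2" using k by (simp add: powr_half_sqrt)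
        also have "\<dots> = real k powr (1/2 - 2)" by (rule powr_diff[symmetric])
        also have "1/2 - 2 = (-3/2 :: real)" by simp
        finally show ?thesis by (simp add: h_def)
      qed
      finally show "(2 * ln (real k) + 1) / (real k)\<^sup>2 \<le> h k" .
    qed
    also have "\<dots> \<le> suminf h" by (rule sum_le_suminf) (use sm h0 in auto)
    finally show "(\<Sum>k\<in>{1..W}. (2 * ln (real_of_int k) + 1) / (real_of_int k)\<^sup>2) \<le> suminf h" .
  qed
qed

text \<open>The partial sums increase to the limit, and the partial sums plus 1 / W decrease to
  it.\<close>

lemma basel_partial:
  assumes "1 \<le> W"
  shows "\<bar>(\<Sum>k\<in>{1..W}. 1 / (real_of_int k)\<^sup>2) - pi\<^sup>2 / 6\<bar> \<le> 1 / W"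
proof -
  define g where "g n = (\<Sum>i<n. 1 / (real i + 1)\<^sup>2)" for n
  have lim: "g \<longlonglongrightarrow> pi\<^sup>2 / 6"
    using inverse_squares_sums unfolding sums_def g_def by (simp add: add.commute)
  have inc: "incseq g" unfolding g_def by (intro incseq_SucI) simp
  define h where "h n = g (Suc n) + 1 / (real n + 1)" for n
  have "decseq h"
  proof (rule decseq_SucI)
    fix n
    have "1 / (real n + 2)\<^sup>2 \<le> 1 / ((real n + 1) * (real n + 2))"
      by (intro divide_left_mono) (auto simp: power2_eq_square)
    also have "\<dots> = 1 / (real n + 1) - 1 / (real n + 2)" by (simp add: field_simps)
    finally show "h (Suc n) \<le> h n" by (simp add: h_def g_def add.commute)
  qed
  moreover have "h \<longlonglongrightarrow> pi\<^sup>2 / 6"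
  proof -
    have "(\<lambda>n. 1 / (real n + 1)) \<longlonglongrightarrow> 0" by (rule LIMSEQ_inverse_real_of_nat[simplified inverse_eq_divide, THEN Lim_transform_eventually]) (simp add: add.commute)
    then show ?thesis unfolding h_def using tendsto_add[OF LIMSEQ_Suc[OF lim]] by force
  qed
  ultimately have "pi\<^sup>2 / 6 \<le> h n" for n by (rule decseq_ge)
  moreover have "g n \<le> pi\<^sup>2 / 6" for n using inc lim by (rule incseq_le)
  moreover have "(\<Sum>k\<in>{1..W}. 1 / (real_of_int k)\<^sup>2) = g (nat W)"
  proof -
    have "(\<Sum>k\<in>{1..W}. 1 / (real_of_int k)\<^sup>2) = (\<Sum>k\<in>{1..nat W}. 1 / (real k)\<^sup>2)"
      using sum_int_eq_nat[of W] assms by simp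
    also have "\<dots> = g (nat W)"
      unfolding g_def by (rule sum.reindex_bij_witness[where i = Suc and j = "\<lambda>k. k - 1"]) auto
    finally show ?thesis .
  qed
  moreover have "h (nat W - 1) = g (nat W) + 1 / W"
  proof -
    have "Suc (nat W - 1) = nat W" "real (nat W - 1) + 1 = W" using assms by (simp_all add: of_nat_diff)
    then show ?thesis by (simp add: h_def)
  qed
  ultimately show ?thesis by (smt (verit) abs_le_iff)
qed

lemma sum_inverse_squares_from_2: "(\<Sum>k\<in>{2..W}. 1 / (real_of_int k)\<^sup>2) \<le> 3 / 4"
proof -
  have *: "(\<Sum>k\<in>{2..W}. 1 / (real_of_int k)\<^sup>2) \<le> 3 / 4 - 1 / W" if "2 \<le> W" for W
    using that
  proof (induction W rule: int_ge_induct)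
    case (step W)
    have "1 / (real_of_int W + 1)\<^sup>2 \<le> 1 / (W * (real_of_int W + 1))"
      using step.hyps by (intro divide_left_mono) (auto simp: power2_eq_square)
    also have "\<dots> = 1 / W - 1 / (real_of_int W + 1)" using step.hyps by (simp add: field_simps)
    finally have "1 / (real_of_int W + 1)\<^sup>2 \<le> 1 / W - 1 / (real_of_int W + 1)" .
    moreover have "{2..W + 1} = insert (W + 1) {2..W}" using step.hyps by auto
    ultimately show ?case using step by simp
  qed simp
  show ?thesis
  proof (cases "2 \<le> W")
    case True
    then have "0 \<le> 1 / real_of_int W" by simp
    then show ?thesis using *[OF True] by linarith
  qed simp
qed

text \<open>The terms with \<open>k \<ge> 2\<close> carry total weight at most \<open>3 / 4 < 1\<close>, so the relation between \<open>F\<close> and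
  \<open>P\<close> is inverted by a contraction argument instead of Moebius inversion.\<close>

lemma contraction:
  fixes F P :: "int \<Rightarrow> real"
  assumes FP: "\<And>W. 1 \<le> W \<Longrightarrow> F W = (\<Sum>k\<in>{1..W}. P (W div k\<^sup>2) / (real_of_int k)\<^sup>2)"
    and P0: "P 0 = 0"
    and F: "\<And>W. 1 \<le> W \<Longrightarrow> \<bar>F W - \<kappa> * ln (real_of_int W) ^ Suc m\<bar> \<le> C * (1 + ln (real_of_int W)) ^ m"
  shows "\<exists>C'\<ge>0. \<forall>W\<ge>1. \<bar>P W - 6 * \<kappa> / pi\<^sup>2 * ln (real_of_int W) ^ Suc m\<bar> \<le> C' * (1 + ln (real_of_int W)) ^ m"
proof -
  \<comment> \<open>\<beta> is chosen so that \<beta> times pi^2 / 6, the sum of all 1 / k^2, is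
    \<kappa>.\<close>
  define \<beta> where "\<beta> = 6 * \<kappa> / pi\<^sup>2"
  define L where "L W = ln (real_of_int W)" for W
  define E where "E W = P W - \<beta> * L W ^ Suc m" for W
  obtain D where D: "0 \<le> D" "\<And>W. 0 \<le> W \<Longrightarrow> (\<Sum>k\<in>{1..W}. (2 * ln (real_of_int k) + 1) / (real_of_int k)\<^sup>2) \<le> D"
    using sum_ln_over_square_bounded by blast
  define G where "G = real (Suc m) * D + 1"
  define C1 where "C1 = \<bar>C\<bar> + \<bar>\<beta>\<bar> * G"
  have C1: "0 \<le> C1" using D(1) by (simp add: C1_def G_def)
  have L0: "0 \<le> L W" if "1 \<le> W" for W using that by (simp add: L_def)
  have main: "\<bar>(\<Sum>k\<in>{1..W}. L (W div k\<^sup>2) ^ Suc m / (real_of_int k)\<^sup>2) - pi\<^sup>2 / 6 * L W ^ Suc m\<bar> \<le> G * L W ^ m"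
    if W: "1 \<le> W" for W
  proof -
    define Z where "Z = (\<Sum>k\<in>{1..W}. 1 / (real_of_int k)\<^sup>2)"
    have "(\<Sum>k\<in>{1..W}. L (W div k\<^sup>2) ^ Suc m / (real_of_int k)\<^sup>2) - Z * L W ^ Suc m
        = (\<Sum>k\<in>{1..W}. (L (W div k\<^sup>2) ^ Suc m - L W ^ Suc m) / (real_of_int k)\<^sup>2)"
      by (simp add: Z_def sum_distrib_right diff_divide_distrib sum_subtractf)
    also have "\<bar>\<dots>\<bar> \<le> (\<Sum>k\<in>{1..W}. real (Suc m) * L W ^ m * ((2 * ln (real_of_int k) + 1) / (real_of_int k)\<^sup>2))"
    proof (rule order_trans[OF sum_abs sum_mono])
      fix k assume k: "k \<in> {1..W}"
      then have "1 \<le> k\<^sup>2" by (simp add: one_le_power)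
      from ln_div_power_diff(1)[OF W this, of m]
      have "\<bar>L (W div k\<^sup>2) ^ Suc m - L W ^ Suc m\<bar> \<le> real (Suc m) * L W ^ m * (2 * ln (real_of_int k) + 1)"
        using k by (simp only: L_def of_int_power) (simp add: ln_realpow)
      then have "\<bar>L (W div k\<^sup>2) ^ Suc m - L W ^ Suc m\<bar> / (real_of_int k)\<^sup>2
          \<le> real (Suc m) * L W ^ m * (2 * ln (real_of_int k) + 1) / (real_of_int k)\<^sup>2"
        by (rule divide_right_mono) simp
      then show "\<bar>(L (W div k\<^sup>2) ^ Suc m - L W ^ Suc m) / (real_of_int k)\<^sup>2\<bar>
          \<le> real (Suc m) * L W ^ m * ((2 * ln (real_of_int k) + 1) / (real_of_int k)\<^sup>2)"
        by (simp add: abs_divide)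
    qed
    also have "\<dots> \<le> real (Suc m) * L W ^ m * D"
      unfolding sum_distrib_left[symmetric] using D(2)[of W] W L0[OF W] by (intro mult_left_mono) auto
    finally have 1: "\<bar>(\<Sum>k\<in>{1..W}. L (W div k\<^sup>2) ^ Suc m / (real_of_int k)\<^sup>2) - Z * L W ^ Suc m\<bar> \<le> real (Suc m) * L W ^ m * D" .
    have "Z * L W ^ Suc m - pi\<^sup>2 / 6 * L W ^ Suc m = (Z - pi\<^sup>2 / 6) * L W * L W ^ m" by (simp add: algebra_simps)
    also have "\<bar>\<dots>\<bar> = \<bar>Z - pi\<^sup>2 / 6\<bar> * L W * L W ^ m" using L0[OF W] by (simp add: abs_mult)
    \<comment> \<open>The tail of the series is at most 1 / W, which absorbs a whole factor
      \<open>L W\<close>.\<close>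
    also have "\<dots> \<le> 1 / W * W * L W ^ m"
      using basel_partial[OF W] L0[OF W] ln_bound[of "real_of_int W"] W unfolding Z_def
      by (intro mult_mono) (auto simp: L_def)
    finally have 2: "\<bar>Z * L W ^ Suc m - pi\<^sup>2 / 6 * L W ^ Suc m\<bar> \<le> 1 * L W ^ m" using W by simp
    show ?thesis using abs_diff_chain[OF 1 2] by (simp add: G_def algebra_simps)
  qed
  \<comment> \<open>The error E enters the same weighted sum as P, and the choice of \<beta> cancels
    the main terms.\<close>
  have Esum: "\<bar>\<Sum>k\<in>{1..W}. E (W div k\<^sup>2) / (real_of_int k)\<^sup>2\<bar> \<le> C1 * (1 + L W) ^ m" if W: "1 \<le> W" for W
  proof -
    define X where "X = (\<Sum>k\<in>{1..W}. L (W div k\<^sup>2) ^ Suc m / (real_of_int k)\<^sup>2)"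
    have "(\<Sum>k\<in>{1..W}. E (W div k\<^sup>2) / (real_of_int k)\<^sup>2) = F W - \<beta> * X"
      by (simp add: E_def X_def FP[OF W] diff_divide_distrib sum_subtractf sum_distrib_left)
    also have "\<dots> = (F W - \<kappa> * L W ^ Suc m) - \<beta> * (X - pi\<^sup>2 / 6 * L W ^ Suc m)"
      by (simp add: \<beta>_def algebra_simps)
    also have "\<bar>\<dots>\<bar> \<le> \<bar>F W - \<kappa> * L W ^ Suc m\<bar> + \<bar>\<beta>\<bar> * \<bar>X - pi\<^sup>2 / 6 * L W ^ Suc m\<bar>"
      using abs_triangle_ineq4[of "F W - \<kappa> * L W ^ Suc m" "\<beta> * (X - pi\<^sup>2 / 6 * L W ^ Suc m)"] by (simp add: abs_mult)
    also have "\<dots> \<le> \<bar>C\<bar> * (1 + L W) ^ m + \<bar>\<beta>\<bar> * (G * (1 + L W) ^ m)"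
    proof (intro add_mono mult_left_mono)
      have "C * (1 + L W) ^ m \<le> \<bar>C\<bar> * (1 + L W) ^ m" using L0[OF W] by (intro mult_right_mono) auto
      then show "\<bar>F W - \<kappa> * L W ^ Suc m\<bar> \<le> \<bar>C\<bar> * (1 + L W) ^ m" using F[OF W] unfolding L_def by linarith
      have "G * L W ^ m \<le> G * (1 + L W) ^ m" using L0[OF W] D(1) by (intro mult_left_mono power_mono) (auto simp: G_def)
      then show "\<bar>X - pi\<^sup>2 / 6 * L W ^ Suc m\<bar> \<le> G * (1 + L W) ^ m" using main[OF W] unfolding X_def by linarith
    qed simp
    finally show ?thesis by (simp add: C1_def algebra_simps)
  qed
  have E0: "E 0 = 0" by (simp add: E_def P0 L_def)
  have bound: "1 \<le> W \<Longrightarrow> \<bar>E W\<bar> \<le> 4 * C1 * (1 + L W) ^ m" for W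
  proof (induction "nat W" arbitrary: W rule: less_induct)
    case less
    \<comment> \<open>B solves C1 (1 + L W)^m + (3 / 4) B = B, so the bound reproduces itself in the
      induction.\<close>
    define B where "B = 4 * C1 * (1 + L W) ^ m"
    have B0: "0 \<le> B" using C1 L0[OF less.prems] by (simp add: B_def)
    have small: "\<bar>E (W div k\<^sup>2)\<bar> \<le> B" if k: "2 \<le> k" for k
    proof (cases "1 \<le> W div k\<^sup>2")
      case True
      have k1: "1 < k\<^sup>2" using k by (simp add: one_less_power)
      have "W div k\<^sup>2 < W" using k1 less.prems by (intro int_div_less_self) auto
      then have "\<bar>E (W div k\<^sup>2)\<bar> \<le> 4 * C1 * (1 + L (W div k\<^sup>2)) ^ m" using less.hyps True by simp
      also have "\<dots> \<le> B"
        unfolding B_def using C1 L0[OF True] ln_div_power_diff(3)[OF less.prems, of "k\<^sup>2"] k1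
        by (intro mult_left_mono power_mono) (auto simp: L_def)
      finally show ?thesis .
    next
      case False
      moreover have "0 \<le> W div k\<^sup>2" using less.prems k by (simp add: pos_imp_zdiv_nonneg_iff)
      ultimately have "W div k\<^sup>2 = 0" by linarith
      then show ?thesis using E0 B0 by simp
    qed
    have "{1..W} = insert 1 {2..W}" using less.prems by auto
    then have "E W = (\<Sum>k\<in>{1..W}. E (W div k\<^sup>2) / (real_of_int k)\<^sup>2) - (\<Sum>k\<in>{2..W}. E (W div k\<^sup>2) / (real_of_int k)\<^sup>2)"
      by simp
    also have "\<bar>\<dots>\<bar> \<le> C1 * (1 + L W) ^ m + B * (3 / 4)"
    proof -
      have "\<bar>\<Sum>k\<in>{2..W}. E (W div k\<^sup>2) / (real_of_int k)\<^sup>2\<bar> \<le> (\<Sum>k\<in>{2..W}. B * (1 / (real_of_int k)\<^sup>2))"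
        by (rule order_trans[OF sum_abs sum_mono]) (use small in \<open>auto simp: abs_divide intro!: divide_right_mono\<close>)
      also have "\<dots> \<le> B * (3 / 4)"
        unfolding sum_distrib_left[symmetric] using sum_inverse_squares_from_2 B0 by (intro mult_left_mono) auto
      finally show ?thesis using Esum[OF less.prems] by linarith
    qed
    also have "\<dots> = B" by (simp add: B_def)
    finally show ?case by (simp add: B_def)
  qed
  show ?thesis
  proof (intro exI[of _ "4 * C1"] conjI allI impI)
    show "0 \<le> 4 * C1" using C1 by simp
    fix W :: int assume "1 \<le> W"
    from bound[OF this] show "\<bar>P W - 6 * \<kappa> / pi\<^sup>2 * ln (real_of_int W) ^ Suc m\<bar> \<le> 4 * C1 * (1 + ln (real_of_int W)) ^ m"
      by (simp only: E_def \<beta>_def L_def)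
  qed
qed

lemma Psum_0: "Psum \<delta> 0 = 0"
proof -
  have "prim_reps \<delta> 0 = {}" using form_pos by (fastforce simp: prim_reps_def)
  then show ?thesis by (simp add: Psum_def)
qed

lemma rho_quotient_sum_asymptotic:
  assumes \<delta>: "\<delta> \<in> {1, -1}"
    and "\<And>W. 1 \<le> W \<Longrightarrow> \<bar>Fsum \<delta> W - \<kappa> * ln (real_of_int W) ^ Suc m\<bar> \<le> C * (1 + ln (real_of_int W)) ^ m"
  shows "\<exists>C'\<ge>0. \<forall>W\<ge>1. \<bar>rho_quotient_sum \<delta> W - 6 * \<kappa> / pi\<^sup>2 * ln (real_of_int W) ^ Suc m\<bar> \<le> C' * (1 + ln (real_of_int W)) ^ m"
  unfolding rho_quotient_sum_eq_Psum[OF \<delta>] by (rule contraction[OF Fsum_eq[OF \<delta>] Psum_0 assms(2)])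

lemma card_prim_reps_le: "\<delta> \<in> {1, -1} \<Longrightarrow> card (prim_reps \<delta> W) \<le> card (reps \<delta> W)"
  by (intro card_mono finite_reps) (auto simp: prim_reps_def reps_def)

text \<open>24 \<kappa> / pi^2 is 4 \<beta> with \<beta> = 6 \<kappa> / pi^2: the factor 2 W times
  two sums that are both \<beta> L^(m+1) to leading order, since halving W only costs one power of L
  = ln W.\<close>

lemma card_mirror_forms_asymptotic:
  assumes \<delta>: "\<delta> \<in> {1, -1}"
    and F: "\<And>W. 1 \<le> W \<Longrightarrow> \<bar>Fsum \<delta> W - \<kappa> * ln (real_of_int W) ^ Suc m\<bar> \<le> C * (1 + ln (real_of_int W)) ^ m"
    and R: "\<And>W. 1 \<le> W \<Longrightarrow> real (card (reps \<delta> W)) \<le> 2 * W * (1 + ln (real_of_int W)) ^ m"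
  shows "\<exists>C'\<ge>0. \<forall>W\<ge>1. \<bar>real (card (mirror_forms \<delta> W)) - 24 * \<kappa> / pi\<^sup>2 * (W * ln (real_of_int W) ^ Suc m)\<bar> \<le> C' * (W * (1 + ln (real_of_int W)) ^ m)"
proof -
  define \<beta> where "\<beta> = 6 * \<kappa> / pi\<^sup>2"
  obtain C1 where C1: "0 \<le> C1" "\<And>W. 1 \<le> W \<Longrightarrow> \<bar>rho_quotient_sum \<delta> W - \<beta> * ln (real_of_int W) ^ Suc m\<bar> \<le> C1 * (1 + ln (real_of_int W)) ^ m"
    using rho_quotient_sum_asymptotic[OF \<delta> F] unfolding \<beta>_def by blast
  define C2 where "C2 = C1 + 2 * real (Suc m) * \<bar>\<beta>\<bar>"
  define C' where "C' = 56 + 2 * (C1 + C2)"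
  show ?thesis
  proof (intro exI[of _ C'] conjI allI impI)
    show "0 \<le> C'" using C1(1) by (simp add: C'_def C2_def)
    fix W :: int assume W: "1 \<le> W"
    define L where "L = ln (real_of_int W)"
    define l where "l = ln (real_of_int (W div 2))"
    define h where "h = (1 + L) ^ m"
    have L: "0 \<le> L" using W by (simp add: L_def)
    have h1: "1 \<le> h" using L by (simp add: h_def)
    have lL: "0 \<le> l" "l \<le> L" using ln_div_power_diff(2,3)[OF W, of 2] by (simp_all add: l_def L_def)
    have a: "\<bar>rho_quotient_sum \<delta> W - \<beta> * L ^ Suc m\<bar> \<le> C1 * h" using C1(2)[OF W] by (simp add: L_def h_def)
    have "\<bar>rho_quotient_sum \<delta> (W div 2) - \<beta> * l ^ Suc m\<bar> \<le> C1 * h"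
    proof (cases "1 \<le> W div 2")
      case True
      have "\<bar>rho_quotient_sum \<delta> (W div 2) - \<beta> * l ^ Suc m\<bar> \<le> C1 * (1 + l) ^ m" using C1(2)[OF True] by (simp add: l_def)
      also have "\<dots> \<le> C1 * h" unfolding h_def using C1(1) lL by (intro mult_left_mono power_mono) auto
      finally show ?thesis .
    next
      case False
      then have "W div 2 = 0" using W by linarith
      then show ?thesis using C1(1) h1 by (simp add: rho_quotient_sum_def l_def)
    qed
    moreover have "\<bar>\<beta> * l ^ Suc m - \<beta> * L ^ Suc m\<bar> \<le> 2 * real (Suc m) * \<bar>\<beta>\<bar> * h"
    proof -
      have "\<bar>l ^ Suc m - L ^ Suc m\<bar> \<le> real (Suc m) * L ^ m * (ln 2 + 1)"
        using ln_div_power_diff(1)[OF W, of 2 m] by (simp add: l_def L_def)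
      also have "\<dots> \<le> real (Suc m) * h * 2"
        unfolding h_def using L ln2_le_1 by (intro mult_mono power_mono mult_nonneg_nonneg zero_le_power) auto
      finally have "\<bar>\<beta>\<bar> * \<bar>l ^ Suc m - L ^ Suc m\<bar> \<le> \<bar>\<beta>\<bar> * (real (Suc m) * h * 2)" by (rule mult_left_mono) simp
      moreover have "\<bar>\<beta> * l ^ Suc m - \<beta> * L ^ Suc m\<bar> = \<bar>\<beta>\<bar> * \<bar>l ^ Suc m - L ^ Suc m\<bar>"
        by (simp only: abs_mult right_diff_distrib[symmetric])
      ultimately show ?thesis by (simp only: mult.assoc mult.commute mult.left_commute)
    qed
    ultimately have b: "\<bar>rho_quotient_sum \<delta> (W div 2) - \<beta> * L ^ Suc m\<bar> \<le> C1 * h + 2 * real (Suc m) * \<bar>\<beta>\<bar> * h"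
      by (rule abs_diff_chain)
    have "\<bar>rho_quotient_sum \<delta> (W div 2) + rho_quotient_sum \<delta> W - 2 * \<beta> * L ^ Suc m\<bar> \<le> (C1 + C2) * h"
      using a b unfolding C2_def distrib_right by linarith
    then have "2 * W * \<bar>rho_quotient_sum \<delta> (W div 2) + rho_quotient_sum \<delta> W - 2 * \<beta> * L ^ Suc m\<bar> \<le> 2 * W * ((C1 + C2) * h)"
      using W by (intro mult_left_mono) auto
    moreover have "2 * W * (rho_quotient_sum \<delta> (W div 2) + rho_quotient_sum \<delta> W) - 4 * \<beta> * (W * L ^ Suc m)
        = 2 * W * (rho_quotient_sum \<delta> (W div 2) + rho_quotient_sum \<delta> W - 2 * \<beta> * L ^ Suc m)" by (simp add: algebra_simps)
    ultimately have 2: "\<bar>2 * W * (rho_quotient_sum \<delta> (W div 2) + rho_quotient_sum \<delta> W) - 4 * \<beta> * (W * L ^ Suc m)\<bar> \<le> 2 * W * ((C1 + C2) * h)"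
      using W by (simp only: abs_mult)
    have 1: "\<bar>real (card (mirror_forms \<delta> W)) - 2 * W * (rho_quotient_sum \<delta> (W div 2) + rho_quotient_sum \<delta> W)\<bar> \<le> 56 * (W * h)"
    proof -
      have "rho_sum \<delta> W \<le> 2 * W * h"
        using card_prim_reps_le[OF \<delta>, of W] R[OF W] by (simp add: rho_sum_eq_card[OF \<delta>] h_def L_def)
      moreover have "1 * 1 \<le> W * h" using W h1 by (intro mult_mono) auto
      ultimately show ?thesis using card_mirror_forms_approx[OF \<delta>, of W] W by linarith
    qed
    have "\<bar>real (card (mirror_forms \<delta> W)) - 4 * \<beta> * (W * L ^ Suc m)\<bar> \<le> 56 * (W * h) + 2 * W * ((C1 + C2) * h)"
      by (rule abs_diff_chain[OF 1 2])
    also have "\<dots> = C' * (W * h)" by (simp add: C'_def algebra_simps)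
    also have "4 * \<beta> = 24 * \<kappa> / pi\<^sup>2" by (simp add: \<beta>_def)
    finally show "\<bar>real (card (mirror_forms \<delta> W)) - 24 * \<kappa> / pi\<^sup>2 * (W * ln (real_of_int W) ^ Suc m)\<bar> \<le> C' * (W * (1 + ln (real_of_int W)) ^ m)"
      by (simp only: L_def h_def)
  qed
qed

lemma card_mirror_forms_plus_asymptotic:
  "\<exists>C\<ge>0. \<forall>W\<ge>1. \<bar>real (card (mirror_forms 1 W)) - 24 * (1/2) / pi\<^sup>2 * (W * ln (real_of_int W) ^ Suc 1)\<bar> \<le> C * (W * (1 + ln (real_of_int W)) ^ 1)"
proof -
  have "real (card (reps 1 W)) \<le> 2 * W * (1 + ln (real_of_int W)) ^ 1" if "1 \<le> W" for W
    using card_reps_plus_le[OF that] by simp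
  note R = this
  have "1 \<in> {1, -1 :: int}" by simp
  from card_mirror_forms_asymptotic[OF this Fsum_plus R] show ?thesis .
qed

lemma card_mirror_forms_minus_asymptotic:
  "\<exists>C\<ge>0. \<forall>W\<ge>1. \<bar>real (card (mirror_forms (-1) W)) - 24 * (pi / 4) / pi\<^sup>2 * (W * ln (real_of_int W) ^ Suc 0)\<bar> \<le> C * (W * (1 + ln (real_of_int W)) ^ 0)"
proof -
  have "real (card (reps (-1) W)) \<le> 2 * W * (1 + ln (real_of_int W)) ^ 0" if "1 \<le> W" for W
    using card_reps_minus_le[OF that] by simp
  note R = this
  have "-1 \<in> {1, -1 :: int}" by simp
  from card_mirror_forms_asymptotic[OF this Fsum_minus R] show ?thesis .
qed

section \<open>From the trace bound back to the length s\<close>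

section \<open>Asymptotics\<close>

text \<open>The trace bounds \<open>\<lfloor>2 * cosh (s / 2)\<rfloor>\<close> and
  \<open>\<lfloor>2 * sinh (s / 4)\<rfloor>\<close> are within 2 of exp (s / 2) and exp (s / 4);
  these estimates allow them to be replaced by the exponentials.\<close>

lemma near_power_log:
  fixes x W :: real
  assumes "4 \<le> x" "\<bar>W - x\<bar> \<le> 2"
  shows "\<bar>W * ln W ^ Suc m - x * ln x ^ Suc m\<bar> \<le> real (m + 3) * (x * (1 + ln x) ^ m)"
    "W * (1 + ln W) ^ m \<le> 2 * 2 ^ m * (x * (1 + ln x) ^ m)" "2 \<le> W" "W \<le> 2 * x"
proof -
  have W: "x / 2 \<le> W" "W \<le> 2 * x" using assms by auto
  then show W2: "2 \<le> W" "W \<le> 2 * x" using assms by auto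
  define L l where "L = ln W" "l = ln x"
  have l0: "0 \<le> l" and L0: "0 \<le> L" using assms W2 by (simp_all add: L_l_def)
  have "ln (x / 2) \<le> L" "L \<le> ln (2 * x)" using W assms by (simp_all add: L_l_def)
  then have near: "\<bar>L - l\<bar> \<le> 1" using ln2_le_1 assms by (simp add: L_l_def ln_div ln_mult)
  have "L ^ Suc m \<le> (1 + l) ^ Suc m" using near L0 by (intro power_mono) auto
  \<comment> \<open>W - x is bounded, so one factor 1 + ln x may be traded for x.\<close>
  also have "\<dots> \<le> x * (1 + l) ^ m"
    using ln_le_minus_one[of x] assms l0 by (simp add: L_l_def mult_right_mono)
  finally have 1: "L ^ Suc m \<le> x * (1 + l) ^ m" .
  have "\<bar>W * L ^ Suc m - x * l ^ Suc m\<bar> = \<bar>(W - x) * L ^ Suc m + x * (L ^ Suc m - l ^ Suc m)\<bar>"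
    by (simp add: algebra_simps)
  also have "\<dots> \<le> \<bar>W - x\<bar> * L ^ Suc m + x * \<bar>L ^ Suc m - l ^ Suc m\<bar>"
    using abs_triangle_ineq[of "(W - x) * L ^ Suc m" "x * (L ^ Suc m - l ^ Suc m)"] L0 assms by (simp add: abs_mult)
  also have "\<dots> \<le> 2 * (x * (1 + l) ^ m) + x * (real (Suc m) * (1 + l) ^ m * 1)"
    using assms 1 L0 l0 near by (intro add_mono mult_mono abs_power_diff_le order_refl) auto
  also have "\<dots> = real (m + 3) * (x * (1 + l) ^ m)" by (simp add: algebra_simps)
  finally show "\<bar>W * ln W ^ Suc m - x * ln x ^ Suc m\<bar> \<le> real (m + 3) * (x * (1 + ln x) ^ m)" by (simp only: L_l_def)
  have "W * (1 + L) ^ m \<le> (2 * x) * (2 * (1 + l)) ^ m"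
    using W2 near L0 l0 by (intro mult_mono power_mono) auto
  also have "\<dots> = 2 * 2 ^ m * (x * (1 + l) ^ m)" by (simp only: power_mult_distrib ac_simps)
  finally show "W * (1 + ln W) ^ m \<le> 2 * 2 ^ m * (x * (1 + ln x) ^ m)" by (simp only: L_l_def)
qed

lemma card_mirror_forms_near:
  assumes "0 \<le> C" "\<And>W. 1 \<le> W \<Longrightarrow> \<bar>real (card (mirror_forms \<delta> W)) - \<alpha> * (W * ln (real_of_int W) ^ Suc m)\<bar> \<le> C * (W * (1 + ln (real_of_int W)) ^ m)"
    and x: "4 \<le> x" "\<bar>real_of_int W - x\<bar> \<le> 2"
  shows "\<bar>real (card (mirror_forms \<delta> W)) - \<alpha> * (x * ln x ^ Suc m)\<bar> \<le> (C * (2 * 2 ^ m) + \<bar>\<alpha>\<bar> * real (m + 3)) * (x * (1 + ln x) ^ m)"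
proof -
  note n = near_power_log(1,2)[OF x, where m = m] near_power_log(3,4)[OF x]
  have W: "1 \<le> W" using n(3) by simp
  have "C * (W * (1 + ln (real_of_int W)) ^ m) \<le> C * (2 * 2 ^ m * (x * (1 + ln x) ^ m))"
    using n(2) assms(1) by (rule mult_left_mono)
  then have 1: "\<bar>real (card (mirror_forms \<delta> W)) - \<alpha> * (W * ln (real_of_int W) ^ Suc m)\<bar> \<le> C * (2 * 2 ^ m * (x * (1 + ln x) ^ m))"
    using assms(2)[OF W] by linarith
  have "\<bar>\<alpha>\<bar> * \<bar>W * ln (real_of_int W) ^ Suc m - x * ln x ^ Suc m\<bar> \<le> \<bar>\<alpha>\<bar> * (real (m + 3) * (x * (1 + ln x) ^ m))"
    using n(1) by (rule mult_left_mono) simp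
  then have 2: "\<bar>\<alpha> * (W * ln (real_of_int W) ^ Suc m) - \<alpha> * (x * ln x ^ Suc m)\<bar> \<le> \<bar>\<alpha>\<bar> * (real (m + 3) * (x * (1 + ln x) ^ m))"
    by (simp only: abs_mult[symmetric] right_diff_distrib)
  show ?thesis using abs_diff_chain[OF 1 2] by (simp add: algebra_simps)
qed

text \<open>a ln x is the logarithm of \<open>x powr a\<close>, hence at most
  \<open>x powr a - 1\<close>: any positive power absorbs a logarithm.\<close>

lemma one_plus_ln_le: "1 \<le> x \<Longrightarrow> 0 < a \<Longrightarrow> a \<le> 1 \<Longrightarrow> 1 + ln x \<le> x powr a / a" for x a :: real
proof -
  assume *: "1 \<le> x" "0 < a" "a \<le> 1"
  have "a * ln x = ln (x powr a)" using * by (simp add: ln_powr)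
  also have "\<dots> \<le> x powr a - 1" using * by (intro ln_le_minus_one) simp
  finally have "a * (1 + ln x) \<le> x powr a" using * by (simp add: algebra_simps)
  then show ?thesis using * by (simp add: pos_le_divide_eq mult.commute)
qed

text \<open>The exponent 5/4 has to be above 1, to absorb the logarithms, and below 3/2, so that
  roots of trace up to x^(2/3) are fewer than x.\<close>

lemma card_mirror_forms_plus_powr:
  assumes "0 \<le> C" "\<And>W. 1 \<le> W \<Longrightarrow> \<bar>real (card (mirror_forms 1 W)) - \<alpha> * (W * ln (real_of_int W) ^ Suc 1)\<bar> \<le> C * (W * (1 + ln (real_of_int W)) ^ 1)"
    and V: "1 \<le> V"
  shows "real (card (mirror_forms 1 V)) \<le> (64 * (C + \<bar>\<alpha>\<bar>)) * V powr (5/4)"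
proof -
  define L where "L = ln (real_of_int V)"
  have L: "0 \<le> L" using V by (simp add: L_def)
  have "\<alpha> * (V * L\<^sup>2) \<le> \<bar>\<alpha>\<bar> * (V * (1 + L)\<^sup>2)"
    using V L by (intro mult_mono power_mono) auto
  moreover have "C * (V * (1 + L)) \<le> C * (V * (1 + L)\<^sup>2)"
    using V L assms(1) by (intro mult_left_mono) (auto simp: power2_eq_square mult_le_cancel_left1)
  moreover have "\<bar>real (card (mirror_forms 1 V)) - \<alpha> * (V * L\<^sup>2)\<bar> \<le> C * (V * (1 + L))"
    using assms(2)[OF V] by (simp add: L_def power2_eq_square)
  ultimately have "real (card (mirror_forms 1 V)) \<le> (C + \<bar>\<alpha>\<bar>) * (V * (1 + L)\<^sup>2)"
    unfolding distrib_right by linarith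
  moreover have "(1 + L)\<^sup>2 \<le> 64 * V powr (1/4)"
  proof -
    \<comment> \<open>The exponent 1/8 becomes 1/4 after squaring, and the constant is 8^2 =
      64.\<close>
    have "(1 + L)\<^sup>2 \<le> (V powr (1/8) / (1/8))\<^sup>2"
      using one_plus_ln_le[of "real_of_int V" "1/8"] L V by (intro power_mono) (auto simp: L_def)
    also have "\<dots> = 64 * V powr (1/4)"
      by (simp add: power2_eq_square flip: powr_add)
    finally show ?thesis .
  qed
  then have "(C + \<bar>\<alpha>\<bar>) * (V * (1 + L)\<^sup>2) \<le> (C + \<bar>\<alpha>\<bar>) * (V * (64 * V powr (1/4)))"
    using assms(1) V by (intro mult_left_mono) auto
  ultimately have "real (card (mirror_forms 1 V)) \<le> (C + \<bar>\<alpha>\<bar>) * (V * (64 * V powr (1/4)))" by linarith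
  moreover have "V * V powr (1/4) = V powr (5/4)"
  proof -
    have "V powr (1 + 1/4) = V powr 1 * V powr (1/4)" by (rule powr_add)
    then show ?thesis using V by simp
  qed
  moreover have "(C + \<bar>\<alpha>\<bar>) * (V * (64 * V powr (1/4))) = (64 * (C + \<bar>\<alpha>\<bar>)) * (V * V powr (1/4))"
    by (simp only: ac_simps)
  ultimately show ?thesis by (simp only:)
qed

text \<open>This limits the exponents of proper powers. As ln 2 >= 1 / 2, the first part of the
  exponent already gives x^2, and the additional 4 gives 16 > 8; the bound 8 x^2 covers both 2 x and
  (2 x)^2 + 2, the traces in the two applications.\<close>

lemma power_two_bound:
  assumes "4 \<le> (x::real)"
  shows "8 * x\<^sup>2 < 2 ^ (nat \<lceil>4 * ln x\<rceil> + 4)" "real (nat \<lceil>4 * ln x\<rceil> + 4) \<le> 5 * (1 + ln x)"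
proof -
  have l: "0 \<le> ln x" using assms by simp
  define k where "k = nat \<lceil>4 * ln x\<rceil>"
  have k: "4 * ln x \<le> k" "k \<le> 4 * ln x + 1" using l unfolding k_def by linarith+
  have "x\<^sup>2 = exp (2 * ln x)" using assms by (simp add: exp_double)
  also have "\<dots> \<le> exp (k * ln 2)"
  proof -
    have "4 * ln x * (1 / 2) \<le> k * ln 2" using k l ln2_ge_two_thirds by (intro mult_mono) auto
    then show ?thesis by simp
  qed
  also have "\<dots> = 2 ^ k" by (simp add: exp_of_nat_mult)
  finally have "8 * x\<^sup>2 < 16 * 2 ^ k" by (smt (verit) zero_less_power)
  then show "8 * x\<^sup>2 < 2 ^ (nat \<lceil>4 * ln x\<rceil> + 4)" by (simp add: k_def power_add)
  show "real (nat \<lceil>4 * ln x\<rceil> + 4) \<le> 5 * (1 + ln x)" using k l by (simp flip: k_def)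
qed

text \<open>Applied with a = 1/2 for square roots of a trace of order x and with a = 2/3 for cube
  roots of a trace of order x^2; the resulting exponents 5/8 and 5/6 are below 1.\<close>

lemma nonprimitive_negligible:
  obtains C where "0 \<le> C"
    "\<And>x a. 4 \<le> x \<Longrightarrow> 0 \<le> a \<Longrightarrow> real ((nat \<lceil>4 * ln x\<rceil> + 4) * card (mirror_forms 1 \<lfloor>3 * x powr a\<rfloor>)) \<le> C * ((1 + ln x) * x powr (5/4 * a))"
proof -
  obtain C where C: "0 \<le> C" "\<And>W. 1 \<le> W \<Longrightarrow> \<bar>real (card (mirror_forms 1 W)) - 24 * (1/2) / pi\<^sup>2 * (W * ln (real_of_int W) ^ Suc 1)\<bar> \<le> C * (W * (1 + ln (real_of_int W)) ^ 1)"
    using card_mirror_forms_plus_asymptotic by blast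
  define D where "D = 64 * (C + \<bar>24 * (1/2) / pi\<^sup>2\<bar>)"
  have D: "0 \<le> D" using C(1) by (simp add: D_def)
  show ?thesis
  proof
    show "0 \<le> 5 * (D * 3 powr (5/4))" using D by simp
    fix x a :: real assume x: "4 \<le> x" and a: "0 \<le> a"
    have X: "1 \<le> x powr a" using x a by (intro ge_one_powr_ge_zero) auto
    define V where "V = \<lfloor>3 * x powr a\<rfloor>"
    have V: "1 \<le> V" "V \<le> 3 * x powr a" using X unfolding V_def by linarith+
    have "real (card (mirror_forms 1 V)) \<le> D * V powr (5/4)"
      unfolding D_def by (rule card_mirror_forms_plus_powr[OF C V(1)])
    also have "\<dots> \<le> D * (3 * x powr a) powr (5/4)" using D V by (intro mult_left_mono powr_mono2) auto
    also have "(3 * x powr a) powr (5/4) = 3 powr (5/4) * x powr (5/4 * a)" using x by (simp add: powr_mult powr_powr mult.commute)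
    finally have "real (card (mirror_forms 1 V)) \<le> D * 3 powr (5/4) * x powr (5/4 * a)" by simp
    then have "real (nat \<lceil>4 * ln x\<rceil> + 4) * real (card (mirror_forms 1 V)) \<le> 5 * (1 + ln x) * (D * 3 powr (5/4) * x powr (5/4 * a))"
      using power_two_bound(2)[OF x] x by (intro mult_mono) auto
    then show "real ((nat \<lceil>4 * ln x\<rceil> + 4) * card (mirror_forms 1 \<lfloor>3 * x powr a\<rfloor>)) \<le> 5 * (D * 3 powr (5/4)) * ((1 + ln x) * x powr (5/4 * a))"
      by (simp add: V_def algebra_simps)
  qed
qed

lemma card_split: "finite A \<Longrightarrow> real (card {x \<in> A. P x}) = real (card A) - real (card {x \<in> A. \<not> P x})"
proof -
  assume "finite A"
  then have "card A = card {x \<in> A. P x} + card {x \<in> A. \<not> P x}"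
    by (subst card_Un_disjoint[symmetric]) (auto intro!: arg_cong[of _ _ card])
  then show ?thesis by simp
qed

text \<open>t - 1 is at most \<open>2 * x powr a\<close>, and \<open>x powr a \<ge> 1\<close>
  absorbs the remaining 1, whence the factor 3.\<close>

lemma root_bound:
  fixes t B :: int and x a :: real
  assumes "2 < t" "(t - 1) ^ n \<le> B" "real_of_int B \<le> (2 * x powr a) ^ n" "0 < n" "1 \<le> x" "0 \<le> a"
  shows "t \<le> \<lfloor>3 * x powr a\<rfloor>"
proof -
  have "real_of_int ((t - 1) ^ n) \<le> real_of_int B" using assms(2) by (simp only: of_int_le_iff)
  then have "(real_of_int (t - 1)) ^ n \<le> (2 * x powr a) ^ n" using assms(3) by simp
  then have "real_of_int (t - 1) \<le> 2 * x powr a" using assms(1,4) by (subst (asm) power_mono_iff) auto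
  moreover have "1 \<le> x powr a" using assms by (intro ge_one_powr_ge_zero) auto
  ultimately show ?thesis by (simp add: le_floor_iff)
qed

text \<open>With x = exp (s / 2) and ln x = s / 2 the main term (12 / pi^2) x (ln x)^2 is (3 / pi^2)
  s^2 x, and each class is counted four times.\<close>

lemma ambiguous_count:
  obtains C where "\<And>s. 12 \<le> s \<Longrightarrow> \<bar>real (N_A s) - 3 / (4 * pi\<^sup>2) * s\<^sup>2 * exp (s / 2)\<bar> \<le> C * (s * exp (s / 2))"
proof -
  obtain C where C: "0 \<le> C" "\<And>W. 1 \<le> W \<Longrightarrow> \<bar>real (card (mirror_forms 1 W)) - 24 * (1/2) / pi\<^sup>2 * (W * ln (real_of_int W) ^ Suc 1)\<bar> \<le> C * (W * (1 + ln (real_of_int W)) ^ 1)"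
    using card_mirror_forms_plus_asymptotic by blast
  obtain D where D: "0 \<le> D" "\<And>x a. 4 \<le> x \<Longrightarrow> 0 \<le> a \<Longrightarrow> real ((nat \<lceil>4 * ln x\<rceil> + 4) * card (mirror_forms 1 \<lfloor>3 * x powr a\<rfloor>)) \<le> D * ((1 + ln x) * x powr (5/4 * a))"
    using nonprimitive_negligible by blast
  define E where "E = C * (2 * 2 ^ 1) + \<bar>24 * (1/2) / pi\<^sup>2\<bar> * real (1 + 3)"
  have E: "0 \<le> E" using C(1) by (simp add: E_def)
  have "\<bar>real (N_A s) - 3 / (4 * pi\<^sup>2) * s\<^sup>2 * exp (s / 2)\<bar> \<le> (E + D) * (s * exp (s / 2))" if s: "12 \<le> s" for s
  proof -
    define x where "x = exp (s / 2)"
    have x: "4 \<le> x" using exp_ge_add_one_self[of "s / 2"] s unfolding x_def by linarith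
    have lx: "ln x = s / 2" by (simp add: x_def)
    define W where "W = \<lfloor>2 * cosh (s / 2)\<rfloor>"
    have "2 * cosh (s / 2) = x + 1 / x" by (simp add: cosh_def x_def exp_minus inverse_eq_divide)
    moreover have "0 < 1 / x" "1 / x \<le> 1" using x by auto
    ultimately have Wx: "\<bar>real_of_int W - x\<bar> \<le> 2" unfolding W_def by linarith
    have W2: "2 \<le> real_of_int W" "real_of_int W \<le> 2 * x" using near_power_log(3,4)[OF x Wx] by auto
    let ?bad = "card {y \<in> mirror_forms 1 W. \<not> prim_rep (snd y)}"
    have "?bad \<le> (nat \<lceil>4 * ln x\<rceil> + 4) * card (mirror_forms 1 \<lfloor>3 * x powr (1/2)\<rfloor>)"
    proof (rule card_nonprimitive_le)
      fix t assume t: "2 < t" "(t - 1)\<^sup>2 \<le> W"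
      have "(2 * x powr (1/2))\<^sup>2 = 4 * x" using x by (simp add: power_mult_distrib powr_half_sqrt)
      then show "t \<le> \<lfloor>3 * x powr (1/2)\<rfloor>" using W2 x by (intro root_bound[OF t]) auto
    next
      have "2 * x \<le> 8 * x\<^sup>2" using x by (simp add: power2_eq_square)
      then have "real_of_int W < 2 ^ (nat \<lceil>4 * ln x\<rceil> + 4)" using power_two_bound(1)[OF x] W2 by linarith
      then have "real_of_int W < real_of_int (2 ^ (nat \<lceil>4 * ln x\<rceil> + 4))" by simp
      then show "W < 2 ^ (nat \<lceil>4 * ln x\<rceil> + 4)" by (simp only: of_int_less_iff)
    qed
    then have "real ?bad \<le> real ((nat \<lceil>4 * ln x\<rceil> + 4) * card (mirror_forms 1 \<lfloor>3 * x powr (1/2)\<rfloor>))" by (simp only: of_nat_le_iff)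
    also have "\<dots> \<le> D * ((1 + ln x) * x powr (5/4 * (1/2)))" by (rule D(2)[OF x]) simp
    also have "x powr (5/4 * (1/2)) \<le> x powr 1" using x by (intro powr_mono) auto
    finally have bad: "real ?bad \<le> D * ((1 + ln x) * x)" using D(1) x by (auto simp: mult_left_mono)
    have tot: "\<bar>real (card (mirror_forms 1 W)) - 24 * (1/2) / pi\<^sup>2 * (x * ln x ^ Suc 1)\<bar> \<le> E * (x * (1 + ln x))"
      using card_mirror_forms_near[OF C x Wx] by (simp add: E_def)
    have "4 * real (N_A s) = real (card (mirror_forms 1 W)) - real ?bad"
      using N_A_eq_card[of s] card_split[OF finite_mirror_forms[of 1 W], of "\<lambda>y. prim_rep (snd y)"] s unfolding W_def by simp
    then have "\<bar>4 * real (N_A s) - 24 * (1/2) / pi\<^sup>2 * (x * ln x ^ Suc 1)\<bar> \<le> E * (x * (1 + ln x)) + D * ((1 + ln x) * x)"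
      using tot bad by linarith
    also have "\<dots> = (E + D) * ((1 + s / 2) * x)" by (simp add: lx algebra_simps)
    also have "\<dots> \<le> (E + D) * (4 * (s * x))"
    proof -
      have "(1 + s / 2) * x \<le> (4 * s) * x" using s x by (intro mult_right_mono) auto
      then show ?thesis using E D(1) by (intro mult_left_mono) auto
    qed
    finally have "\<bar>4 * real (N_A s) - 24 * (1/2) / pi\<^sup>2 * (x * ln x ^ Suc 1)\<bar> \<le> 4 * ((E + D) * (s * x))" by simp
    moreover have "24 * (1/2) / pi\<^sup>2 * (x * ln x ^ Suc 1) = 4 * (3 / (4 * pi\<^sup>2) * s\<^sup>2 * x)"
      by (simp add: lx power2_eq_square)
    ultimately have "\<bar>4 * (real (N_A s) - 3 / (4 * pi\<^sup>2) * s\<^sup>2 * x)\<bar> \<le> 4 * ((E + D) * (s * x))"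
      by (simp only: right_diff_distrib)
    then show ?thesis unfolding abs_mult x_def by simp
  qed
  then show ?thesis using that by blast
qed

text \<open>With x = exp (s / 4) and ln x = s / 4 the main term (6 / pi) x ln x is (3 / (2 pi)) s x,
  and each class is counted four times.\<close>

lemma ambiguous_reciprocal_count:
  obtains C where "\<And>s. 12 \<le> s \<Longrightarrow> \<bar>real (N_AR s) - 3 / (8 * pi) * s * exp (s / 4)\<bar> \<le> C * exp (s / 4)"
proof -
  obtain C where C: "0 \<le> C" "\<And>W. 1 \<le> W \<Longrightarrow> \<bar>real (card (mirror_forms (-1) W)) - 24 * (pi / 4) / pi\<^sup>2 * (W * ln (real_of_int W) ^ Suc 0)\<bar> \<le> C * (W * (1 + ln (real_of_int W)) ^ 0)"
    using card_mirror_forms_minus_asymptotic by blast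
  obtain D where D: "0 \<le> D" "\<And>x a. 4 \<le> x \<Longrightarrow> 0 \<le> a \<Longrightarrow> real ((nat \<lceil>4 * ln x\<rceil> + 4) * card (mirror_forms 1 \<lfloor>3 * x powr a\<rfloor>)) \<le> D * ((1 + ln x) * x powr (5/4 * a))"
    using nonprimitive_negligible by blast
  define E where "E = C * (2 * 2 ^ 0) + \<bar>24 * (pi / 4) / pi\<^sup>2\<bar> * real (0 + 3)"
  have "\<bar>real (N_AR s) - 3 / (8 * pi) * s * exp (s / 4)\<bar> \<le> ((E + 6 * D) / 4) * exp (s / 4)" if s: "12 \<le> s" for s
  proof -
    define x where "x = exp (s / 4)"
    \<comment> \<open>The threshold 12 for s is the value at which 1 + s / 4 reaches 4.\<close>
    have x: "4 \<le> x" using exp_ge_add_one_self[of "s / 4"] s unfolding x_def by linarith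
    have lx: "ln x = s / 4" by (simp add: x_def)
    define W where "W = \<lfloor>2 * sinh (s / 4)\<rfloor>"
    have "2 * sinh (s / 4) = x - 1 / x" by (simp add: sinh_def x_def exp_minus inverse_eq_divide)
    moreover have "0 < 1 / x" "1 / x \<le> 1" using x by auto
    ultimately have Wx: "\<bar>real_of_int W - x\<bar> \<le> 2" unfolding W_def by linarith
    have W2: "2 \<le> real_of_int W" "real_of_int W \<le> 2 * x" using near_power_log(3,4)[OF x Wx] by auto
    have "(real_of_int W)\<^sup>2 \<le> (2 * x)\<^sup>2" using W2 by (intro power_mono) auto
    moreover have "4\<^sup>2 \<le> x\<^sup>2" using x by (intro power_mono) auto
    ultimately have W8: "real_of_int (W\<^sup>2 + 2) \<le> 8 * x\<^sup>2" by (simp add: power_mult_distrib)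
    let ?bad = "card {y \<in> mirror_forms (-1) W. \<not> prim_rep (snd y * snd y)}"
    have "?bad \<le> (nat \<lceil>4 * ln x\<rceil> + 4) * card (mirror_forms 1 \<lfloor>3 * x powr (2/3)\<rfloor>)"
    proof (rule card_nonprimitive_square_le)
      fix t assume t: "2 < t" "(t - 1) ^ 3 \<le> W\<^sup>2 + 2"
      have "(x powr (2/3)) ^ 3 = (x powr (2/3)) powr real 3"
        using x by (intro powr_realpow[symmetric]) simp
      also have "\<dots> = x\<^sup>2" using x by (simp add: powr_powr)
      finally have "(2 * x powr (2/3)) ^ 3 = 8 * x\<^sup>2" by (simp add: power_mult_distrib)
      then show "t \<le> \<lfloor>3 * x powr (2/3)\<rfloor>" using W8 x by (intro root_bound[OF t]) auto
    next
      have "real_of_int (W\<^sup>2 + 2) < 2 ^ (nat \<lceil>4 * ln x\<rceil> + 4)" using power_two_bound(1)[OF x] W8 by linarith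
      then have "real_of_int (W\<^sup>2 + 2) < real_of_int (2 ^ (nat \<lceil>4 * ln x\<rceil> + 4))" by simp
      then show "W\<^sup>2 + 2 < 2 ^ (nat \<lceil>4 * ln x\<rceil> + 4)" by (simp only: of_int_less_iff)
    qed
    then have "real ?bad \<le> real ((nat \<lceil>4 * ln x\<rceil> + 4) * card (mirror_forms 1 \<lfloor>3 * x powr (2/3)\<rfloor>))" by (simp only: of_nat_le_iff)
    also have "\<dots> \<le> D * ((1 + ln x) * x powr (5/4 * (2/3)))" by (rule D(2)[OF x]) simp
    also have "\<dots> \<le> D * (6 * x)"
    proof (rule mult_left_mono[OF _ D(1)])
      \<comment> \<open>The exponent is 5/6; the missing 1/6 absorbs the logarithm at the cost of a
        factor 6.\<close>
      have "(1 + ln x) * x powr (5/4 * (2/3)) \<le> (x powr (1/6) / (1/6)) * x powr (5/6)"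
        using one_plus_ln_le[of x "1/6"] x by (intro mult_mono) auto
      also have "\<dots> = 6 * x" using x by (simp flip: powr_add)
      finally show "(1 + ln x) * x powr (5/4 * (2/3)) \<le> 6 * x" .
    qed
    finally have bad: "real ?bad \<le> D * (6 * x)" .
    have tot: "\<bar>real (card (mirror_forms (-1) W)) - 24 * (pi / 4) / pi\<^sup>2 * (x * ln x ^ Suc 0)\<bar> \<le> E * x"
      using card_mirror_forms_near[OF C x Wx] by (simp add: E_def)
    have "4 * real (N_AR s) = real (card (mirror_forms (-1) W)) - real ?bad"
      using N_AR_eq_card[of s] card_split[OF finite_mirror_forms[of "-1" W], of "\<lambda>y. prim_rep (snd y * snd y)"] s unfolding W_def by simp
    then have "\<bar>4 * real (N_AR s) - 24 * (pi / 4) / pi\<^sup>2 * (x * ln x ^ Suc 0)\<bar> \<le> E * x + D * (6 * x)"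
      using tot bad by linarith
    also have "\<dots> = 4 * ((E + 6 * D) / 4 * x)" by (simp add: algebra_simps)
    finally have "\<bar>4 * real (N_AR s) - 24 * (pi / 4) / pi\<^sup>2 * (x * ln x ^ Suc 0)\<bar> \<le> 4 * ((E + 6 * D) / 4 * x)" .
    moreover have "24 * (pi / 4) / pi\<^sup>2 * (x * ln x ^ Suc 0) = 4 * (3 / (8 * pi) * s * x)"
      by (simp add: lx power2_eq_square)
    ultimately have "\<bar>4 * (real (N_AR s) - 3 / (8 * pi) * s * x)\<bar> \<le> 4 * ((E + 6 * D) / 4 * x)"
      by (simp only: right_diff_distrib)
    then show ?thesis unfolding abs_mult x_def by simp
  qed
  then show ?thesis using that by blast
qed

theorem theorem14:
  shows "(\<lambda>s::real. real (N_A s) - 3 / (4 * pi\<^sup>2) * s\<^sup>2 * exp (s / 2)) \<in> O[at_top](\<lambda>s. s * exp (s / 2))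
       \<and> (\<lambda>s::real. real (N_AR s) - 3 / (8 * pi) * s * exp (s / 4)) \<in> O[at_top](\<lambda>s. exp (s / 4))"
proof
  obtain C where C: "\<And>s. 12 \<le> s \<Longrightarrow> \<bar>real (N_A s) - 3 / (4 * pi\<^sup>2) * s\<^sup>2 * exp (s / 2)\<bar> \<le> C * (s * exp (s / 2))"
    using ambiguous_count by blast
  show "(\<lambda>s::real. real (N_A s) - 3 / (4 * pi\<^sup>2) * s\<^sup>2 * exp (s / 2)) \<in> O[at_top](\<lambda>s. s * exp (s / 2))"
  proof (rule bigoI)
    show "\<forall>\<^sub>F s in at_top. norm (real (N_A s) - 3 / (4 * pi\<^sup>2) * s\<^sup>2 * exp (s / 2)) \<le> C * norm (s * exp (s / 2))"
      using eventually_ge_at_top[of "12::real"] by eventually_elim (use C in \<open>simp add: abs_mult\<close>)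
  qed
next
  obtain C where C: "\<And>s. 12 \<le> s \<Longrightarrow> \<bar>real (N_AR s) - 3 / (8 * pi) * s * exp (s / 4)\<bar> \<le> C * exp (s / 4)"
    using ambiguous_reciprocal_count by blast
  show "(\<lambda>s::real. real (N_AR s) - 3 / (8 * pi) * s * exp (s / 4)) \<in> O[at_top](\<lambda>s. exp (s / 4))"
  proof (rule bigoI)
    show "\<forall>\<^sub>F s in at_top. norm (real (N_AR s) - 3 / (8 * pi) * s * exp (s / 4)) \<le> C * norm (exp (s / 4))"
      using eventually_ge_at_top[of "12::real"] by eventually_elim (use C in simp)
  qed
qed

end
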